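(* Let $A$ and $B$ be rings, $\mathcal{C}$ an $A$-coring, and $\Sigma\in{}_B\mathcal{M}^{\mathcal{C}}_{\rm fgp}$. Consider the Morita context $\mathbb{C}=(T,{}^*\mathcal{C},\Sigma,Q,\tau,\mu)$ associated to $\Sigma$ (see context). If $\mathcal{C}$ is right coFrobenius, then there exists a monomorphism of $(A,B)$-bimodules $J:\Sigma^*\to Q$. Conversely, suppose that $\mathcal{C}$ is locally projective as a left $A$-module, $({}^*\mathcal{C})^{\rm rat}$ is dense in ${}^*\mathcal{C}$ in the finite topology, $l:B\to T$, $l(b)(u)=bu$, is an isomorphism, $\tau$ is surjective, and the equivalent conditions (i)–(ix) listed in the context are satisfied. If there exists a monomorphism of $(A,B)$-bimodules $J:\Sigma^*\to Q$, then $\mathcal{C}$ is right coFrobenius.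
   Context: An $A$-coring is an $A$-bimodule $\mathcal{C}$ with $A$-bimodule maps $\Delta:\mathcal{C}\to\mathcal{C}\otimes_A\mathcal{C}$, $\Delta(c)=c_{(1)}\otimes_A c_{(2)}$ (coassociative) and $\varepsilon:\mathcal{C}\to A$ (counit). Right $\mathcal{C}$-comodules are right $A$-modules with a right $A$-linear, coassociative, counital coaction $m\mapsto m_{[0]}\otimes_A m_{[1]}$; morphisms are right $A$-linear maps commuting with coactions; category $\mathcal{M}^{\mathcal{C}}$, with $\mathrm{Hom}^{\mathcal{C}}$, $\mathrm{End}^{\mathcal{C}}$; left comodules and ${}^{\mathcal{C}}\mathrm{Hom}$ symmetrically. $\Sigma\in{}_B\mathcal{M}^{\mathcal{C}}_{\rm fgp}$ means: $\Sigma$ is a $(B,A)$-bimodule, finitely generated projective as a right $A$-module, and a right $\mathcal{C}$-comodule with left $B$-linear coaction. $\Sigma^*=\mathrm{Hom}_A(\Sigma,A)$ is an $(A,B)$-bimodule via $(afb)(u)=af(bu)$. ${}^*\mathcal{C}={}_A\mathrm{Hom}(\mathcal{C},A)$ is a ring with $(f\#g)(c)=g(c_{(1)}f(c_{(2)}))$, and an $A$-bimodule via $(afb)(c)=f(ca)b$. $\mathcal{C}$ is an $(A,{}^*\mathcal{C})$-bimodule via $c\cdot f=c_{(1)}f(c_{(2)})$. $\mathcal{C}$ is locally projective as a left $A$-module if for every finite $D\subset\mathcal{C}$ there are finitely many $c_i^*\in{}^*\mathcal{C}$, $c_i\in\mathcal{C}$ with $d=\sum_i c_i^*(d)c_i$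 for all $d\in D$. $\mathcal{C}$ is right coFrobenius if it is locally projective as a left $A$-module and there is an injective $(A,{}^*\mathcal{C})$-bimodule map $j:\mathcal{C}\to{}^*\mathcal{C}$. With dual basis $\sum_i e_i\otimes_A f_i$ of $\Sigma$, $\Sigma^*$ is a left $\mathcal{C}$-comodule via $f\mapsto\sum_i f(e_{i[0]})e_{i[1]}\otimes_A f_i$. The context $\mathbb{C}$: $T=\mathrm{End}^{\mathcal{C}}(\Sigma)$; $Q={}^{\mathcal{C}}\mathrm{Hom}(\mathcal{C},\Sigma^* )$ is a $({}^*\mathcal{C},T)$-bimodule via $(f\cdot q)(c)=q(c_{(1)}f(c_{(2)}))$, $(q\cdot t)(c)=q(c)\circ t$; $\Sigma$ is a $(T,{}^*\mathcal{C})$-bimodule via $t\cdot u=t(u)$, $u\cdot f=u_{[0]}f(u_{[1]})$; connecting maps $\mu:Q\otimes_T\Sigma\to{}^*\mathcal{C}$, $\mu(q\otimes u)(c)=q(c)(u)$, $\tau:\Sigma\otimes_{{}^*\mathcal{C}}Q\to T$, $\tau(u\otimes q)(v)=u_{[0]}(q(u_{[1]})(v))$. The $(A,B)$-bimodule structure on $Q$ is $(aqb)(c)(u)=q(ca)(bu)$. $f\in{}^*\mathcal{C}$ is rational if there are finitely many $f_i\in{}^*\mathcal{C}$, $c_i\in\mathcal{C}$ with $f\#g=\sum_i f_i\,g(c_i)$ for all $g\in{}^*\mathcal{C}$; $({}^*\mathcal{C})^{\rm rat}$ is the set of rational elements. It is dense in the finite topology if for every $f\in{}^*\mathcal{C}$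 and finite $D\subset\mathcal{C}$ there is $g\in({}^*\mathcal{C})^{\rm rat}$ with $g|_D=f|_D$; then it is a ring with local units. The image of $\mu$ lies in $({}^*\mathcal{C})^{\rm rat}$ (for $\mathcal{C}$ locally projective), and $\mathbb{C}'=(T,({}^*\mathcal{C})^{\rm rat},\Sigma,Q,\tau,\mu)$ is the restricted Morita context. The conditions (equivalent under the hypotheses of the converse): (i) $\mathrm{can}:\Sigma^*\otimes_B\Sigma\to\mathcal{C}$, $g\otimes u\mapsto g(u_{[0]})u_{[1]}$, is an isomorphism and ${}_B\Sigma$ is faithfully flat; (ii) $\mathrm{can}$ is an isomorphism and ${}_B\Sigma$ is flat; (iii) $\Sigma$ is a generator in $\mathcal{M}^{\mathcal{C}}$; (iv) $\Sigma$ is a projective generator in $\mathcal{M}^{\mathcal{C}}$; (v) $\Sigma$ is a progenerator in the category of right $({}^*\mathcal{C})^{\rm rat}$-modules $M$ with $M\otimes_{({}^*\mathcal{C})^{\rm rat}}({}^*\mathcal{C})^{\rm rat}\to M$ an isomorphism; (vi) $\mu$ is surjective onto $({}^*\mathcal{C})^{\rm rat}$; (vii) $\mathbb{C}'$ is strict (both connecting maps bijective); (viii) $-\otimes_B\Sigma:\mathcal{M}_B\to\mathcal{M}^{\mathcal{C}}$ and its right adjoint $\mathrm{Hom}^{\mathcal{C}}(\Sigma,-)$ are inverse equivalences; (ix) for all $N\in\mathcal{M}^{\mathcal{C}}$, the evaluation map $\mathrm{Hom}^{\mathcal{C}}(\Sigma,N)\otimes_B\Sigma\to N$ is an isomorphism.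 *)

theory Defs
  imports "HOL-Algebra.Module" "HOL-Algebra.QuotRing" "HOL-Algebra.Generated_Groups"
    "HOL-Algebra.Free_Abelian_Groups"
begin

section \<open>Modules and bimodules over noncommutative rings\<close>

text \<open>
  Modules are library \<^type>\<open>module\<close> records (the left action is \<open>\<odot>\<close>) with an additional right
  action \<open>\<triangleleft>\<close>.  As in the library, the fields \<open>mult\<close> and \<open>one\<close> of a module are meaningless unless
  the module is also a ring.  A one-sided right module is such a record whose left action, of
  type \<^typ>\<open>unit \<Rightarrow> 'm \<Rightarrow> 'm\<close>, is never used.
\<close>

record ('l, 'r, 'm) bimod = "('l, 'm) module" +
  ract :: "['m, 'r] \<Rightarrow> 'm" (infixl \<open>\<triangleleft>\<index>\<close> 70)

locale left_module = R?: ring R + M?: abelian_group M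
  for R :: "('r, 'w) ring_scheme" (structure) and M :: "('r, 'm, 'z) module_scheme" (structure) +
  assumes lact_closed: "\<lbrakk>r \<in> carrier R; x \<in> carrier M\<rbrakk> \<Longrightarrow> r \<odot>\<^bsub>M\<^esub> x \<in> carrier M"
    and lact_add: "\<lbrakk>r \<in> carrier R; s \<in> carrier R; x \<in> carrier M\<rbrakk>
      \<Longrightarrow> (r \<oplus>\<^bsub>R\<^esub> s) \<odot>\<^bsub>M\<^esub> x = r \<odot>\<^bsub>M\<^esub> x \<oplus>\<^bsub>M\<^esub> s \<odot>\<^bsub>M\<^esub> x"
    and lact_distrib: "\<lbrakk>r \<in> carrier R; x \<in> carrier M; y \<in> carrier M\<rbrakk>
      \<Longrightarrow> r \<odot>\<^bsub>M\<^esub> (x \<oplus>\<^bsub>M\<^esub> y) = r \<odot>\<^bsub>M\<^esub> x \<oplus>\<^bsub>M\<^esub> r \<odot>\<^bsub>M\<^esub> y"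
    and lact_assoc: "\<lbrakk>r \<in> carrier R; s \<in> carrier R; x \<in> carrier M\<rbrakk>
      \<Longrightarrow> (r \<otimes>\<^bsub>R\<^esub> s) \<odot>\<^bsub>M\<^esub> x = r \<odot>\<^bsub>M\<^esub> (s \<odot>\<^bsub>M\<^esub> x)"
    and lact_one: "x \<in> carrier M \<Longrightarrow> \<one>\<^bsub>R\<^esub> \<odot>\<^bsub>M\<^esub> x = x"

text \<open>Right modules over a ring \<open>R\<close> that need not have a unit; \<open>\<one>\<^bsub>R\<^esub>\<close> is not used.\<close>

locale rng_right_module = M?: abelian_group M
  for R :: "('r, 'w) ring_scheme" (structure) and M :: "('l, 'r, 'm, 'z) bimod_scheme" (structure) +
  assumes ract_closed: "\<lbrakk>x \<in> carrier M; r \<in> carrier R\<rbrakk> \<Longrightarrow> x \<triangleleft>\<^bsub>M\<^esub> r \<in> carrier M"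
    and ract_add: "\<lbrakk>x \<in> carrier M; r \<in> carrier R; s \<in> carrier R\<rbrakk>
      \<Longrightarrow> x \<triangleleft>\<^bsub>M\<^esub> (r \<oplus>\<^bsub>R\<^esub> s) = x \<triangleleft>\<^bsub>M\<^esub> r \<oplus>\<^bsub>M\<^esub> x \<triangleleft>\<^bsub>M\<^esub> s"
    and ract_distrib: "\<lbrakk>x \<in> carrier M; y \<in> carrier M; r \<in> carrier R\<rbrakk>
      \<Longrightarrow> (x \<oplus>\<^bsub>M\<^esub> y) \<triangleleft>\<^bsub>M\<^esub> r = x \<triangleleft>\<^bsub>M\<^esub> r \<oplus>\<^bsub>M\<^esub> y \<triangleleft>\<^bsub>M\<^esub> r"
    and ract_assoc: "\<lbrakk>x \<in> carrier M; r \<in> carrier R; s \<in> carrier R\<rbrakk>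
      \<Longrightarrow> x \<triangleleft>\<^bsub>M\<^esub> (r \<otimes>\<^bsub>R\<^esub> s) = (x \<triangleleft>\<^bsub>M\<^esub> r) \<triangleleft>\<^bsub>M\<^esub> s"

locale right_module = R?: ring R + rng_right_module R M
  for R :: "('r, 'w) ring_scheme" (structure) and M :: "('l, 'r, 'm, 'z) bimod_scheme" (structure) +
  assumes ract_one: "x \<in> carrier M \<Longrightarrow> x \<triangleleft>\<^bsub>M\<^esub> \<one>\<^bsub>R\<^esub> = x"

locale bimodule = left: left_module L M + right: right_module R M
  for L :: "('l, 'v) ring_scheme" and R :: "('r, 'w) ring_scheme"
    and M :: "('l, 'r, 'm, 'z) bimod_scheme" (structure) +
  assumes lact_ract: "\<lbrakk>l \<in> carrier L; x \<in> carrier M; r \<in> carrier R\<rbrakk>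
      \<Longrightarrow> (l \<odot>\<^bsub>M\<^esub> x) \<triangleleft>\<^bsub>M\<^esub> r = l \<odot>\<^bsub>M\<^esub> (x \<triangleleft>\<^bsub>M\<^esub> r)"

definition additive_group :: "'m set \<Rightarrow> 'm \<Rightarrow> ('m \<Rightarrow> 'm \<Rightarrow> 'm) \<Rightarrow> 'm ring" where
  "additive_group X z p = \<lparr>carrier = X, monoid.mult = undefined, one = undefined,
     ring.zero = z, add = p\<rparr>"

definition with_actions :: "('m, 'z) ring_scheme \<Rightarrow> ('l \<Rightarrow> 'm \<Rightarrow> 'm) \<Rightarrow> ('m \<Rightarrow> 'r \<Rightarrow> 'm)
    \<Rightarrow> ('l, 'r, 'm) bimod" where
  "with_actions G l r = \<lparr>carrier = carrier G, monoid.mult = monoid.mult G, one = \<one>\<^bsub>G\<^esub>,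
     ring.zero = \<zero>\<^bsub>G\<^esub>, add = ring.add G, smult = l, ract = r\<rparr>"

definition regular :: "('r, 'w) ring_scheme \<Rightarrow> ('r, 'r, 'r) bimod" where
  "regular R = with_actions R (monoid.mult R) (monoid.mult R)"

definition additive_map :: "('m, 'y) ring_scheme \<Rightarrow> ('n, 'z) ring_scheme \<Rightarrow> ('m \<Rightarrow> 'n) \<Rightarrow> bool" where
  "additive_map M N f \<longleftrightarrow> f \<in> hom (add_monoid M) (add_monoid N)"

definition left_linear :: "('r, 'w) ring_scheme \<Rightarrow> ('r, 'm, 'y) module_scheme
    \<Rightarrow> ('r, 'n, 'z) module_scheme \<Rightarrow> ('m \<Rightarrow> 'n) \<Rightarrow> bool" where
  "left_linear R M N f \<longleftrightarrow> additive_map M N f \<and>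
     (\<forall>r \<in> carrier R. \<forall>x \<in> carrier M. f (r \<odot>\<^bsub>M\<^esub> x) = r \<odot>\<^bsub>N\<^esub> f x)"

definition right_linear :: "('r, 'w) ring_scheme \<Rightarrow> ('k, 'r, 'm, 'y) bimod_scheme
    \<Rightarrow> ('l, 'r, 'n, 'z) bimod_scheme \<Rightarrow> ('m \<Rightarrow> 'n) \<Rightarrow> bool" where
  "right_linear R M N f \<longleftrightarrow> additive_map M N f \<and>
     (\<forall>x \<in> carrier M. \<forall>r \<in> carrier R. f (x \<triangleleft>\<^bsub>M\<^esub> r) = f x \<triangleleft>\<^bsub>N\<^esub> r)"

definition bimodule_map :: "('l, 'v) ring_scheme \<Rightarrow> ('r, 'w) ring_scheme
    \<Rightarrow> ('l, 'r, 'm, 'y) bimod_scheme \<Rightarrow> ('l, 'r, 'n, 'z) bimod_scheme \<Rightarrow> ('m \<Rightarrow> 'n) \<Rightarrow> bool" where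
  "bimodule_map L R M N f \<longleftrightarrow> left_linear L M N f \<and> right_linear R M N f"

definition bimodule_mono :: "('l, 'v) ring_scheme \<Rightarrow> ('r, 'w) ring_scheme
    \<Rightarrow> ('l, 'r, 'm, 'y) bimod_scheme \<Rightarrow> ('l, 'r, 'n, 'z) bimod_scheme \<Rightarrow> ('m \<Rightarrow> 'n) \<Rightarrow> bool" where
  "bimodule_mono L R M N f \<longleftrightarrow> bimodule_map L R M N f \<and> inj_on f (carrier M)"

text \<open>Elements of Hom sets are extensional, so that HOL equality is equality of maps.\<close>

definition left_hom :: "('r, 'w) ring_scheme \<Rightarrow> ('r, 'm, 'y) module_scheme
    \<Rightarrow> ('r, 'n, 'z) module_scheme \<Rightarrow> ('m \<Rightarrow> 'n) set" where
  "left_hom R M N = {f \<in> extensional (carrier M). left_linear R M N f}"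

definition right_hom :: "('r, 'w) ring_scheme \<Rightarrow> ('k, 'r, 'm, 'y) bimod_scheme
    \<Rightarrow> ('l, 'r, 'n, 'z) bimod_scheme \<Rightarrow> ('m \<Rightarrow> 'n) set" where
  "right_hom R M N = {f \<in> extensional (carrier M). right_linear R M N f}"


section \<open>Tensor products\<close>

text \<open>
  \<open>M \<otimes>\<^sub>R N\<close> is the free abelian group on \<open>M \<times> N\<close> modulo the subgroup generated by the usual
  relations.  Only the carrier of \<open>R\<close> enters, so \<open>R\<close> may lack a unit.
\<close>

type_synonym ('m, 'n) tens = "(('m \<times> 'n) \<Rightarrow>\<^sub>0 int) set"

definition tensor_relations :: "('r, 'w) ring_scheme \<Rightarrow> ('l, 'r, 'm, 'y) bimod_scheme
    \<Rightarrow> ('r, 'n, 'z) module_scheme \<Rightarrow> (('m \<times> 'n) \<Rightarrow>\<^sub>0 int) set" where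
  "tensor_relations R M N =
     {frag_of (x \<oplus>\<^bsub>M\<^esub> x', y) - frag_of (x, y) - frag_of (x', y) | x x' y.
        x \<in> carrier M \<and> x' \<in> carrier M \<and> y \<in> carrier N}
   \<union> {frag_of (x, y \<oplus>\<^bsub>N\<^esub> y') - frag_of (x, y) - frag_of (x, y') | x y y'.
        x \<in> carrier M \<and> y \<in> carrier N \<and> y' \<in> carrier N}
   \<union> {frag_of (x \<triangleleft>\<^bsub>M\<^esub> r, y) - frag_of (x, r \<odot>\<^bsub>N\<^esub> y) | x r y.
        x \<in> carrier M \<and> r \<in> carrier R \<and> y \<in> carrier N}"

definition tensor_null :: "('r, 'w) ring_scheme \<Rightarrow> ('l, 'r, 'm, 'y) bimod_scheme
    \<Rightarrow> ('r, 'n, 'z) module_scheme \<Rightarrow> (('m \<times> 'n) \<Rightarrow>\<^sub>0 int) set" where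
  "tensor_null R M N =
     generate (free_Abelian_group (carrier M \<times> carrier N)) (tensor_relations R M N)"

definition tensor_group :: "('r, 'w) ring_scheme \<Rightarrow> ('l, 'r, 'm, 'y) bimod_scheme
    \<Rightarrow> ('r, 'n, 'z) module_scheme \<Rightarrow> ('m, 'n) tens monoid" where
  "tensor_group R M N = free_Abelian_group (carrier M \<times> carrier N) Mod tensor_null R M N"

definition pure :: "('r, 'w) ring_scheme \<Rightarrow> ('l, 'r, 'm, 'y) bimod_scheme
    \<Rightarrow> ('r, 'n, 'z) module_scheme \<Rightarrow> 'm \<Rightarrow> 'n \<Rightarrow> ('m, 'n) tens" where
  "pure R M N x y =
     tensor_null R M N #>\<^bsub>free_Abelian_group (carrier M \<times> carrier N)\<^esub> frag_of (x, y)"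

text \<open>
  \<open>tlift G f\<close> is the map out of a tensor product into the abelian group \<open>G\<close> induced by an
  \<open>R\<close>-balanced map \<open>f\<close>, that is, the additive map with \<open>x \<otimes> y \<mapsto> f x y\<close>: it evaluates \<open>f\<close> on a
  representative in the free abelian group.  For balanced \<open>f\<close> the choice does not matter, and
  \<open>tlift\<close> is only applied to balanced \<open>f\<close>.  In Sweedler notation, \<open>tlift G f (\<rho> m)\<close> is
  \<open>f m\<^sub>[\<^sub>0\<^sub>] m\<^sub>[\<^sub>1\<^sub>]\<close> (summation understood).
\<close>

definition tlift :: "('g, 'z) ring_scheme \<Rightarrow> ('m \<Rightarrow> 'n \<Rightarrow> 'g) \<Rightarrow> ('m, 'n) tens \<Rightarrow> 'g" where
  "tlift G f X = (let w = SOME w. w \<in> X in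
     \<Oplus>\<^bsub>G\<^esub>p \<in> Poly_Mapping.keys w. [Poly_Mapping.lookup w p] \<cdot>\<^bsub>G\<^esub> f (fst p) (snd p))"

definition tensor :: "('r, 'w) ring_scheme \<Rightarrow> ('l, 'r, 'm, 'y) bimod_scheme
    \<Rightarrow> ('r, 's, 'n, 'z) bimod_scheme \<Rightarrow> ('l, 's, ('m, 'n) tens) bimod" where
  "tensor R M N = (let G = additive_group (carrier (tensor_group R M N))
       \<one>\<^bsub>tensor_group R M N\<^esub> (monoid.mult (tensor_group R M N))
     in with_actions G
         (\<lambda>l. tlift G (\<lambda>x y. pure R M N (l \<odot>\<^bsub>M\<^esub> x) y))
         (\<lambda>X s. tlift G (\<lambda>x y. pure R M N x (y \<triangleleft>\<^bsub>N\<^esub> s)) X))"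

text \<open>\<open>f \<otimes> g\<close>, where \<open>M\<close>, \<open>N\<close> are the codomains of \<open>f\<close>, \<open>g\<close>.\<close>

definition tensor_map :: "('r, 'w) ring_scheme \<Rightarrow> ('l, 'r, 'm, 'y) bimod_scheme
    \<Rightarrow> ('r, 's, 'n, 'z) bimod_scheme \<Rightarrow> ('p \<Rightarrow> 'm) \<Rightarrow> ('q \<Rightarrow> 'n) \<Rightarrow> ('p, 'q) tens
    \<Rightarrow> ('m, 'n) tens" where
  "tensor_map R M N f g = tlift (tensor R M N) (\<lambda>x y. pure R M N (f x) (g y))"

text \<open>The associativity isomorphism \<open>(M \<otimes>\<^sub>R N) \<otimes>\<^sub>S P \<rightarrow> M \<otimes>\<^sub>R (N \<otimes>\<^sub>S P)\<close>.\<close>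

definition tensor_assoc :: "('r, 'v) ring_scheme \<Rightarrow> ('s, 'w) ring_scheme
    \<Rightarrow> ('l, 'r, 'm, 'x) bimod_scheme \<Rightarrow> ('r, 's, 'n, 'y) bimod_scheme
    \<Rightarrow> ('s, 't, 'p, 'z) bimod_scheme \<Rightarrow> (('m, 'n) tens, 'p) tens \<Rightarrow> ('m, ('n, 'p) tens) tens" where
  "tensor_assoc R S M N P = (let G = tensor R M (tensor S N P) in
     tlift G (\<lambda>X z. tlift G (\<lambda>x y. pure R M (tensor S N P) x (pure S N P y z)) X))"


section \<open>Corings and comodules\<close>

record ('a, 'c) coring = "('a, 'a, 'c) bimod" +
  comult :: "'c \<Rightarrow> ('c, 'c) tens"
  counit :: "'c \<Rightarrow> 'a"

locale coring = bimodule A A C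
  for A :: "('a, 'w) ring_scheme" and C :: "('a, 'c, 'z) coring_scheme" (structure) +
  assumes comult_map: "bimodule_map A A C (tensor A C C) (comult C)"
    and counit_map: "bimodule_map A A C (regular A) (counit C)"
    and coassoc: "c \<in> carrier C \<Longrightarrow>
      tensor_assoc A A C C C (tensor_map A (tensor A C C) C (comult C) id (comult C c))
        = tensor_map A C (tensor A C C) id (comult C) (comult C c)"
    and counit_left: "c \<in> carrier C \<Longrightarrow> tlift C (\<lambda>x y. counit C x \<odot>\<^bsub>C\<^esub> y) (comult C c) = c"
    and counit_right: "c \<in> carrier C \<Longrightarrow> tlift C (\<lambda>x y. x \<triangleleft>\<^bsub>C\<^esub> counit C y) (comult C c) = c"

locale right_comodule = right_module A M
  for A :: "('a, 'w) ring_scheme" and C :: "('a, 'c, 'z) coring_scheme"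
    and M :: "('l, 'a, 'm, 'y) bimod_scheme" (structure) and \<rho> :: "'m \<Rightarrow> ('m, 'c) tens" +
  assumes coact_map: "right_linear A M (tensor A M C) \<rho>"
    and coact_coassoc: "m \<in> carrier M \<Longrightarrow>
      tensor_assoc A A M C C (tensor_map A (tensor A M C) C \<rho> id (\<rho> m))
        = tensor_map A M (tensor A C C) id (comult C) (\<rho> m)"
    and coact_counit: "m \<in> carrier M \<Longrightarrow> tlift M (\<lambda>x c. x \<triangleleft>\<^bsub>M\<^esub> counit C c) (\<rho> m) = m"

definition comod_hom :: "('a, 'w) ring_scheme \<Rightarrow> ('a, 'c, 'z) coring_scheme
    \<Rightarrow> ('k, 'a, 'm, 'x) bimod_scheme \<Rightarrow> ('m \<Rightarrow> ('m, 'c) tens)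
    \<Rightarrow> ('l, 'a, 'n, 'y) bimod_scheme \<Rightarrow> ('n \<Rightarrow> ('n, 'c) tens) \<Rightarrow> ('m \<Rightarrow> 'n) set" where
  "comod_hom A C M \<rho>M N \<rho>N =
     {f \<in> right_hom A M N. \<forall>m \<in> carrier M. \<rho>N (f m) = tensor_map A N C f id (\<rho>M m)}"

definition left_comod_hom :: "('a, 'w) ring_scheme \<Rightarrow> ('a, 'c, 'z) coring_scheme
    \<Rightarrow> ('a, 'k, 'm, 'x) bimod_scheme \<Rightarrow> ('m \<Rightarrow> ('c, 'm) tens)
    \<Rightarrow> ('a, 'l, 'n, 'y) bimod_scheme \<Rightarrow> ('n \<Rightarrow> ('c, 'n) tens) \<Rightarrow> ('m \<Rightarrow> 'n) set" where
  "left_comod_hom A C M \<delta>M N \<delta>N =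
     {f \<in> left_hom A M N. \<forall>m \<in> carrier M. \<delta>N (f m) = tensor_map A C N id f (\<delta>M m)}"


section \<open>Projective, generating and flat objects\<close>

text \<open>
  Categories of (co)modules have as objects the (co)modules carried by subsets of a type \<open>'u\<close>,
  which acts as a universe and is passed as \<^typ>\<open>'u itself\<close> where needed.
  A category is given by its objects \<open>Ob\<close>, underlying sets \<open>U\<close> and extensional Hom sets \<open>Mor\<close>.
  The test object \<open>P\<close> need not live in the universe: it is given by its underlying set \<open>X\<close> and by
  \<open>H M = Hom(P, M)\<close>.  In module and comodule categories, and for firm modules over a ring with local units,
  the epimorphisms are the surjective morphisms.
\<close>

definition projective_in :: "('o \<Rightarrow> bool) \<Rightarrow> ('o \<Rightarrow> 'u set) \<Rightarrow> ('o \<Rightarrow> 'o \<Rightarrow> ('u \<Rightarrow> 'u) set)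
    \<Rightarrow> 'p set \<Rightarrow> ('o \<Rightarrow> ('p \<Rightarrow> 'u) set) \<Rightarrow> bool" where
  "projective_in Ob U Mor X H \<longleftrightarrow>
     (\<forall>M N. \<forall>p \<in> Mor M N. \<forall>g \<in> H N. Ob M \<and> Ob N \<and> p ` U M = U N \<longrightarrow>
        (\<exists>h \<in> H M. compose X p h = g))"

text \<open>\<open>P\<close> is a generator iff \<open>Hom(P, -)\<close> is faithful.\<close>

definition generator_in :: "('o \<Rightarrow> bool) \<Rightarrow> ('o \<Rightarrow> 'o \<Rightarrow> ('u \<Rightarrow> 'u) set)
    \<Rightarrow> 'p set \<Rightarrow> ('o \<Rightarrow> ('p \<Rightarrow> 'u) set) \<Rightarrow> bool" where
  "generator_in Ob Mor X H \<longleftrightarrow>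
     (\<forall>M N. \<forall>f \<in> Mor M N. \<forall>g \<in> Mor M N. Ob M \<and> Ob N \<and> f \<noteq> g \<longrightarrow>
        (\<exists>h \<in> H M. compose X f h \<noteq> compose X g h))"

definition right_submodule :: "('r, 'w) ring_scheme \<Rightarrow> ('l, 'r, 'm, 'z) bimod_scheme
    \<Rightarrow> 'm set \<Rightarrow> bool" where
  "right_submodule R M N \<longleftrightarrow> subgroup N (add_monoid M) \<and>
     (\<forall>x \<in> N. \<forall>r \<in> carrier R. x \<triangleleft>\<^bsub>M\<^esub> r \<in> N)"

definition finitely_generated :: "('r, 'w) ring_scheme \<Rightarrow> ('l, 'r, 'm, 'z) bimod_scheme \<Rightarrow> bool" where
  "finitely_generated R M \<longleftrightarrow> (\<exists>X. finite X \<and> X \<subseteq> carrier M \<and>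
     (\<forall>N. right_submodule R M N \<and> X \<subseteq> N \<longrightarrow> N = carrier M))"

definition fg_projective :: "'u itself \<Rightarrow> ('r, 'w) ring_scheme
    \<Rightarrow> ('l, 'r, 'm, 'z) bimod_scheme \<Rightarrow> bool" where
  "fg_projective (_ :: 'u itself) R P \<longleftrightarrow> finitely_generated R P \<and>
     projective_in (right_module R :: (unit, 'r, 'u) bimod \<Rightarrow> bool) carrier (right_hom R)
       (carrier P) (right_hom R P)"

definition flat :: "'u itself \<Rightarrow> ('r, 'w) ring_scheme \<Rightarrow> ('r, 's, 'n, 'z) bimod_scheme \<Rightarrow> bool" where
  "flat (_ :: 'u itself) R N \<longleftrightarrow>
     (\<forall>(M :: (unit, 'r, 'u) bimod) (M' :: (unit, 'r, 'u) bimod). \<forall>f \<in> right_hom R M M'.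
        right_module R M \<and> right_module R M' \<and> inj_on f (carrier M) \<longrightarrow>
        inj_on (tensor_map R M' N f id) (carrier (tensor R M N)))"

definition faithfully_flat :: "'u itself \<Rightarrow> ('r, 'w) ring_scheme
    \<Rightarrow> ('r, 's, 'n, 'z) bimod_scheme \<Rightarrow> bool" where
  "faithfully_flat (_ :: 'u itself) R N \<longleftrightarrow>
     (\<forall>(M :: (unit, 'r, 'u) bimod) (M' :: (unit, 'r, 'u) bimod) (M'' :: (unit, 'r, 'u) bimod).
      \<forall>f \<in> right_hom R M M'. \<forall>g \<in> right_hom R M' M''.
        right_module R M \<and> right_module R M' \<and> right_module R M'' \<longrightarrow>
        (f ` carrier M = {x \<in> carrier M'. g x = \<zero>\<^bsub>M''\<^esub>} \<longleftrightarrow>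
         tensor_map R M' N f id ` carrier (tensor R M N) =
           {x \<in> carrier (tensor R M' N). tensor_map R M'' N g id x = \<zero>\<^bsub>tensor R M'' N\<^esub>}))"


section \<open>The left dual of a coring\<close>

text \<open>
  The ring \<open>\<^sup>*C\<close>, with its \<open>A\<close>-bimodule structure, and \<open>C\<close>, \<open>\<^sup>*C\<close> as \<open>(A, \<^sup>*C)\<close>-bimodules.
\<close>

definition coring_act :: "('a, 'c, 'z) coring_scheme \<Rightarrow> 'c \<Rightarrow> ('c \<Rightarrow> 'a) \<Rightarrow> 'c" where
  "coring_act C c f = tlift C (\<lambda>x y. x \<triangleleft>\<^bsub>C\<^esub> f y) (comult C c)"

definition star :: "('a, 'w) ring_scheme \<Rightarrow> ('a, 'c, 'z) coring_scheme
    \<Rightarrow> ('a, 'a, 'c \<Rightarrow> 'a) bimod" where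
  "star A C = with_actions
     \<lparr>carrier = left_hom A C (regular A),
      monoid.mult = (\<lambda>f g. \<lambda>c \<in> carrier C. g (coring_act C c f)),
      one = restrict (counit C) (carrier C),
      ring.zero = (\<lambda>c \<in> carrier C. \<zero>\<^bsub>A\<^esub>),
      add = (\<lambda>f g. \<lambda>c \<in> carrier C. f c \<oplus>\<^bsub>A\<^esub> g c)\<rparr>
     (\<lambda>a f. \<lambda>c \<in> carrier C. f (c \<triangleleft>\<^bsub>C\<^esub> a))
     (\<lambda>f a. \<lambda>c \<in> carrier C. f c \<otimes>\<^bsub>A\<^esub> a)"

definition coring_A_star :: "('a, 'c, 'z) coring_scheme \<Rightarrow> ('a, 'c \<Rightarrow> 'a, 'c) bimod" where
  "coring_A_star C = with_actions C (smult C) (coring_act C)"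

definition star_A_star :: "('a, 'w) ring_scheme \<Rightarrow> ('a, 'c, 'z) coring_scheme
    \<Rightarrow> ('a, 'c \<Rightarrow> 'a, 'c \<Rightarrow> 'a) bimod" where
  "star_A_star A C = with_actions (star A C) (smult (star A C)) (monoid.mult (star A C))"

definition locally_projective :: "('a, 'w) ring_scheme \<Rightarrow> ('a, 'c, 'z) coring_scheme \<Rightarrow> bool" where
  "locally_projective A C \<longleftrightarrow> (\<forall>D. finite D \<and> D \<subseteq> carrier C \<longrightarrow>
     (\<exists>(n :: nat) f e. (\<forall>i<n. f i \<in> carrier (star A C) \<and> e i \<in> carrier C) \<and>
        (\<forall>d \<in> D. d = (\<Oplus>\<^bsub>C\<^esub>i \<in> {..<n}. f i d \<odot>\<^bsub>C\<^esub> e i))))"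

definition right_coFrobenius :: "('a, 'w) ring_scheme \<Rightarrow> ('a, 'c, 'z) coring_scheme \<Rightarrow> bool" where
  "right_coFrobenius A C \<longleftrightarrow> locally_projective A C \<and>
     (\<exists>j. bimodule_mono A (star A C) (coring_A_star C) (star_A_star A C) j)"

definition rational :: "('a, 'w) ring_scheme \<Rightarrow> ('a, 'c, 'z) coring_scheme \<Rightarrow> ('c \<Rightarrow> 'a) \<Rightarrow> bool" where
  "rational A C f \<longleftrightarrow> f \<in> carrier (star A C) \<and>
     (\<exists>(n :: nat) h e. (\<forall>i<n. h i \<in> carrier (star A C) \<and> e i \<in> carrier C) \<and>
        (\<forall>g \<in> carrier (star A C).
           f \<otimes>\<^bsub>star A C\<^esub> g = (\<Oplus>\<^bsub>star A C\<^esub>i \<in> {..<n}. h i \<triangleleft>\<^bsub>star A C\<^esub> g (e i))))"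

text \<open>
  The ring \<open>(\<^sup>*C)\<^sup>r\<^sup>a\<^sup>t\<close>, with \<open>ract\<close> its regular right action.  It has no unit in general; the
  field \<open>one\<close> is inherited from \<open>\<^sup>*C\<close> and not used.
\<close>

definition star_rat :: "('a, 'w) ring_scheme \<Rightarrow> ('a, 'c, 'z) coring_scheme
    \<Rightarrow> ('c \<Rightarrow> 'a, 'c \<Rightarrow> 'a, 'c \<Rightarrow> 'a) bimod" where
  "star_rat A C = (regular (star A C)) \<lparr>carrier := Collect (rational A C)\<rparr>"

definition rat_dense :: "('a, 'w) ring_scheme \<Rightarrow> ('a, 'c, 'z) coring_scheme \<Rightarrow> bool" where
  "rat_dense A C \<longleftrightarrow> (\<forall>f \<in> carrier (star A C). \<forall>D. finite D \<and> D \<subseteq> carrier C \<longrightarrow>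
     (\<exists>g \<in> carrier (star_rat A C). \<forall>d \<in> D. g d = f d))"


section \<open>The Morita context of a comodule\<close>

locale fgp_bicomodule = bimodule B A S + comod: right_comodule A C S \<rho>
  for u :: "'u itself" and B :: "('b, 'v) ring_scheme" and A :: "('a, 'w) ring_scheme"
    and C :: "('a, 'c, 'z) coring_scheme"
    and S :: "('b, 'a, 's, 'y) bimod_scheme" (structure) and \<rho> :: "'s \<Rightarrow> ('s, 'c) tens" +
  assumes fgp: "fg_projective u A S"
    and coact_left_linear: "left_linear B S (tensor A S C) \<rho>"

definition dual :: "('a, 'w) ring_scheme \<Rightarrow> ('b, 'a, 's, 'y) bimod_scheme
    \<Rightarrow> ('a, 'b, 's \<Rightarrow> 'a) bimod" where
  "dual A S = with_actions
     (additive_group (right_hom A S (regular A)) (\<lambda>u \<in> carrier S. \<zero>\<^bsub>A\<^esub>)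
       (\<lambda>f g. \<lambda>u \<in> carrier S. f u \<oplus>\<^bsub>A\<^esub> g u))
     (\<lambda>a f. \<lambda>u \<in> carrier S. a \<otimes>\<^bsub>A\<^esub> f u)
     (\<lambda>f b. \<lambda>u \<in> carrier S. f (b \<odot>\<^bsub>S\<^esub> u))"

definition dual_basis :: "('a, 'w) ring_scheme \<Rightarrow> ('b, 'a, 's, 'y) bimod_scheme
    \<Rightarrow> ('s \<times> ('s \<Rightarrow> 'a)) list \<Rightarrow> bool" where
  "dual_basis A S es \<longleftrightarrow> set es \<subseteq> carrier S \<times> carrier (dual A S) \<and>
     (\<forall>u \<in> carrier S. u = (\<Oplus>\<^bsub>S\<^esub>i \<in> {..<length es}. fst (es ! i) \<triangleleft>\<^bsub>S\<^esub> snd (es ! i) u))"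

text \<open>The left coaction of \<open>\<Sigma>\<^sup>*\<close>; it does not depend on the choice of the dual basis.\<close>

definition dual_coact :: "('a, 'w) ring_scheme \<Rightarrow> ('a, 'c, 'z) coring_scheme
    \<Rightarrow> ('b, 'a, 's, 'y) bimod_scheme \<Rightarrow> ('s \<Rightarrow> ('s, 'c) tens)
    \<Rightarrow> ('s \<Rightarrow> 'a) \<Rightarrow> ('c, 's \<Rightarrow> 'a) tens" where
  "dual_coact A C S \<rho> f = (let es = SOME es. dual_basis A S es in
     \<Oplus>\<^bsub>tensor A C (dual A S)\<^esub>i \<in> {..<length es}.
       pure A C (dual A S) (tlift C (\<lambda>x c. f x \<odot>\<^bsub>C\<^esub> c) (\<rho> (fst (es ! i)))) (snd (es ! i)))"

definition T_ring :: "('a, 'w) ring_scheme \<Rightarrow> ('a, 'c, 'z) coring_scheme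
    \<Rightarrow> ('b, 'a, 's, 'y) bimod_scheme \<Rightarrow> ('s \<Rightarrow> ('s, 'c) tens) \<Rightarrow> ('s \<Rightarrow> 's) ring" where
  "T_ring A C S \<rho> = \<lparr>carrier = comod_hom A C S \<rho> S \<rho>,
     monoid.mult = compose (carrier S), one = (\<lambda>u \<in> carrier S. u),
     ring.zero = (\<lambda>u \<in> carrier S. \<zero>\<^bsub>S\<^esub>), add = (\<lambda>f g. \<lambda>u \<in> carrier S. f u \<oplus>\<^bsub>S\<^esub> g u)\<rparr>"

text \<open>\<open>Q\<close> as an abelian group, as an \<open>(A, B)\<close>-bimodule and as a \<open>(\<^sup>*C, T)\<close>-bimodule.\<close>

definition Q_group :: "('a, 'w) ring_scheme \<Rightarrow> ('a, 'c, 'z) coring_scheme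
    \<Rightarrow> ('b, 'a, 's, 'y) bimod_scheme \<Rightarrow> ('s \<Rightarrow> ('s, 'c) tens) \<Rightarrow> ('c \<Rightarrow> 's \<Rightarrow> 'a) ring" where
  "Q_group A C S \<rho> = additive_group
     (left_comod_hom A C C (comult C) (dual A S) (dual_coact A C S \<rho>))
     (\<lambda>c \<in> carrier C. \<zero>\<^bsub>dual A S\<^esub>) (\<lambda>p q. \<lambda>c \<in> carrier C. p c \<oplus>\<^bsub>dual A S\<^esub> q c)"

definition Q_A_B :: "('a, 'w) ring_scheme \<Rightarrow> ('a, 'c, 'z) coring_scheme
    \<Rightarrow> ('b, 'a, 's, 'y) bimod_scheme \<Rightarrow> ('s \<Rightarrow> ('s, 'c) tens)
    \<Rightarrow> ('a, 'b, 'c \<Rightarrow> 's \<Rightarrow> 'a) bimod" where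
  "Q_A_B A C S \<rho> = with_actions (Q_group A C S \<rho>)
     (\<lambda>a q. \<lambda>c \<in> carrier C. q (c \<triangleleft>\<^bsub>C\<^esub> a))
     (\<lambda>q b. \<lambda>c \<in> carrier C. \<lambda>u \<in> carrier S. q c (b \<odot>\<^bsub>S\<^esub> u))"

definition Q_star_T :: "('a, 'w) ring_scheme \<Rightarrow> ('a, 'c, 'z) coring_scheme
    \<Rightarrow> ('b, 'a, 's, 'y) bimod_scheme \<Rightarrow> ('s \<Rightarrow> ('s, 'c) tens)
    \<Rightarrow> ('c \<Rightarrow> 'a, 's \<Rightarrow> 's, 'c \<Rightarrow> 's \<Rightarrow> 'a) bimod" where
  "Q_star_T A C S \<rho> = with_actions (Q_group A C S \<rho>)
     (\<lambda>f q. \<lambda>c \<in> carrier C. q (coring_act C c f))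
     (\<lambda>q t. \<lambda>c \<in> carrier C. compose (carrier S) (q c) t)"

text \<open>\<open>\<Sigma>\<close> as a \<open>(T, \<^sup>*C)\<close>-bimodule.\<close>

definition S_T_star :: "('b, 'a, 's, 'y) bimod_scheme \<Rightarrow> ('s \<Rightarrow> ('s, 'c) tens)
    \<Rightarrow> ('s \<Rightarrow> 's, 'c \<Rightarrow> 'a, 's) bimod" where
  "S_T_star S \<rho> = with_actions S (\<lambda>t u. t u)
     (\<lambda>u f. tlift S (\<lambda>x c. x \<triangleleft>\<^bsub>S\<^esub> f c) (\<rho> u))"

definition mu :: "('a, 'w) ring_scheme \<Rightarrow> ('a, 'c, 'z) coring_scheme
    \<Rightarrow> ('c \<Rightarrow> 's \<Rightarrow> 'a, 's) tens \<Rightarrow> 'c \<Rightarrow> 'a" where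
  "mu A C = tlift (star A C) (\<lambda>q u. \<lambda>c \<in> carrier C. q c u)"

definition tau :: "('a, 'w) ring_scheme \<Rightarrow> ('a, 'c, 'z) coring_scheme
    \<Rightarrow> ('b, 'a, 's, 'y) bimod_scheme \<Rightarrow> ('s \<Rightarrow> ('s, 'c) tens)
    \<Rightarrow> ('s, 'c \<Rightarrow> 's \<Rightarrow> 'a) tens \<Rightarrow> 's \<Rightarrow> 's" where
  "tau A C S \<rho> = tlift (T_ring A C S \<rho>)
     (\<lambda>u q. \<lambda>v \<in> carrier S. tlift S (\<lambda>x c. x \<triangleleft>\<^bsub>S\<^esub> q c v) (\<rho> u))"

definition tau_surjective :: "('a, 'w) ring_scheme \<Rightarrow> ('a, 'c, 'z) coring_scheme
    \<Rightarrow> ('b, 'a, 's, 'y) bimod_scheme \<Rightarrow> ('s \<Rightarrow> ('s, 'c) tens) \<Rightarrow> bool" where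
  "tau_surjective A C S \<rho> \<longleftrightarrow>
     tau A C S \<rho> ` carrier (tensor (star A C) (S_T_star S \<rho>) (Q_star_T A C S \<rho>))
       = carrier (T_ring A C S \<rho>)"

definition l_map :: "('b, 'a, 's, 'y) bimod_scheme \<Rightarrow> 'b \<Rightarrow> 's \<Rightarrow> 's" where
  "l_map S b = (\<lambda>u \<in> carrier S. b \<odot>\<^bsub>S\<^esub> u)"


section \<open>Galois, generator and equivalence conditions\<close>

definition can :: "('a, 'c, 'z) coring_scheme \<Rightarrow> ('s \<Rightarrow> ('s, 'c) tens)
    \<Rightarrow> ('s \<Rightarrow> 'a, 's) tens \<Rightarrow> 'c" where
  "can C \<rho> = tlift C (\<lambda>g u. tlift C (\<lambda>x c. g x \<odot>\<^bsub>C\<^esub> c) (\<rho> u))"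

definition can_iso :: "('b, 'v) ring_scheme \<Rightarrow> ('a, 'w) ring_scheme \<Rightarrow> ('a, 'c, 'z) coring_scheme
    \<Rightarrow> ('b, 'a, 's, 'y) bimod_scheme \<Rightarrow> ('s \<Rightarrow> ('s, 'c) tens) \<Rightarrow> bool" where
  "can_iso B A C S \<rho> \<longleftrightarrow> bij_betw (can C \<rho>) (carrier (tensor B (dual A S) S)) (carrier C)"

definition comodule_generator :: "'u itself \<Rightarrow> ('a, 'w) ring_scheme \<Rightarrow> ('a, 'c, 'z) coring_scheme
    \<Rightarrow> ('b, 'a, 's, 'y) bimod_scheme \<Rightarrow> ('s \<Rightarrow> ('s, 'c) tens) \<Rightarrow> bool" where
  "comodule_generator (_ :: 'u itself) A C S \<rho> \<longleftrightarrow>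
     generator_in (\<lambda>(M :: (unit, 'a, 'u) bimod, \<rho>M). right_comodule A C M \<rho>M)
       (\<lambda>(M, \<rho>M) (N, \<rho>N). comod_hom A C M \<rho>M N \<rho>N)
       (carrier S) (\<lambda>(M, \<rho>M). comod_hom A C S \<rho> M \<rho>M)"

definition comodule_projective :: "'u itself \<Rightarrow> ('a, 'w) ring_scheme \<Rightarrow> ('a, 'c, 'z) coring_scheme
    \<Rightarrow> ('b, 'a, 's, 'y) bimod_scheme \<Rightarrow> ('s \<Rightarrow> ('s, 'c) tens) \<Rightarrow> bool" where
  "comodule_projective (_ :: 'u itself) A C S \<rho> \<longleftrightarrow>
     projective_in (\<lambda>(M :: (unit, 'a, 'u) bimod, \<rho>M). right_comodule A C M \<rho>M)
       (\<lambda>(M, \<rho>M). carrier M) (\<lambda>(M, \<rho>M) (N, \<rho>N). comod_hom A C M \<rho>M N \<rho>N)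
       (carrier S) (\<lambda>(M, \<rho>M). comod_hom A C S \<rho> M \<rho>M)"

text \<open>Right modules \<open>M\<close> over a ring \<open>R\<close> without unit such that \<open>M \<otimes>\<^sub>R R \<rightarrow> M\<close> is bijective.\<close>

definition firm :: "('r, 'r, 'r, 'w) bimod_scheme \<Rightarrow> ('l, 'r, 'm, 'z) bimod_scheme \<Rightarrow> bool" where
  "firm R M \<longleftrightarrow> rng_right_module R M \<and>
     bij_betw (tlift M (ract M)) (carrier (tensor R M R)) (carrier M)"

definition firm_progenerator :: "'u itself \<Rightarrow> ('r, 'r, 'r, 'w) bimod_scheme
    \<Rightarrow> ('l, 'r, 'm, 'z) bimod_scheme \<Rightarrow> bool" where
  "firm_progenerator (_ :: 'u itself) R P \<longleftrightarrow> firm R P \<and> finitely_generated R P \<and>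
     projective_in (firm R :: (unit, 'r, 'u) bimod \<Rightarrow> bool) carrier (right_hom R)
       (carrier P) (right_hom R P) \<and>
     generator_in (firm R :: (unit, 'r, 'u) bimod \<Rightarrow> bool) (right_hom R)
       (carrier P) (right_hom R P)"

definition mu_surjective_rat :: "('a, 'w) ring_scheme \<Rightarrow> ('a, 'c, 'z) coring_scheme
    \<Rightarrow> ('b, 'a, 's, 'y) bimod_scheme \<Rightarrow> ('s \<Rightarrow> ('s, 'c) tens) \<Rightarrow> bool" where
  "mu_surjective_rat A C S \<rho> \<longleftrightarrow>
     mu A C ` carrier (tensor (T_ring A C S \<rho>) (Q_star_T A C S \<rho>) (S_T_star S \<rho>))
       = carrier (star_rat A C)"

definition restricted_context_strict :: "('a, 'w) ring_scheme \<Rightarrow> ('a, 'c, 'z) coring_scheme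
    \<Rightarrow> ('b, 'a, 's, 'y) bimod_scheme \<Rightarrow> ('s \<Rightarrow> ('s, 'c) tens) \<Rightarrow> bool" where
  "restricted_context_strict A C S \<rho> \<longleftrightarrow>
     bij_betw (mu A C)
       (carrier (tensor (T_ring A C S \<rho>) (Q_star_T A C S \<rho>) (S_T_star S \<rho>)))
       (carrier (star_rat A C)) \<and>
     bij_betw (tau A C S \<rho>)
       (carrier (tensor (star_rat A C) (S_T_star S \<rho>) (Q_star_T A C S \<rho>)))
       (carrier (T_ring A C S \<rho>))"

text \<open>\<open>Hom\<^sup>C(\<Sigma>, N)\<close> as a right \<open>B\<close>-module.\<close>

definition hom_module :: "('a, 'w) ring_scheme \<Rightarrow> ('a, 'c, 'z) coring_scheme
    \<Rightarrow> ('b, 'a, 's, 'y) bimod_scheme \<Rightarrow> ('s \<Rightarrow> ('s, 'c) tens)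
    \<Rightarrow> ('l, 'a, 'n, 'x) bimod_scheme \<Rightarrow> ('n \<Rightarrow> ('n, 'c) tens) \<Rightarrow> (unit, 'b, 's \<Rightarrow> 'n) bimod" where
  "hom_module A C S \<rho> N \<rho>N = with_actions
     (additive_group (comod_hom A C S \<rho> N \<rho>N) (\<lambda>u \<in> carrier S. \<zero>\<^bsub>N\<^esub>)
       (\<lambda>f g. \<lambda>u \<in> carrier S. f u \<oplus>\<^bsub>N\<^esub> g u))
     undefined
     (\<lambda>f b. \<lambda>u \<in> carrier S. f (b \<odot>\<^bsub>S\<^esub> u))"

definition evaluation_iso :: "('b, 'v) ring_scheme \<Rightarrow> ('a, 'w) ring_scheme
    \<Rightarrow> ('a, 'c, 'z) coring_scheme \<Rightarrow> ('b, 'a, 's, 'y) bimod_scheme \<Rightarrow> ('s \<Rightarrow> ('s, 'c) tens)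
    \<Rightarrow> ('l, 'a, 'n, 'x) bimod_scheme \<Rightarrow> ('n \<Rightarrow> ('n, 'c) tens) \<Rightarrow> bool" where
  "evaluation_iso B A C S \<rho> N \<rho>N \<longleftrightarrow>
     bij_betw (tlift N (\<lambda>f u. f u)) (carrier (tensor B (hom_module A C S \<rho> N \<rho>N) S)) (carrier N)"

text \<open>The coaction \<open>n \<otimes> u \<mapsto> (n \<otimes> u\<^sub>[\<^sub>0\<^sub>]) \<otimes> u\<^sub>[\<^sub>1\<^sub>]\<close> of \<open>N \<otimes>\<^sub>B \<Sigma>\<close>.\<close>

definition induced_coact :: "('b, 'v) ring_scheme \<Rightarrow> ('a, 'w) ring_scheme
    \<Rightarrow> ('a, 'c, 'z) coring_scheme \<Rightarrow> ('b, 'a, 's, 'y) bimod_scheme \<Rightarrow> ('s \<Rightarrow> ('s, 'c) tens)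
    \<Rightarrow> ('l, 'b, 'n, 'x) bimod_scheme \<Rightarrow> ('n, 's) tens \<Rightarrow> (('n, 's) tens, 'c) tens" where
  "induced_coact B A C S \<rho> N = tlift (tensor A (tensor B N S) C)
     (\<lambda>n u. tensor_map A (tensor B N S) C (pure B N S n) id (\<rho> u))"

definition unit_iso :: "('b, 'v) ring_scheme \<Rightarrow> ('a, 'w) ring_scheme
    \<Rightarrow> ('a, 'c, 'z) coring_scheme \<Rightarrow> ('b, 'a, 's, 'y) bimod_scheme \<Rightarrow> ('s \<Rightarrow> ('s, 'c) tens)
    \<Rightarrow> ('l, 'b, 'n, 'x) bimod_scheme \<Rightarrow> bool" where
  "unit_iso B A C S \<rho> N \<longleftrightarrow>
     bij_betw (\<lambda>n. \<lambda>u \<in> carrier S. pure B N S n u) (carrier N)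
       (comod_hom A C S \<rho> (tensor B N S) (induced_coact B A C S \<rho> N))"

definition comodule_evaluation_isos :: "'u itself \<Rightarrow> ('b, 'v) ring_scheme \<Rightarrow> ('a, 'w) ring_scheme
    \<Rightarrow> ('a, 'c, 'z) coring_scheme \<Rightarrow> ('b, 'a, 's, 'y) bimod_scheme
    \<Rightarrow> ('s \<Rightarrow> ('s, 'c) tens) \<Rightarrow> bool" where
  "comodule_evaluation_isos (_ :: 'u itself) B A C S \<rho> \<longleftrightarrow>
     (\<forall>(N :: (unit, 'a, 'u) bimod) \<rho>N. right_comodule A C N \<rho>N \<longrightarrow> evaluation_iso B A C S \<rho> N \<rho>N)"

text \<open>
  The adjoint functors \<open>- \<otimes>\<^sub>B \<Sigma>\<close> and \<open>Hom\<^sup>C(\<Sigma>, -)\<close> are inverse equivalences: the unit and the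
  counit (the evaluation map) of the adjunction are natural isomorphisms.
\<close>

definition comodule_equivalence :: "'u itself \<Rightarrow> ('b, 'v) ring_scheme \<Rightarrow> ('a, 'w) ring_scheme
    \<Rightarrow> ('a, 'c, 'z) coring_scheme \<Rightarrow> ('b, 'a, 's, 'y) bimod_scheme
    \<Rightarrow> ('s \<Rightarrow> ('s, 'c) tens) \<Rightarrow> bool" where
  "comodule_equivalence (u :: 'u itself) B A C S \<rho> \<longleftrightarrow>
     (\<forall>N :: (unit, 'b, 'u) bimod. right_module B N \<longrightarrow> unit_iso B A C S \<rho> N) \<and>
     comodule_evaluation_isos u B A C S \<rho>"

text \<open>
  The universe used in the theorem.  If \<open>\<kappa>\<close> is the cardinality of \<open>'a + 'b + 'c + 's + nat\<close>, then
  it has cardinality \<open>2\<^sup>\<kappa>\<close>, and the modules and comodules of at most this size comprise all those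
  above and are closed under \<open>- \<otimes>\<^sub>B \<Sigma>\<close>, \<open>Hom\<^sup>C(\<Sigma>, -)\<close>, submodules, quotients and direct sums of
  \<open>\<kappa>\<close> many objects.
\<close>

type_synonym ('a, 'b, 'c, 's) universe = "('a + 'b + 'c + 's + nat) set"

end

theory Submission
  imports Defs
begin

text \<open>
  For \<open>g\<close> in \<open>\<Sigma>\<^sup>*\<close> and \<open>u\<close> in \<open>\<Sigma>\<close> write \<open>gcan g u\<close> for \<open>can (g \<otimes> u) = g(u\<^sub>[\<^sub>0\<^sub>]) u\<^sub>[\<^sub>1\<^sub>]\<close>.  Two identities
  carry the proof.  By coassociativity \<open>can\<close> is right \<open>\<^sup>*\<C>\<close>-linear, \<open>gcan g (u\<cdot>f) = (gcan g u)\<cdot>f\<close>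
  (\<open>gcan_S_act\<close>).  And a left \<open>A\<close>-linear \<open>q : \<C> \<rightarrow> \<Sigma>\<^sup>*\<close> is colinear iff
  \<open>q(c)(u\<^sub>[\<^sub>0\<^sub>]) u\<^sub>[\<^sub>1\<^sub>] = c\<^sub>(\<^sub>1\<^sub>) q(c\<^sub>(\<^sub>2\<^sub>))(u)\<close> for all \<open>c\<close> and \<open>u\<close> (\<open>Q_iff\<close>), because
  \<open>\<C> \<otimes>\<^sub>A \<Sigma>\<^sup>*\<close> is \<open>Hom\<^sub>A(\<Sigma>, \<C>)\<close> for finitely generated projective \<open>\<Sigma>\<close>.

  If \<open>j : \<C> \<rightarrow> \<^sup>*\<C>\<close> is an injective bimodule map, then \<open>J(\<phi>)(c)(u) = j(gcan \<phi> u)(c)\<close> is the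
  required monomorphism (\<open>coFrobenius_imp_mono\<close>).  After applying any \<open>f\<close> in \<open>\<^sup>*\<C>\<close>, colinearity
  of \<open>J(\<phi>)\<close> becomes the right \<open>\<^sup>*\<C>\<close>-linearity of \<open>j\<close>; by local projectivity the elements of
  \<open>\<^sup>*\<C>\<close> separate the points of \<open>\<C>\<close>.  The counit recovers \<open>\<phi>\<close> from \<open>gcan \<phi>\<close>, whence injectivity.

  Conversely, a monomorphism \<open>J : \<Sigma>\<^sup>* \<rightarrow> Q\<close> gives
  \<open>j : \<C> \<cong> \<Sigma>\<^sup>* \<otimes>\<^sub>B \<Sigma> \<rightarrow> Q \<otimes>\<^sub>B \<Sigma> = Q \<otimes>\<^sub>T \<Sigma> \<rightarrow> \<^sup>*\<C>\<close>, the composite of the inverse of \<open>can\<close>, of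
  \<open>J \<otimes> \<Sigma>\<close> and of \<open>\<mu>\<close> (\<open>mono_imp_coFrobenius\<close>).  It is injective since \<open>\<Sigma>\<close> is flat over \<open>B\<close> and the
  restricted Morita context is strict, and it is linear by the two identities above.

  Flatness and projectivity are tested on modules carried by subsets of a universe.  The modules to
  which they are applied consist of functions between smaller sets; they are moved into the universe
  by sending a function to its graph (\<open>flat_inj_tensor_map\<close>, \<open>ex_dual_basis\<close>, \<open>ex_inj_fun\<close>).
\<close>


section \<open>Additive maps and maps out of tensor products\<close>

lemma additive_mapI:
  assumes "\<And>x. x \<in> carrier M \<Longrightarrow> f x \<in> carrier N"
    and "\<And>x y. x \<in> carrier M \<Longrightarrow> y \<in> carrier M \<Longrightarrow> f (x \<oplus>\<^bsub>M\<^esub> y) = f x \<oplus>\<^bsub>N\<^esub> f y"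
  shows "additive_map M N f"
  using assms by (auto simp: additive_map_def hom_def)

lemma additive_map_closed: "additive_map M N f \<Longrightarrow> x \<in> carrier M \<Longrightarrow> f x \<in> carrier N"
  by (auto simp: additive_map_def hom_def)

lemma additive_map_add:
  "additive_map M N f \<Longrightarrow> x \<in> carrier M \<Longrightarrow> y \<in> carrier M \<Longrightarrow> f (x \<oplus>\<^bsub>M\<^esub> y) = f x \<oplus>\<^bsub>N\<^esub> f y"
  by (auto simp: additive_map_def hom_def)

lemma additive_map_comp:
  "additive_map M N f \<Longrightarrow> additive_map N P g \<Longrightarrow> additive_map M P (\<lambda>x. g (f x))"
  by (auto intro!: additive_mapI simp: additive_map_add additive_map_closed)

lemma additive_map_cong:
  assumes "carrier M = carrier M'" "add M = add M'" "carrier N = carrier N'" "add N = add N'"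
  shows "additive_map M N f \<longleftrightarrow> additive_map M' N' f"
  using assms by (simp add: additive_map_def hom_def)

lemma abelian_group_cong:
  assumes "abelian_group G" "carrier H = carrier G" "add H = add G" "\<zero>\<^bsub>H\<^esub> = \<zero>\<^bsub>G\<^esub>"
  shows "abelian_group H"
proof -
  interpret G: abelian_group G by fact
  show ?thesis
    by (rule abelian_groupI) (auto simp: assms G.a_ac intro: G.add.l_inv_ex)
qed

lemma additive_map_group_hom:
  assumes "additive_map M N f" "abelian_group M" "abelian_group N"
  shows "group_hom (add_monoid M) (add_monoid N) f"
  using assms by (simp add: additive_map_def group_hom_def group_hom_axioms_def abelian_group.a_group)

lemma additive_map_zero:
  assumes "additive_map M N f" "abelian_group M" "abelian_group N"
  shows "f \<zero>\<^bsub>M\<^esub> = \<zero>\<^bsub>N\<^esub>"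
  using group_hom.hom_one[OF additive_map_group_hom[OF assms]] by simp

lemma additive_map_minus:
  assumes "additive_map M N f" "abelian_group M" "abelian_group N" "x \<in> carrier M"
  shows "f (\<ominus>\<^bsub>M\<^esub> x) = \<ominus>\<^bsub>N\<^esub> f x"
  using group_hom.hom_inv[OF additive_map_group_hom[OF assms(1-3)]] assms(4) by (simp add: a_inv_def)

lemma additive_map_finsum:
  assumes "additive_map M N f" "abelian_group M" "abelian_group N" "g \<in> I \<rightarrow> carrier M"
  shows "f (\<Oplus>\<^bsub>M\<^esub>i\<in>I. g i) = (\<Oplus>\<^bsub>N\<^esub>i\<in>I. f (g i))"
proof -
  interpret M: abelian_group M by fact
  interpret N: abelian_group N by fact
  from assms(4) show ?thesis
  proof (induction I rule: infinite_finite_induct)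
    case (infinite I)
    then show ?case using additive_map_zero[OF assms(1-3)] by (simp add: M.finsum_infinite N.finsum_infinite)
  next
    case empty
    then show ?case using additive_map_zero[OF assms(1-3)] by simp
  next
    case (insert i I)
    then have "f (g i) \<in> carrier N" "(\<lambda>i. f (g i)) \<in> I \<rightarrow> carrier N"
      using additive_map_closed[OF assms(1)] by auto
    with insert show ?case
      by (simp add: M.finsum_insert N.finsum_insert additive_map_add[OF assms(1)] M.finsum_closed Pi_def)
  qed
qed

text \<open>The additive extension of \<open>f\<close> to formal integer combinations.\<close>

definition frag_eval :: "('g, 'z) ring_scheme \<Rightarrow> ('p \<Rightarrow> 'g) \<Rightarrow> ('p \<Rightarrow>\<^sub>0 int) \<Rightarrow> 'g" where
  "frag_eval G f w = (\<Oplus>\<^bsub>G\<^esub>p \<in> Poly_Mapping.keys w. [Poly_Mapping.lookup w p] \<cdot>\<^bsub>G\<^esub> f p)"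

context abelian_group
begin

lemma int_mult_closed: "x \<in> carrier G \<Longrightarrow> [(k :: int)] \<cdot>\<^bsub>G\<^esub> x \<in> carrier G"
  using add.int_pow_closed[of x k] by (simp add: add_pow_def)

lemma int_mult_add:
  "x \<in> carrier G \<Longrightarrow> [(j + k :: int)] \<cdot>\<^bsub>G\<^esub> x = [j] \<cdot>\<^bsub>G\<^esub> x \<oplus>\<^bsub>G\<^esub> [k] \<cdot>\<^bsub>G\<^esub> x"
  using add.int_pow_mult[of x j k] by (simp add: add_pow_def)

lemma int_mult_one: "x \<in> carrier G \<Longrightarrow> [(1 :: int)] \<cdot>\<^bsub>G\<^esub> x = x"
  using add.int_pow_1[of x] by (simp add: add_pow_def)

lemma frag_eval_closed:
  assumes "\<And>p. p \<in> Poly_Mapping.keys w \<Longrightarrow> f p \<in> carrier G"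
  shows "frag_eval G f w \<in> carrier G"
  unfolding frag_eval_def using assms by (auto intro!: finsum_closed int_mult_closed)

lemma frag_eval_superset:
  assumes "finite D" "Poly_Mapping.keys w \<subseteq> D" "f \<in> D \<rightarrow> carrier G"
  shows "frag_eval G f w = (\<Oplus>\<^bsub>G\<^esub>p \<in> D. [Poly_Mapping.lookup w p] \<cdot>\<^bsub>G\<^esub> f p)"
proof -
  have "[Poly_Mapping.lookup w p] \<cdot>\<^bsub>G\<^esub> f p = \<zero>\<^bsub>G\<^esub>" if "p \<in> D - Poly_Mapping.keys w" for p
    using that by (simp add: in_keys_iff add_pow_def)
  then show ?thesis unfolding frag_eval_def
    using assms by (intro add.finprod_mono_neutral_cong_left) (auto intro: int_mult_closed)
qed

lemma frag_eval_add:
  assumes "Poly_Mapping.keys v \<subseteq> S" "Poly_Mapping.keys w \<subseteq> S" "f \<in> S \<rightarrow> carrier G"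
  shows "frag_eval G f (v + w) = frag_eval G f v \<oplus>\<^bsub>G\<^esub> frag_eval G f w"
proof -
  let ?D = "Poly_Mapping.keys v \<union> Poly_Mapping.keys w"
  have f: "f \<in> ?D \<rightarrow> carrier G" using assms by auto
  have "frag_eval G f (v + w) = (\<Oplus>\<^bsub>G\<^esub>p \<in> ?D. [Poly_Mapping.lookup (v + w) p] \<cdot>\<^bsub>G\<^esub> f p)"
    using keys_add[of v w] f by (intro frag_eval_superset) auto
  also have "\<dots> = (\<Oplus>\<^bsub>G\<^esub>p \<in> ?D. [Poly_Mapping.lookup v p] \<cdot>\<^bsub>G\<^esub> f p \<oplus>\<^bsub>G\<^esub> [Poly_Mapping.lookup w p] \<cdot>\<^bsub>G\<^esub> f p)"
    using f by (intro finsum_cong') (auto simp: lookup_add int_mult_add Pi_def intro!: int_mult_closed)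
  also have "\<dots> = frag_eval G f v \<oplus>\<^bsub>G\<^esub> frag_eval G f w"
    using f by (subst finsum_addf)
      (auto intro!: int_mult_closed arg_cong2[where f = "add G"] frag_eval_superset[symmetric])
  finally show ?thesis .
qed

lemma frag_eval_frag_of: "f p \<in> carrier G \<Longrightarrow> frag_eval G f (frag_of p) = f p"
  unfolding frag_eval_def by (simp add: int_mult_one)

lemma frag_eval_hom:
  assumes "f \<in> S \<rightarrow> carrier G"
  shows "group_hom (free_Abelian_group S) (add_monoid G) (frag_eval G f)"
  using assms
  by (auto simp: group_hom_def group_hom_axioms_def a_group hom_def Pi_iff subset_iff
        intro!: frag_eval_closed frag_eval_add[where S = S])

lemma frag_eval_diff:
  assumes "Poly_Mapping.keys v \<subseteq> S" "Poly_Mapping.keys w \<subseteq> S" "f \<in> S \<rightarrow> carrier G"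
  shows "frag_eval G f (v - w) = frag_eval G f v \<ominus>\<^bsub>G\<^esub> frag_eval G f w"
proof -
  interpret group_hom "free_Abelian_group S" "add_monoid G" "frag_eval G f"
    by (rule frag_eval_hom) fact
  have "frag_eval G f (- w) = \<ominus>\<^bsub>G\<^esub> frag_eval G f w"
    using hom_inv[of w] assms(2) by (simp add: a_inv_def)
  then show ?thesis
    using frag_eval_add[of v S "- w" f] assms by (simp add: a_minus_def keys_minus)
qed

end

text \<open>The closure conditions under which the relations of \<open>M \<otimes>\<^sub>R N\<close> lie in the free abelian group.\<close>

locale tensor_pair = M: abelian_group M + N: abelian_group N
  for R :: "('r, 'w) ring_scheme" and M :: "('l, 'r, 'm, 'y) bimod_scheme"
    and N :: "('r, 's, 'n, 'z) bimod_scheme" +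
  assumes racl: "\<lbrakk>x \<in> carrier M; r \<in> carrier R\<rbrakk> \<Longrightarrow> x \<triangleleft>\<^bsub>M\<^esub> r \<in> carrier M"
    and lacl: "\<lbrakk>r \<in> carrier R; y \<in> carrier N\<rbrakk> \<Longrightarrow> r \<odot>\<^bsub>N\<^esub> y \<in> carrier N"

text \<open>\<open>R\<close>-balanced biadditive maps on \<open>M \<times> N\<close>; nothing is required off the carriers.\<close>

definition balanced :: "('r, 'w) ring_scheme \<Rightarrow> ('l, 'r, 'm, 'y) bimod_scheme
    \<Rightarrow> ('r, 's, 'n, 'z) bimod_scheme \<Rightarrow> ('g, 'x) ring_scheme \<Rightarrow> ('m \<Rightarrow> 'n \<Rightarrow> 'g) \<Rightarrow> bool" where
  "balanced R M N G f \<longleftrightarrow>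
     (\<forall>y \<in> carrier N. additive_map M G (\<lambda>x. f x y)) \<and>
     (\<forall>x \<in> carrier M. additive_map N G (f x)) \<and>
     (\<forall>x \<in> carrier M. \<forall>r \<in> carrier R. \<forall>y \<in> carrier N. f (x \<triangleleft>\<^bsub>M\<^esub> r) y = f x (r \<odot>\<^bsub>N\<^esub> y))"

lemma balancedI:
  assumes "\<And>x y. x \<in> carrier M \<Longrightarrow> y \<in> carrier N \<Longrightarrow> f x y \<in> carrier G"
    and "\<And>x x' y. x \<in> carrier M \<Longrightarrow> x' \<in> carrier M \<Longrightarrow> y \<in> carrier N
      \<Longrightarrow> f (x \<oplus>\<^bsub>M\<^esub> x') y = f x y \<oplus>\<^bsub>G\<^esub> f x' y"
    and "\<And>x y y'. x \<in> carrier M \<Longrightarrow> y \<in> carrier N \<Longrightarrow> y' \<in> carrier N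
      \<Longrightarrow> f x (y \<oplus>\<^bsub>N\<^esub> y') = f x y \<oplus>\<^bsub>G\<^esub> f x y'"
    and "\<And>x r y. x \<in> carrier M \<Longrightarrow> r \<in> carrier R \<Longrightarrow> y \<in> carrier N
      \<Longrightarrow> f (x \<triangleleft>\<^bsub>M\<^esub> r) y = f x (r \<odot>\<^bsub>N\<^esub> y)"
  shows "balanced R M N G f"
  unfolding balanced_def using assms by (auto intro!: additive_mapI)

lemma balanced_closed:
  "balanced R M N G f \<Longrightarrow> x \<in> carrier M \<Longrightarrow> y \<in> carrier N \<Longrightarrow> f x y \<in> carrier G"
  unfolding balanced_def by (blast dest: additive_map_closed)

lemma balanced_comp:
  "balanced R M N G f \<Longrightarrow> additive_map G H h \<Longrightarrow> balanced R M N H (\<lambda>x y. h (f x y))"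
  unfolding balanced_def by (auto dest: additive_map_comp)

lemma balanced_left: "balanced R M N G f \<Longrightarrow> y \<in> carrier N \<Longrightarrow> additive_map M G (\<lambda>x. f x y)"
  and balanced_right: "balanced R M N G f \<Longrightarrow> x \<in> carrier M \<Longrightarrow> additive_map N G (f x)"
  and balanced_mid: "balanced R M N G f \<Longrightarrow> x \<in> carrier M \<Longrightarrow> r \<in> carrier R \<Longrightarrow> y \<in> carrier N
    \<Longrightarrow> f (x \<triangleleft>\<^bsub>M\<^esub> r) y = f x (r \<odot>\<^bsub>N\<^esub> y)"
  unfolding balanced_def by auto

lemma carrier_tensor: "carrier (tensor R M N) = carrier (tensor_group R M N)"
  and add_tensor: "add (tensor R M N) = monoid.mult (tensor_group R M N)"
  and zero_tensor: "\<zero>\<^bsub>tensor R M N\<^esub> = \<one>\<^bsub>tensor_group R M N\<^esub>"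
  by (simp_all add: tensor_def with_actions_def additive_group_def Let_def)

context tensor_pair
begin

abbreviation F where "F \<equiv> free_Abelian_group (carrier M \<times> carrier N)"

sublocale F: comm_group F by (rule abelian_free_Abelian_group)

lemma relations_in_free: "tensor_relations R M N \<subseteq> carrier F"
proof -
  have k: "Poly_Mapping.keys (frag_of a - frag_of b) \<subseteq> {a, b}"
    "Poly_Mapping.keys (frag_of a - frag_of b - frag_of c) \<subseteq> {a, b, c}" for a b c :: "'m \<times> 'n"
    using keys_diff[of "frag_of a" "frag_of b"] keys_diff[of "frag_of a - frag_of b" "frag_of c"]
    by auto
  show ?thesis unfolding tensor_relations_def
    using racl lacl by (auto dest!: subsetD[OF k(1)] subsetD[OF k(2)])
qed

lemma null_subgroup: "subgroup (tensor_null R M N) F"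
  unfolding tensor_null_def by (rule F.generate_is_subgroup[OF relations_in_free])

lemma null_normal: "tensor_null R M N \<lhd> F"
  by (rule F.subgroup_imp_normal[OF null_subgroup])

sublocale null: normal "tensor_null R M N" F by (rule null_normal)

lemma abelian_group_tensor: "abelian_group (tensor R M N)"
proof -
  interpret G: comm_group "tensor_group R M N"
    unfolding tensor_group_def by (rule F.abelian_FactGroup[OF null_subgroup])
  show ?thesis
    by (rule abelian_groupI)
      (auto simp: carrier_tensor add_tensor zero_tensor G.m_ac intro: G.l_inv_ex)
qed

text \<open>The class in \<open>M \<otimes>\<^sub>R N\<close> of a formal combination of pairs.\<close>

abbreviation cls where "cls w \<equiv> tensor_null R M N #>\<^bsub>F\<^esub> w"

lemma cls_closed: "Poly_Mapping.keys w \<subseteq> carrier M \<times> carrier N \<Longrightarrow> cls w \<in> carrier (tensor R M N)"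
  by (auto simp: carrier_tensor tensor_group_def FactGroup_def RCOSETS_def)

lemma cls_cases:
  assumes "X \<in> carrier (tensor R M N)"
  obtains w where "Poly_Mapping.keys w \<subseteq> carrier M \<times> carrier N" "X = cls w"
  using assms by (auto simp: carrier_tensor tensor_group_def FactGroup_def RCOSETS_def)

lemma cls_add:
  assumes "Poly_Mapping.keys v \<subseteq> carrier M \<times> carrier N" "Poly_Mapping.keys w \<subseteq> carrier M \<times> carrier N"
  shows "cls (v + w) = cls v \<oplus>\<^bsub>tensor R M N\<^esub> cls w"
  using null.rcos_sum[of v w] assms by (simp add: add_tensor tensor_group_def)

lemma cls_eqI:
  assumes "v - w \<in> tensor_null R M N" "Poly_Mapping.keys v \<subseteq> carrier M \<times> carrier N"
    "Poly_Mapping.keys w \<subseteq> carrier M \<times> carrier N"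
  shows "cls v = cls w"
proof -
  have "v \<in> cls w"
    using assms by (auto simp: r_coset_def intro!: bexI[of _ "v - w"])
  then show ?thesis using F.repr_independence[of v "tensor_null R M N" w] null_subgroup assms by simp
qed

lemma pure_cls: "pure R M N x y = cls (frag_of (x, y))"
  by (simp add: pure_def)

lemma pure_closed: "x \<in> carrier M \<Longrightarrow> y \<in> carrier N \<Longrightarrow> pure R M N x y \<in> carrier (tensor R M N)"
  unfolding pure_cls by (rule cls_closed) auto

lemma relation_null: "t \<in> tensor_relations R M N \<Longrightarrow> t \<in> tensor_null R M N"
  unfolding tensor_null_def by (rule generate.incl)

lemma balanced_pure: "balanced R M N (tensor R M N) (pure R M N)"
proof (rule balancedI)
  fix x x' y assume *: "x \<in> carrier M" "x' \<in> carrier M" "y \<in> carrier N"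
  then have "cls (frag_of (x \<oplus>\<^bsub>M\<^esub> x', y)) = cls (frag_of (x, y) + frag_of (x', y))"
    using keys_add[of "frag_of (x, y)" "frag_of (x', y)"]
    by (intro cls_eqI relation_null) (auto simp: tensor_relations_def diff_diff_eq)
  also have "\<dots> = pure R M N x y \<oplus>\<^bsub>tensor R M N\<^esub> pure R M N x' y"
    unfolding pure_cls using * by (intro cls_add) auto
  finally show "pure R M N (x \<oplus>\<^bsub>M\<^esub> x') y = pure R M N x y \<oplus>\<^bsub>tensor R M N\<^esub> pure R M N x' y"
    by (simp add: pure_cls)
next
  fix x y y' assume *: "x \<in> carrier M" "y \<in> carrier N" "y' \<in> carrier N"
  then have "cls (frag_of (x, y \<oplus>\<^bsub>N\<^esub> y')) = cls (frag_of (x, y) + frag_of (x, y'))"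
    using keys_add[of "frag_of (x, y)" "frag_of (x, y')"]
    by (intro cls_eqI relation_null) (auto simp: tensor_relations_def diff_diff_eq)
  also have "\<dots> = pure R M N x y \<oplus>\<^bsub>tensor R M N\<^esub> pure R M N x y'"
    unfolding pure_cls using * by (intro cls_add) auto
  finally show "pure R M N x (y \<oplus>\<^bsub>N\<^esub> y') = pure R M N x y \<oplus>\<^bsub>tensor R M N\<^esub> pure R M N x y'"
    by (simp add: pure_cls)
next
  fix x r y assume *: "x \<in> carrier M" "r \<in> carrier R" "y \<in> carrier N"
  show "pure R M N (x \<triangleleft>\<^bsub>M\<^esub> r) y = pure R M N x (r \<odot>\<^bsub>N\<^esub> y)"
    unfolding pure_cls using * racl lacl
    by (intro cls_eqI relation_null) (auto simp: tensor_relations_def)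
qed (rule pure_closed)

text \<open>The additive extension of a balanced map vanishes on the tensor relations, so \<open>tlift\<close> does not
  depend on the chosen representative.\<close>

lemma frag_eval_null:
  assumes "abelian_group G" and f: "balanced R M N G f" and t: "t \<in> tensor_null R M N"
  shows "frag_eval G (\<lambda>p. f (fst p) (snd p)) t = \<zero>\<^bsub>G\<^esub>"
proof -
  interpret G: abelian_group G by fact
  let ?f = "\<lambda>p. f (fst p) (snd p)" and ?S = "carrier M \<times> carrier N"
  have f': "?f \<in> ?S \<rightarrow> carrier G" using balanced_closed[OF f] by auto
  interpret h: group_hom F "add_monoid G" "frag_eval G ?f" by (rule G.frag_eval_hom[OF f'])
  have sub: "subgroup (kernel F (add_monoid G) (frag_eval G ?f)) F" by (rule h.subgroup_kernel)
  have ev1: "frag_eval G ?f (frag_of a) = ?f a" if "a \<in> ?S" for a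
    using f' that by (intro G.frag_eval_frag_of) auto
  have "tensor_relations R M N \<subseteq> kernel F (add_monoid G) (frag_eval G ?f)"
  proof
    fix t assume t: "t \<in> tensor_relations R M N"
    have keys1: "Poly_Mapping.keys (frag_of a) \<subseteq> ?S" if "a \<in> ?S" for a using that by simp
    have keys2: "Poly_Mapping.keys (frag_of a - frag_of b) \<subseteq> ?S" if "a \<in> ?S" "b \<in> ?S" for a b
      using that keys_diff[of "frag_of a" "frag_of b"] by auto
    have d2: "frag_eval G ?f (frag_of a - frag_of b) = ?f a \<ominus>\<^bsub>G\<^esub> ?f b" if "a \<in> ?S" "b \<in> ?S" for a b
      using G.frag_eval_diff[OF keys1 keys1 f'] ev1 that by simp
    have d3: "frag_eval G ?f (frag_of a - frag_of b - frag_of c) = ?f a \<ominus>\<^bsub>G\<^esub> ?f b \<ominus>\<^bsub>G\<^esub> ?f c"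
      if "a \<in> ?S" "b \<in> ?S" "c \<in> ?S" for a b c
      using G.frag_eval_diff[OF keys2 keys1 f'] ev1 d2 that by simp
    have cancel: "(u \<oplus>\<^bsub>G\<^esub> v) \<ominus>\<^bsub>G\<^esub> u \<ominus>\<^bsub>G\<^esub> v = \<zero>\<^bsub>G\<^esub>" "u \<ominus>\<^bsub>G\<^esub> u = \<zero>\<^bsub>G\<^esub>"
      if "u \<in> carrier G" "v \<in> carrier G" for u v
    proof -
      have "(u \<oplus>\<^bsub>G\<^esub> v) \<ominus>\<^bsub>G\<^esub> u = v"
        using that by (simp add: G.a_comm[of u v] G.a_assoc a_minus_def G.r_neg)
      then show "(u \<oplus>\<^bsub>G\<^esub> v) \<ominus>\<^bsub>G\<^esub> u \<ominus>\<^bsub>G\<^esub> v = \<zero>\<^bsub>G\<^esub>" "u \<ominus>\<^bsub>G\<^esub> u = \<zero>\<^bsub>G\<^esub>"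
        using that by (simp_all add: a_minus_def G.r_neg)
    qed
    have bc: "f x y \<in> carrier G" if "x \<in> carrier M" "y \<in> carrier N" for x y
      using balanced_closed[OF f] that .
    have "frag_eval G ?f t = \<zero>\<^bsub>G\<^esub>"
      using t unfolding tensor_relations_def
      by (auto simp: d2 d3 racl lacl bc additive_map_add[OF balanced_left[OF f]]
          additive_map_add[OF balanced_right[OF f]] balanced_mid[OF f] cancel
          intro!: cancel)
    then show "t \<in> kernel F (add_monoid G) (frag_eval G ?f)"
      using subsetD[OF relations_in_free t] by (simp add: kernel_def)
  qed
  then have "tensor_null R M N \<subseteq> kernel F (add_monoid G) (frag_eval G ?f)"
    unfolding tensor_null_def by (rule F.generate_subgroup_incl[OF _ sub])
  with t show ?thesis by (auto simp: kernel_def)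
qed

lemma tlift_cls:
  assumes G: "abelian_group G" and f: "balanced R M N G f"
    and w: "Poly_Mapping.keys w \<subseteq> carrier M \<times> carrier N"
  shows "tlift G f (cls w) = frag_eval G (\<lambda>p. f (fst p) (snd p)) w"
proof -
  interpret G: abelian_group G by fact
  let ?f = "\<lambda>p. f (fst p) (snd p)"
  have f': "?f \<in> carrier M \<times> carrier N \<rightarrow> carrier G" using balanced_closed[OF f] by auto
  define v where "v = (SOME v. v \<in> cls w)"
  have "w \<in> cls w" using F.rcos_self[of w "tensor_null R M N"] null_subgroup w by simp
  then have "v \<in> cls w" unfolding v_def by (rule someI)
  then obtain t where t: "t \<in> tensor_null R M N" "v = t + w" by (auto simp: r_coset_def)
  then have "Poly_Mapping.keys t \<subseteq> carrier M \<times> carrier N" using subsetD[OF null.subset t(1)] by simp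
  then have "frag_eval G ?f v = frag_eval G ?f w"
    using G.frag_eval_add[OF _ w f', of t] frag_eval_null[OF G f t(1)] t
      group_hom.hom_closed[OF G.frag_eval_hom[OF f'], of w] w by simp
  then show ?thesis by (simp add: tlift_def v_def Let_def frag_eval_def)
qed

lemma tlift_pure:
  assumes "abelian_group G" "balanced R M N G f" "x \<in> carrier M" "y \<in> carrier N"
  shows "tlift G f (pure R M N x y) = f x y"
  using assms unfolding pure_cls
  by (subst tlift_cls) (auto simp: abelian_group.frag_eval_frag_of balanced_closed)

lemma tlift_additive:
  assumes G: "abelian_group G" and f: "balanced R M N G f"
  shows "additive_map (tensor R M N) G (tlift G f)"
proof (rule additive_mapI)
  interpret G: abelian_group G by fact
  let ?f = "\<lambda>p. f (fst p) (snd p)"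
  have f': "?f \<in> carrier M \<times> carrier N \<rightarrow> carrier G" using balanced_closed[OF f] by auto
  fix X assume "X \<in> carrier (tensor R M N)"
  then obtain v where v: "Poly_Mapping.keys v \<subseteq> carrier M \<times> carrier N" "X = cls v"
    by (rule cls_cases)
  then show "tlift G f X \<in> carrier G"
    using f' by (auto simp: tlift_cls[OF G f] intro!: G.frag_eval_closed)
  fix Y assume "Y \<in> carrier (tensor R M N)"
  then obtain w where w: "Poly_Mapping.keys w \<subseteq> carrier M \<times> carrier N" "Y = cls w"
    by (rule cls_cases)
  have vw: "Poly_Mapping.keys (v + w) \<subseteq> carrier M \<times> carrier N"
    using keys_add[of v w] v w by auto
  show "tlift G f (X \<oplus>\<^bsub>tensor R M N\<^esub> Y) = tlift G f X \<oplus>\<^bsub>G\<^esub> tlift G f Y"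
    using v w vw by (simp add: cls_add[symmetric] tlift_cls[OF G f] G.frag_eval_add[OF _ _ f'])
qed

lemma tlift_closed:
  assumes "abelian_group G" "balanced R M N G f" "X \<in> carrier (tensor R M N)"
  shows "tlift G f X \<in> carrier G"
  using additive_map_closed[OF tlift_additive[OF assms(1,2)] assms(3)] .

lemma additive_map_eq_on_pure:
  assumes G: "abelian_group G" and h: "additive_map (tensor R M N) G h"
    and k: "additive_map (tensor R M N) G k"
    and eq: "\<And>x y. x \<in> carrier M \<Longrightarrow> y \<in> carrier N \<Longrightarrow> h (pure R M N x y) = k (pure R M N x y)"
    and X: "X \<in> carrier (tensor R M N)"
  shows "h X = k X"
proof -
  interpret G: abelian_group G by fact
  interpret T: abelian_group "tensor R M N" by (rule abelian_group_tensor)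
  let ?S = "carrier M \<times> carrier N"
  obtain w where w: "Poly_Mapping.keys w \<subseteq> ?S" "X = cls w" using X by (rule cls_cases)
  have zero: "cls 0 = \<zero>\<^bsub>tensor R M N\<^esub>"
    using F.coset_mult_one[of "tensor_null R M N"] null.subset
    by (simp add: zero_tensor tensor_group_def FactGroup_def)
  have "h (cls w) = k (cls w)"
  proof (rule free_Abelian_group_induct[OF w(1)])
    show "h (cls 0) = k (cls 0)" using additive_map_zero[OF h T.abelian_group_axioms G] additive_map_zero[OF k T.abelian_group_axioms G] zero by simp
  next
    fix v w assume 2: "Poly_Mapping.keys v \<subseteq> ?S" "Poly_Mapping.keys w \<subseteq> ?S"
      "h (cls v) = k (cls v)" "h (cls w) = k (cls w)"
    have vw: "Poly_Mapping.keys (v - w) \<subseteq> ?S" using keys_diff[of v w] 2 by auto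
    have "cls v = cls (v - w) \<oplus>\<^bsub>tensor R M N\<^esub> cls w" using cls_add[OF vw 2(2)] by simp
    then have "h (cls (v - w)) \<oplus>\<^bsub>G\<^esub> h (cls w) = k (cls (v - w)) \<oplus>\<^bsub>G\<^esub> h (cls w)"
      using 2 vw additive_map_add[OF h cls_closed cls_closed] additive_map_add[OF k cls_closed cls_closed]
      by metis
    then show "h (cls (v - w)) = k (cls (v - w))"
      using vw 2 additive_map_closed[OF h cls_closed] additive_map_closed[OF k cls_closed]
      by (metis G.add.right_cancel)
  next
    fix a assume "a \<in> ?S"
    then show "h (cls (frag_of a)) = k (cls (frag_of a))" using eq[of "fst a" "snd a"] by (auto simp: pure_cls)
  qed
  with w show ?thesis by simp
qed

text \<open>An additive map can be pulled inside the Sweedler notation.\<close>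

lemma additive_map_tlift:
  assumes "abelian_group G" "abelian_group H" "balanced R M N G f" "additive_map G H h"
    "X \<in> carrier (tensor R M N)"
  shows "h (tlift G f X) = tlift H (\<lambda>x y. h (f x y)) X"
proof -
  have b: "balanced R M N H (\<lambda>x y. h (f x y))" by (rule balanced_comp[OF assms(3,4)])
  show ?thesis
    by (rule additive_map_eq_on_pure[OF assms(2) additive_map_comp[OF tlift_additive[OF assms(1,3)] assms(4)]
          tlift_additive[OF assms(2) b] _ assms(5)])
      (simp add: tlift_pure[OF assms(1,3)] tlift_pure[OF assms(2) b])
qed

lemma tlift_cong:
  assumes "abelian_group G" "balanced R M N G f" "balanced R M N G g"
    "\<And>x y. x \<in> carrier M \<Longrightarrow> y \<in> carrier N \<Longrightarrow> f x y = g x y" "X \<in> carrier (tensor R M N)"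
  shows "tlift G f X = tlift G g X"
  by (rule additive_map_eq_on_pure[OF assms(1) tlift_additive[OF assms(1,2)]
        tlift_additive[OF assms(1,3)] _ assms(5)])
    (simp add: tlift_pure[OF assms(1,2)] tlift_pure[OF assms(1,3)] assms(4))

lemma tlift_add:
  assumes G: "abelian_group G" and f: "balanced R M N G f" and g: "balanced R M N G g"
    and X: "X \<in> carrier (tensor R M N)"
  shows "tlift G (\<lambda>x y. f x y \<oplus>\<^bsub>G\<^esub> g x y) X = tlift G f X \<oplus>\<^bsub>G\<^esub> tlift G g X"
proof -
  interpret G: abelian_group G by fact
  note c = balanced_closed[OF f] balanced_closed[OF g]
  have b: "balanced R M N G (\<lambda>x y. f x y \<oplus>\<^bsub>G\<^esub> g x y)"
    by (rule balancedI)
      (auto simp: c additive_map_add[OF balanced_left[OF f]] additive_map_add[OF balanced_left[OF g]]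
         additive_map_add[OF balanced_right[OF f]] additive_map_add[OF balanced_right[OF g]]
         balanced_mid[OF f] balanced_mid[OF g] G.a_ac M.a_closed N.a_closed)
  have a: "additive_map (tensor R M N) G (\<lambda>X. tlift G f X \<oplus>\<^bsub>G\<^esub> tlift G g X)"
    by (rule additive_mapI)
      (auto simp: tlift_closed[OF G f] tlift_closed[OF G g] additive_map_add[OF tlift_additive[OF G f]]
        additive_map_add[OF tlift_additive[OF G g]] G.a_ac)
  show ?thesis
    by (rule additive_map_eq_on_pure[OF G tlift_additive[OF G b] a _ X])
      (simp add: tlift_pure[OF G b] tlift_pure[OF G f] tlift_pure[OF G g])
qed

lemma balanced_pure_map:
  assumes "tensor_pair R M' N'" "additive_map M M' f" "additive_map N N' g"
    "\<And>x r. x \<in> carrier M \<Longrightarrow> r \<in> carrier R \<Longrightarrow> f (x \<triangleleft>\<^bsub>M\<^esub> r) = f x \<triangleleft>\<^bsub>M'\<^esub> r"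
    "\<And>y r. y \<in> carrier N \<Longrightarrow> r \<in> carrier R \<Longrightarrow> g (r \<odot>\<^bsub>N\<^esub> y) = r \<odot>\<^bsub>N'\<^esub> g y"
  shows "balanced R M N (tensor R M' N') (\<lambda>x y. pure R M' N' (f x) (g y))"
proof -
  interpret T: tensor_pair R M' N' by fact
  note c = additive_map_closed[OF assms(2)] additive_map_closed[OF assms(3)]
  show ?thesis
    by (rule balancedI)
      (simp_all add: c T.pure_closed assms(4,5) balanced_mid[OF T.balanced_pure]
        additive_map_add[OF assms(2)] additive_map_add[OF assms(3)]
        additive_map_add[OF balanced_left[OF T.balanced_pure]]
        additive_map_add[OF balanced_right[OF T.balanced_pure]])
qed

text \<open>The definition of the actions on \<open>M \<otimes>\<^sub>R N\<close> lifts into the bare additive group of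
  \<open>M \<otimes>\<^sub>R N\<close>, which is why these two lemmas are not instances of the previous ones.\<close>

lemma smult_tensor:
  assumes l: "additive_map M M (smult M l)"
    and lr: "\<And>x r. x \<in> carrier M \<Longrightarrow> r \<in> carrier R \<Longrightarrow> l \<odot>\<^bsub>M\<^esub> (x \<triangleleft>\<^bsub>M\<^esub> r) = (l \<odot>\<^bsub>M\<^esub> x) \<triangleleft>\<^bsub>M\<^esub> r"
  shows "additive_map (tensor R M N) (tensor R M N) (smult (tensor R M N) l)"
    and "x \<in> carrier M \<Longrightarrow> y \<in> carrier N
      \<Longrightarrow> l \<odot>\<^bsub>tensor R M N\<^esub> pure R M N x y = pure R M N (l \<odot>\<^bsub>M\<^esub> x) y"
proof -
  define G where "G = additive_group (carrier (tensor_group R M N))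
       \<one>\<^bsub>tensor_group R M N\<^esub> (monoid.mult (tensor_group R M N))"
  have G: "carrier G = carrier (tensor R M N)" "add G = add (tensor R M N)"
    "\<zero>\<^bsub>G\<^esub> = \<zero>\<^bsub>tensor R M N\<^esub>"
    by (simp_all add: G_def additive_group_def carrier_tensor add_tensor zero_tensor)
  have aG: "abelian_group G" by (rule abelian_group_cong[OF abelian_group_tensor G])
  have eq: "smult (tensor R M N) l = tlift G (\<lambda>x y. pure R M N (l \<odot>\<^bsub>M\<^esub> x) y)"
    by (simp add: tensor_def with_actions_def Let_def G_def)
  have "balanced R M N (tensor R M N) (\<lambda>x y. pure R M N (l \<odot>\<^bsub>M\<^esub> x) y)"
    by (rule balanced_pure_map[OF tensor_pair_axioms l _ lr]) (auto intro: additive_mapI)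
  then have b: "balanced R M N G (\<lambda>x y. pure R M N (l \<odot>\<^bsub>M\<^esub> x) y)"
    by (simp add: balanced_def additive_map_cong[OF refl refl G(1,2)])
  show "additive_map (tensor R M N) (tensor R M N) (smult (tensor R M N) l)"
    using tlift_additive[OF aG b] by (simp add: eq additive_map_cong[OF refl refl G(1,2)])
  show "x \<in> carrier M \<Longrightarrow> y \<in> carrier N
      \<Longrightarrow> l \<odot>\<^bsub>tensor R M N\<^esub> pure R M N x y = pure R M N (l \<odot>\<^bsub>M\<^esub> x) y"
    using tlift_pure[OF aG b] by (simp add: eq)
qed

lemma ract_tensor:
  assumes s: "additive_map N N (\<lambda>y. y \<triangleleft>\<^bsub>N\<^esub> s)"
    and rs: "\<And>y r. y \<in> carrier N \<Longrightarrow> r \<in> carrier R \<Longrightarrow> (r \<odot>\<^bsub>N\<^esub> y) \<triangleleft>\<^bsub>N\<^esub> s = r \<odot>\<^bsub>N\<^esub> (y \<triangleleft>\<^bsub>N\<^esub> s)"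
  shows "additive_map (tensor R M N) (tensor R M N) (\<lambda>X. X \<triangleleft>\<^bsub>tensor R M N\<^esub> s)"
    and "x \<in> carrier M \<Longrightarrow> y \<in> carrier N
      \<Longrightarrow> pure R M N x y \<triangleleft>\<^bsub>tensor R M N\<^esub> s = pure R M N x (y \<triangleleft>\<^bsub>N\<^esub> s)"
proof -
  define G where "G = additive_group (carrier (tensor_group R M N))
       \<one>\<^bsub>tensor_group R M N\<^esub> (monoid.mult (tensor_group R M N))"
  have G: "carrier G = carrier (tensor R M N)" "add G = add (tensor R M N)"
    "\<zero>\<^bsub>G\<^esub> = \<zero>\<^bsub>tensor R M N\<^esub>"
    by (simp_all add: G_def additive_group_def carrier_tensor add_tensor zero_tensor)
  have aG: "abelian_group G" by (rule abelian_group_cong[OF abelian_group_tensor G])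
  have eq: "X \<triangleleft>\<^bsub>tensor R M N\<^esub> s = tlift G (\<lambda>x y. pure R M N x (y \<triangleleft>\<^bsub>N\<^esub> s)) X" for X
    by (simp add: tensor_def with_actions_def Let_def G_def)
  have "balanced R M N (tensor R M N) (\<lambda>x y. pure R M N x (y \<triangleleft>\<^bsub>N\<^esub> s))"
    by (rule balanced_pure_map[OF tensor_pair_axioms _ s _ rs]) (auto intro: additive_mapI)
  then have b: "balanced R M N G (\<lambda>x y. pure R M N x (y \<triangleleft>\<^bsub>N\<^esub> s))"
    by (simp add: balanced_def additive_map_cong[OF refl refl G(1,2)])
  show "additive_map (tensor R M N) (tensor R M N) (\<lambda>X. X \<triangleleft>\<^bsub>tensor R M N\<^esub> s)"
    using tlift_additive[OF aG b] by (simp add: eq additive_map_cong[OF refl refl G(1,2)])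
  show "x \<in> carrier M \<Longrightarrow> y \<in> carrier N
      \<Longrightarrow> pure R M N x y \<triangleleft>\<^bsub>tensor R M N\<^esub> s = pure R M N x (y \<triangleleft>\<^bsub>N\<^esub> s)"
    using tlift_pure[OF aG b] by (simp add: eq)
qed

end


section \<open>Dual modules and pairings\<close>

lemma with_actions_simps [simp]:
  "carrier (with_actions G l r) = carrier G" "add (with_actions G l r) = add G"
  "\<zero>\<^bsub>with_actions G l r\<^esub> = \<zero>\<^bsub>G\<^esub>" "monoid.mult (with_actions G l r) = monoid.mult G"
  "smult (with_actions G l r) = l" "ract (with_actions G l r) = r"
  by (simp_all add: with_actions_def)

lemma additive_group_simps [simp]:
  "carrier (additive_group X z p) = X" "add (additive_group X z p) = p"
  "\<zero>\<^bsub>additive_group X z p\<^esub> = z"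
  by (simp_all add: additive_group_def)

lemma regular_simps [simp]:
  "carrier (regular R) = carrier R" "add (regular R) = add R" "\<zero>\<^bsub>regular R\<^esub> = \<zero>\<^bsub>R\<^esub>"
  "smult (regular R) = monoid.mult R" "ract (regular R) = monoid.mult R"
  by (simp_all add: regular_def)

text \<open>A set of functions into an abelian group that is closed under pointwise operations.\<close>

lemma abelian_group_pointwise:
  assumes "abelian_group G"
    and H: "add H = (\<lambda>f g. \<lambda>x\<in>X. f x \<oplus>\<^bsub>G\<^esub> g x)" "\<zero>\<^bsub>H\<^esub> = (\<lambda>x\<in>X. \<zero>\<^bsub>G\<^esub>)"
    and sub: "carrier H \<subseteq> X \<rightarrow>\<^sub>E carrier G"
    and zero: "(\<lambda>x\<in>X. \<zero>\<^bsub>G\<^esub>) \<in> carrier H"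
    and add: "\<And>f g. f \<in> carrier H \<Longrightarrow> g \<in> carrier H \<Longrightarrow> (\<lambda>x\<in>X. f x \<oplus>\<^bsub>G\<^esub> g x) \<in> carrier H"
    and minus: "\<And>f. f \<in> carrier H \<Longrightarrow> (\<lambda>x\<in>X. \<ominus>\<^bsub>G\<^esub> f x) \<in> carrier H"
  shows "abelian_group H"
proof -
  interpret G: abelian_group G by fact
  have c: "f x \<in> carrier G" if "f \<in> carrier H" "x \<in> X" for f x
    using sub that by auto
  have e: "f \<in> extensional X" if "f \<in> carrier H" for f
    using sub that by (auto simp: PiE_def)
  show ?thesis
  proof (rule abelian_groupI)
    fix f assume f: "f \<in> carrier H"
    show "\<exists>g\<in>carrier H. g \<oplus>\<^bsub>H\<^esub> f = \<zero>\<^bsub>H\<^esub>"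
      by (rule bexI[OF _ minus[OF f]]) (auto simp: H fun_eq_iff restrict_def c[OF f] G.l_neg)
    show "\<zero>\<^bsub>H\<^esub> \<oplus>\<^bsub>H\<^esub> f = f"
      by (rule extensionalityI[OF _ e[OF f]]) (auto simp: H c[OF f])
  qed (auto simp: H add zero c G.a_ac intro!: restrict_ext)
qed

lemma left_linearD:
  assumes "left_linear R M N f"
  shows "additive_map M N f" "r \<in> carrier R \<Longrightarrow> x \<in> carrier M \<Longrightarrow> f (r \<odot>\<^bsub>M\<^esub> x) = r \<odot>\<^bsub>N\<^esub> f x"
  using assms by (auto simp: left_linear_def)

lemma right_linearD:
  assumes "right_linear R M N f"
  shows "additive_map M N f" "r \<in> carrier R \<Longrightarrow> x \<in> carrier M \<Longrightarrow> f (x \<triangleleft>\<^bsub>M\<^esub> r) = f x \<triangleleft>\<^bsub>N\<^esub> r"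
  using assms by (auto simp: right_linear_def)

text \<open>
  The data of the theorem.  The underlying rings and groups of \<open>A\<close>, \<open>B\<close>, \<open>\<C>\<close> and \<open>\<Sigma>\<close> are listed
  separately to give their facts short names.
\<close>

locale bicomodule_setting = A: ring A + B: ring B + C: abelian_group C + S: abelian_group S
    + cor: coring A C + com: fgp_bicomodule U B A C S \<rho>
  for U :: "'u itself" and A :: "('a, 'w) ring_scheme" and B :: "('b, 'v) ring_scheme"
    and C :: "('a, 'c, 'z) coring_scheme" and S :: "('b, 'a, 's, 'y) bimod_scheme"
    and \<rho> :: "'s \<Rightarrow> ('s, 'c) tens"
begin

lemmas S_simps = com.left.lact_closed com.left.lact_add com.left.lact_distrib com.left.lact_assoc
  com.right.ract_closed com.right.ract_add com.right.ract_distrib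
lemmas C_simps = cor.left.lact_closed cor.left.lact_add cor.left.lact_distrib
  cor.right.ract_closed cor.right.ract_add cor.right.ract_distrib

lemma S_rassoc: "x \<in> carrier S \<Longrightarrow> a \<in> carrier A \<Longrightarrow> b \<in> carrier A
    \<Longrightarrow> (x \<triangleleft>\<^bsub>S\<^esub> a) \<triangleleft>\<^bsub>S\<^esub> b = x \<triangleleft>\<^bsub>S\<^esub> (a \<otimes>\<^bsub>A\<^esub> b)"
  by (simp add: com.right.ract_assoc)

lemma C_rassoc: "x \<in> carrier C \<Longrightarrow> a \<in> carrier A \<Longrightarrow> b \<in> carrier A
    \<Longrightarrow> (x \<triangleleft>\<^bsub>C\<^esub> a) \<triangleleft>\<^bsub>C\<^esub> b = x \<triangleleft>\<^bsub>C\<^esub> (a \<otimes>\<^bsub>A\<^esub> b)"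
  by (simp add: cor.right.ract_assoc)

lemma C_lassoc: "x \<in> carrier C \<Longrightarrow> a \<in> carrier A \<Longrightarrow> b \<in> carrier A
    \<Longrightarrow> (a \<otimes>\<^bsub>A\<^esub> b) \<odot>\<^bsub>C\<^esub> x = a \<odot>\<^bsub>C\<^esub> (b \<odot>\<^bsub>C\<^esub> x)"
  by (simp add: cor.left.lact_assoc)

lemma C_lr: "x \<in> carrier C \<Longrightarrow> a \<in> carrier A \<Longrightarrow> b \<in> carrier A
    \<Longrightarrow> (a \<odot>\<^bsub>C\<^esub> x) \<triangleleft>\<^bsub>C\<^esub> b = a \<odot>\<^bsub>C\<^esub> (x \<triangleleft>\<^bsub>C\<^esub> b)"
  by (simp add: cor.lact_ract)

sublocale SC: tensor_pair A S C by unfold_locales (simp_all add: S_simps C_simps)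
sublocale CC: tensor_pair A C C by unfold_locales (simp_all add: C_simps)

lemma comult_left: "left_linear A C (tensor A C C) (comult C)"
  using cor.comult_map by (auto simp: bimodule_map_def)

lemma comult_closed: "c \<in> carrier C \<Longrightarrow> comult C c \<in> carrier (tensor A C C)"
  by (rule additive_map_closed[OF left_linearD(1)[OF comult_left]])

lemmas coact_right = com.comod.coact_map
lemmas coact_additive = right_linearD(1)[OF coact_right]

lemma coact_closed: "u \<in> carrier S \<Longrightarrow> \<rho> u \<in> carrier (tensor A S C)"
  by (rule additive_map_closed[OF coact_additive])

subsection \<open>Functionals on \<open>\<C>\<close> and \<open>\<Sigma>\<close>\<close>

text \<open>Left linear functionals on \<open>\<C>\<close> and right linear functionals on \<open>\<Sigma>\<close>, extensional or not.\<close>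

abbreviation C_functional where "C_functional f \<equiv> left_linear A C (regular A) f"
abbreviation S_functional where "S_functional g \<equiv> right_linear A S (regular A) g"

lemma additive_regular: "additive_map M (regular A) f \<longleftrightarrow> additive_map M A f"
  by (rule additive_map_cong) auto

lemma C_functionalD:
  assumes "C_functional f"
  shows "c \<in> carrier C \<Longrightarrow> f c \<in> carrier A"
    and "c \<in> carrier C \<Longrightarrow> d \<in> carrier C \<Longrightarrow> f (c \<oplus>\<^bsub>C\<^esub> d) = f c \<oplus>\<^bsub>A\<^esub> f d"
    and "c \<in> carrier C \<Longrightarrow> a \<in> carrier A \<Longrightarrow> f (a \<odot>\<^bsub>C\<^esub> c) = a \<otimes>\<^bsub>A\<^esub> f c"
  using assms
  by (auto simp: left_linear_def additive_regular dest: additive_map_closed additive_map_add)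

lemma C_functionalI:
  assumes "\<And>c. c \<in> carrier C \<Longrightarrow> f c \<in> carrier A"
    and "\<And>c d. c \<in> carrier C \<Longrightarrow> d \<in> carrier C \<Longrightarrow> f (c \<oplus>\<^bsub>C\<^esub> d) = f c \<oplus>\<^bsub>A\<^esub> f d"
    and "\<And>c a. c \<in> carrier C \<Longrightarrow> a \<in> carrier A \<Longrightarrow> f (a \<odot>\<^bsub>C\<^esub> c) = a \<otimes>\<^bsub>A\<^esub> f c"
  shows "C_functional f"
  using assms by (auto simp: left_linear_def additive_regular intro: additive_mapI)

lemma S_functionalD:
  assumes "S_functional g"
  shows "u \<in> carrier S \<Longrightarrow> g u \<in> carrier A"
    and "u \<in> carrier S \<Longrightarrow> v \<in> carrier S \<Longrightarrow> g (u \<oplus>\<^bsub>S\<^esub> v) = g u \<oplus>\<^bsub>A\<^esub> g v"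
    and "u \<in> carrier S \<Longrightarrow> a \<in> carrier A \<Longrightarrow> g (u \<triangleleft>\<^bsub>S\<^esub> a) = g u \<otimes>\<^bsub>A\<^esub> a"
  using assms
  by (auto simp: right_linear_def additive_regular dest: additive_map_closed additive_map_add)

lemma S_functionalI:
  assumes "\<And>u. u \<in> carrier S \<Longrightarrow> g u \<in> carrier A"
    and "\<And>u v. u \<in> carrier S \<Longrightarrow> v \<in> carrier S \<Longrightarrow> g (u \<oplus>\<^bsub>S\<^esub> v) = g u \<oplus>\<^bsub>A\<^esub> g v"
    and "\<And>u a. u \<in> carrier S \<Longrightarrow> a \<in> carrier A \<Longrightarrow> g (u \<triangleleft>\<^bsub>S\<^esub> a) = g u \<otimes>\<^bsub>A\<^esub> a"
  shows "S_functional g"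
  using assms by (auto simp: right_linear_def additive_regular intro: additive_mapI)

lemma star_iff: "f \<in> carrier (star A C) \<longleftrightarrow> f \<in> extensional (carrier C) \<and> C_functional f"
  by (auto simp: star_def left_hom_def)

lemma star_simps:
  "add (star A C) = (\<lambda>f g. \<lambda>c \<in> carrier C. f c \<oplus>\<^bsub>A\<^esub> g c)"
  "\<zero>\<^bsub>star A C\<^esub> = (\<lambda>c \<in> carrier C. \<zero>\<^bsub>A\<^esub>)"
  "monoid.mult (star A C) = (\<lambda>f g. \<lambda>c \<in> carrier C. g (coring_act C c f))"
  "smult (star A C) = (\<lambda>a f. \<lambda>c \<in> carrier C. f (c \<triangleleft>\<^bsub>C\<^esub> a))"
  by (simp_all add: star_def)

lemma dual_iff: "g \<in> carrier (dual A S) \<longleftrightarrow> g \<in> extensional (carrier S) \<and> S_functional g"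
  by (auto simp: dual_def right_hom_def)

lemma dual_simps:
  "add (dual A S) = (\<lambda>f g. \<lambda>u \<in> carrier S. f u \<oplus>\<^bsub>A\<^esub> g u)"
  "\<zero>\<^bsub>dual A S\<^esub> = (\<lambda>u \<in> carrier S. \<zero>\<^bsub>A\<^esub>)"
  "smult (dual A S) = (\<lambda>a f. \<lambda>u \<in> carrier S. a \<otimes>\<^bsub>A\<^esub> f u)"
  "ract (dual A S) = (\<lambda>f b. \<lambda>u \<in> carrier S. f (b \<odot>\<^bsub>S\<^esub> u))"
  by (simp_all add: dual_def)

lemma C_functional_restrict: "C_functional f \<Longrightarrow> (\<lambda>c \<in> carrier C. f c) \<in> carrier (star A C)"
  by (auto simp: star_iff C_simps C_functionalD C.a_closed intro!: C_functionalI)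

lemma S_functional_restrict: "S_functional f \<Longrightarrow> (\<lambda>c \<in> carrier S. f c) \<in> carrier (dual A S)"
  by (auto simp: dual_iff S_simps S_functionalD S.a_closed intro!: S_functionalI)

lemma abelian_group_star: "abelian_group (star A C)"
proof (rule abelian_group_pointwise[where X = "carrier C" and G = A])
  show "carrier (star A C) \<subseteq> carrier C \<rightarrow>\<^sub>E carrier A"
    by (auto simp: star_iff PiE_def C_functionalD)
qed (auto simp: A.abelian_group_axioms star_simps star_iff A.r_minus A.minus_add A.a_ac A.r_distr
      C_functionalD C_simps intro!: C_functional_restrict C_functionalI)

lemma abelian_group_dual: "abelian_group (dual A S)"
proof (rule abelian_group_pointwise[where X = "carrier S" and G = A])
  show "carrier (dual A S) \<subseteq> carrier S \<rightarrow>\<^sub>E carrier A"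
    by (auto simp: dual_iff PiE_def S_functionalD)
qed (auto simp: A.abelian_group_axioms dual_simps dual_iff A.l_minus A.minus_add A.a_ac A.l_distr
      S_functionalD S_simps intro!: S_functional_restrict S_functionalI)

sublocale D: abelian_group "dual A S" by (rule abelian_group_dual)
sublocale star: abelian_group "star A C" by (rule abelian_group_star)

lemma dual_lact_closed:
  "a \<in> carrier A \<Longrightarrow> g \<in> carrier (dual A S) \<Longrightarrow> a \<odot>\<^bsub>dual A S\<^esub> g \<in> carrier (dual A S)"
  by (auto simp: dual_simps dual_iff S_functionalD S_simps A.r_distr A.m_assoc
      intro!: S_functional_restrict S_functionalI)

lemma dual_ract_closed:
  "b \<in> carrier B \<Longrightarrow> g \<in> carrier (dual A S) \<Longrightarrow> g \<triangleleft>\<^bsub>dual A S\<^esub> b \<in> carrier (dual A S)"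
  by (auto simp: dual_simps dual_iff S_functionalD S_simps com.lact_ract[symmetric]
      intro!: S_functional_restrict S_functionalI)

sublocale CD: tensor_pair A C "dual A S" by unfold_locales (simp_all add: C_simps dual_lact_closed)
sublocale DS: tensor_pair B "dual A S" S by unfold_locales (simp_all add: S_simps dual_ract_closed)

lemma S_functional_dual: "g \<in> carrier (dual A S) \<Longrightarrow> S_functional g"
  by (simp add: dual_iff)

lemma C_functional_star: "f \<in> carrier (star A C) \<Longrightarrow> C_functional f"
  by (simp add: star_iff)

subsection \<open>Balanced maps\<close>

lemma balanced_gcan: "S_functional g \<Longrightarrow> balanced A S C C (\<lambda>x c. g x \<odot>\<^bsub>C\<^esub> c)"
  by (rule balancedI) (simp_all add: C_simps S_functionalD C_lassoc)

lemma balanced_S_act: "C_functional f \<Longrightarrow> balanced A S C S (\<lambda>x c. x \<triangleleft>\<^bsub>S\<^esub> f c)"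
  by (rule balancedI) (simp_all add: S_simps C_functionalD S_rassoc)

lemma balanced_C_act: "C_functional f \<Longrightarrow> balanced A C C C (\<lambda>x c. x \<triangleleft>\<^bsub>C\<^esub> f c)"
  by (rule balancedI) (simp_all add: C_simps C_functionalD C_rassoc)

text \<open>\<open>gcan g u = g(u\<^sub>[\<^sub>0\<^sub>]) u\<^sub>[\<^sub>1\<^sub>]\<close>, the value of \<open>can\<close> on \<open>g \<otimes> u\<close>, and \<open>S_act u f = u\<^sub>[\<^sub>0\<^sub>] f(u\<^sub>[\<^sub>1\<^sub>])\<close>,
  the action of \<open>\<^sup>*\<C>\<close> on \<open>\<Sigma>\<close>.\<close>

definition gcan :: "('s \<Rightarrow> 'a) \<Rightarrow> 's \<Rightarrow> 'c" where
  "gcan g u = tlift C (\<lambda>x c. g x \<odot>\<^bsub>C\<^esub> c) (\<rho> u)"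

definition S_act :: "'s \<Rightarrow> ('c \<Rightarrow> 'a) \<Rightarrow> 's" where
  "S_act u f = tlift S (\<lambda>x c. x \<triangleleft>\<^bsub>S\<^esub> f c) (\<rho> u)"

lemma coring_act_additive:
  "C_functional f \<Longrightarrow> additive_map C C (\<lambda>c. coring_act C c f)"
  unfolding coring_act_def
  by (rule additive_map_comp[OF left_linearD(1)[OF comult_left]
        CC.tlift_additive[OF C.abelian_group_axioms balanced_C_act]])

lemma coring_act_closed: "C_functional f \<Longrightarrow> c \<in> carrier C \<Longrightarrow> coring_act C c f \<in> carrier C"
  by (rule additive_map_closed[OF coring_act_additive])

lemma coring_act_add: "C_functional f \<Longrightarrow> c \<in> carrier C \<Longrightarrow> d \<in> carrier C
    \<Longrightarrow> coring_act C (c \<oplus>\<^bsub>C\<^esub> d) f = coring_act C c f \<oplus>\<^bsub>C\<^esub> coring_act C d f"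
  by (rule additive_map_add[OF coring_act_additive])

lemma additive_smult_C: "a \<in> carrier A \<Longrightarrow> additive_map C C (smult C a)"
  by (auto intro: additive_mapI simp: C_simps)

lemma additive_ract_C: "a \<in> carrier A \<Longrightarrow> additive_map C C (\<lambda>c. c \<triangleleft>\<^bsub>C\<^esub> a)"
  by (auto intro: additive_mapI simp: C_simps)

text \<open>The map \<open>\<C> \<otimes>\<^sub>A \<C> \<rightarrow> \<C>\<close>, \<open>c \<otimes> d \<mapsto> c f(d)\<close>, is left \<open>A\<close>-linear.\<close>

lemma contract_lact:
  assumes f: "C_functional f" and a: "a \<in> carrier A" and X: "X \<in> carrier (tensor A C C)"
  shows "tlift C (\<lambda>x c. x \<triangleleft>\<^bsub>C\<^esub> f c) (a \<odot>\<^bsub>tensor A C C\<^esub> X) = a \<odot>\<^bsub>C\<^esub> tlift C (\<lambda>x c. x \<triangleleft>\<^bsub>C\<^esub> f c) X"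
proof -
  note s = CC.smult_tensor[OF additive_smult_C[OF a], OF C_lr[symmetric, OF _ a]]
  note t = CC.tlift_additive[OF C.abelian_group_axioms balanced_C_act[OF f]]
  show ?thesis
    by (rule CC.additive_map_eq_on_pure[OF C.abelian_group_axioms additive_map_comp[OF s(1) t]
          additive_map_comp[OF t additive_smult_C[OF a]] _ X])
      (simp_all add: s(2) CC.tlift_pure[OF C.abelian_group_axioms balanced_C_act[OF f]]
        C_simps C_lr a C_functionalD[OF f])
qed

lemma coring_act_lact:
  "C_functional f \<Longrightarrow> a \<in> carrier A \<Longrightarrow> c \<in> carrier C
    \<Longrightarrow> coring_act C (a \<odot>\<^bsub>C\<^esub> c) f = a \<odot>\<^bsub>C\<^esub> coring_act C c f"
  unfolding coring_act_def
  by (simp add: left_linearD(2)[OF comult_left] contract_lact comult_closed)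

lemma coring_act_add_right:
  assumes "C_functional f" "C_functional g" "c \<in> carrier C"
  shows "coring_act C c (\<lambda>d. f d \<oplus>\<^bsub>A\<^esub> g d) = coring_act C c f \<oplus>\<^bsub>C\<^esub> coring_act C c g"
proof -
  have fg: "C_functional (\<lambda>d. f d \<oplus>\<^bsub>A\<^esub> g d)"
    using assms by (auto intro!: C_functionalI simp: C_functionalD A.a_ac A.r_distr)
  have "balanced A C C C (\<lambda>x y. x \<triangleleft>\<^bsub>C\<^esub> f y \<oplus>\<^bsub>C\<^esub> x \<triangleleft>\<^bsub>C\<^esub> g y)"
    by (rule balancedI) (simp_all add: C_simps C_functionalD assms C_rassoc C.a_ac)
  then show ?thesis
    unfolding coring_act_def using assms comult_closed
    by (subst CC.tlift_add[symmetric])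
      (auto intro!: CC.tlift_cong balanced_C_act fg C.abelian_group_axioms simp: C_simps C_functionalD)
qed

lemma coring_act_cong:
  assumes "C_functional f" "\<And>d. d \<in> carrier C \<Longrightarrow> f d = g d" "c \<in> carrier C"
  shows "coring_act C c f = coring_act C c g"
proof -
  have g: "C_functional g"
    using assms by (auto intro!: C_functionalI simp: C_functionalD C_simps assms(2)[symmetric])
  show ?thesis unfolding coring_act_def
    by (rule CC.tlift_cong[OF C.abelian_group_axioms balanced_C_act[OF assms(1)] balanced_C_act[OF g]])
      (simp_all add: assms comult_closed)
qed

lemma gcan_additive: "S_functional g \<Longrightarrow> additive_map S C (gcan g)"
  unfolding gcan_def
  by (rule additive_map_comp[OF coact_additive
        SC.tlift_additive[OF C.abelian_group_axioms balanced_gcan]])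

lemma gcan_closed: "S_functional g \<Longrightarrow> u \<in> carrier S \<Longrightarrow> gcan g u \<in> carrier C"
  by (rule additive_map_closed[OF gcan_additive])

lemma gcan_cong:
  assumes "S_functional f" "\<And>x. x \<in> carrier S \<Longrightarrow> f x = g x" "u \<in> carrier S"
  shows "gcan f u = gcan g u"
proof -
  have g: "S_functional g"
    using assms by (auto intro!: S_functionalI simp: S_functionalD S_simps assms(2)[symmetric])
  show ?thesis unfolding gcan_def
    by (rule SC.tlift_cong[OF C.abelian_group_axioms balanced_gcan[OF assms(1)] balanced_gcan[OF g]])
      (simp_all add: assms coact_closed)
qed

lemma gcan_add_left:
  assumes "S_functional f" "S_functional g" "u \<in> carrier S"
  shows "gcan (\<lambda>x. f x \<oplus>\<^bsub>A\<^esub> g x) u = gcan f u \<oplus>\<^bsub>C\<^esub> gcan g u"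
proof -
  have fg: "S_functional (\<lambda>d. f d \<oplus>\<^bsub>A\<^esub> g d)"
    using assms by (auto intro!: S_functionalI simp: S_functionalD A.a_ac A.l_distr)
  have "balanced A S C C (\<lambda>x y. f x \<odot>\<^bsub>C\<^esub> y \<oplus>\<^bsub>C\<^esub> g x \<odot>\<^bsub>C\<^esub> y)"
    by (rule balancedI) (simp_all add: C_simps S_functionalD assms C_lassoc C.a_ac)
  then show ?thesis
    unfolding gcan_def using assms coact_closed
    by (subst SC.tlift_add[symmetric])
      (auto intro!: SC.tlift_cong balanced_gcan fg C.abelian_group_axioms simp: C_simps S_functionalD)
qed

lemma gcan_lact_left:
  assumes g: "S_functional g" and a: "a \<in> carrier A" and u: "u \<in> carrier S"
  shows "gcan (\<lambda>x. a \<otimes>\<^bsub>A\<^esub> g x) u = a \<odot>\<^bsub>C\<^esub> gcan g u"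
proof -
  have ag: "S_functional (\<lambda>x. a \<otimes>\<^bsub>A\<^esub> g x)"
    by (auto intro!: S_functionalI simp: S_functionalD[OF g] a A.r_distr A.m_assoc)
  show ?thesis unfolding gcan_def
    by (subst SC.additive_map_tlift[OF C.abelian_group_axioms C.abelian_group_axioms balanced_gcan[OF g]
          additive_smult_C[OF a] coact_closed[OF u]])
      (auto intro!: SC.tlift_cong balanced_gcan ag C.abelian_group_axioms coact_closed u
        balanced_comp[OF balanced_gcan[OF g] additive_smult_C[OF a]]
        simp: C_lassoc a S_functionalD[OF g])
qed

lemma gcan_ract:
  assumes g: "S_functional g" and a: "a \<in> carrier A" and u: "u \<in> carrier S"
  shows "gcan g (u \<triangleleft>\<^bsub>S\<^esub> a) = gcan g u \<triangleleft>\<^bsub>C\<^esub> a"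
proof -
  note s = SC.ract_tensor[OF additive_ract_C[OF a], OF C_lr[OF _ _ a]]
  note b = balanced_gcan[OF g]
  note t = SC.tlift_additive[OF C.abelian_group_axioms b]
  have "tlift C (\<lambda>x c. g x \<odot>\<^bsub>C\<^esub> c) (\<rho> u \<triangleleft>\<^bsub>tensor A S C\<^esub> a) = tlift C (\<lambda>x c. g x \<odot>\<^bsub>C\<^esub> c) (\<rho> u) \<triangleleft>\<^bsub>C\<^esub> a"
    by (rule SC.additive_map_eq_on_pure[OF C.abelian_group_axioms additive_map_comp[OF s(1) t]
          additive_map_comp[OF t additive_ract_C[OF a]] _ coact_closed[OF u]])
      (simp_all add: s(2) SC.tlift_pure[OF C.abelian_group_axioms b] C_simps C_lr a S_functionalD[OF g])
  then show ?thesis by (simp add: gcan_def right_linearD(2)[OF coact_right a u])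
qed

text \<open>Left \<open>B\<close>-linearity of the coaction, seen through a functional on \<open>\<Sigma>\<close>.\<close>

lemma gcan_lact:
  assumes g: "S_functional g" and b: "b \<in> carrier B" and u: "u \<in> carrier S"
  shows "gcan g (b \<odot>\<^bsub>S\<^esub> u) = gcan (\<lambda>x. g (b \<odot>\<^bsub>S\<^esub> x)) u"
proof -
  have bS: "additive_map S S (smult S b)" using b by (auto intro: additive_mapI simp: S_simps)
  have gb: "S_functional (\<lambda>x. g (b \<odot>\<^bsub>S\<^esub> x))"
    by (auto intro!: S_functionalI simp: S_functionalD[OF g] b S_simps com.lact_ract[symmetric])
  note s = SC.smult_tensor[OF bS, OF com.lact_ract[symmetric, OF b]]
  note t = SC.tlift_additive[OF C.abelian_group_axioms balanced_gcan[OF g]]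
  have "tlift C (\<lambda>x c. g x \<odot>\<^bsub>C\<^esub> c) (b \<odot>\<^bsub>tensor A S C\<^esub> \<rho> u) = tlift C (\<lambda>x c. g (b \<odot>\<^bsub>S\<^esub> x) \<odot>\<^bsub>C\<^esub> c) (\<rho> u)"
    by (rule SC.additive_map_eq_on_pure[OF C.abelian_group_axioms additive_map_comp[OF s(1) t]
          SC.tlift_additive[OF C.abelian_group_axioms balanced_gcan[OF gb]] _ coact_closed[OF u]])
      (simp_all add: s(2) SC.tlift_pure[OF C.abelian_group_axioms balanced_gcan[OF g]]
        SC.tlift_pure[OF C.abelian_group_axioms balanced_gcan[OF gb]] S_simps b)
  then show ?thesis by (simp add: gcan_def left_linearD(2)[OF com.coact_left_linear b u])
qed

lemma S_act_closed: "C_functional f \<Longrightarrow> u \<in> carrier S \<Longrightarrow> S_act u f \<in> carrier S"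
  unfolding S_act_def
  by (rule SC.tlift_closed[OF S.abelian_group_axioms balanced_S_act coact_closed])

text \<open>Both sides are \<open>g(u\<^sub>[\<^sub>0\<^sub>]) f(u\<^sub>[\<^sub>1\<^sub>])\<close>.\<close>

lemma functional_S_act:
  assumes g: "S_functional g" and f: "C_functional f" and u: "u \<in> carrier S"
  shows "g (S_act u f) = f (gcan g u)"
proof -
  have ga: "additive_map S A g" using g by (simp add: right_linear_def additive_regular)
  have fa: "additive_map C A f" using f by (simp add: left_linear_def additive_regular)
  have 1: "g (S_act u f) = tlift A (\<lambda>x c. g (x \<triangleleft>\<^bsub>S\<^esub> f c)) (\<rho> u)"
    unfolding S_act_def
    by (rule SC.additive_map_tlift[OF S.abelian_group_axioms A.abelian_group_axioms
          balanced_S_act[OF f] ga coact_closed[OF u]])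
  have 2: "f (gcan g u) = tlift A (\<lambda>x c. f (g x \<odot>\<^bsub>C\<^esub> c)) (\<rho> u)"
    unfolding gcan_def
    by (rule SC.additive_map_tlift[OF C.abelian_group_axioms A.abelian_group_axioms
          balanced_gcan[OF g] fa coact_closed[OF u]])
  show ?thesis unfolding 1 2
    by (rule SC.tlift_cong[OF A.abelian_group_axioms balanced_comp[OF balanced_S_act[OF f] ga]
          balanced_comp[OF balanced_gcan[OF g] fa]])
      (simp_all add: coact_closed u S_functionalD[OF g] C_functionalD[OF f])
qed

end


context bicomodule_setting
begin

text \<open>Coassociativity of the coaction enters only through this identity:
  \<open>g(u\<^sub>[\<^sub>0\<^sub>]) u\<^sub>[\<^sub>1\<^sub>] f(u\<^sub>[\<^sub>2\<^sub>])\<close> can be read in two ways.\<close>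

lemma gcan_S_act:
  assumes g: "S_functional g" and f: "C_functional f" and u: "u \<in> carrier S"
  shows "gcan g (S_act u f) = coring_act C (gcan g u) f"
proof -
  let ?CC = "tensor A C C" and ?SC = "tensor A S C"
  note aC = C.abelian_group_axioms
  define h where "h = tlift C (\<lambda>x c. x \<triangleleft>\<^bsub>C\<^esub> f c)"
  have h: "additive_map ?CC C h"
    unfolding h_def by (rule CC.tlift_additive[OF aC balanced_C_act[OF f]])
  have h_pure: "h (pure A C C c d) = c \<triangleleft>\<^bsub>C\<^esub> f d" if "c \<in> carrier C" "d \<in> carrier C" for c d
    unfolding h_def by (rule CC.tlift_pure[OF aC balanced_C_act[OF f] that])
  have h_lact: "h (a \<odot>\<^bsub>?CC\<^esub> X) = a \<odot>\<^bsub>C\<^esub> h X" if "a \<in> carrier A" "X \<in> carrier ?CC" for a X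
    unfolding h_def by (rule contract_lact[OF f that])
  have CCl: "additive_map ?CC ?CC (smult ?CC a)"
    "x \<in> carrier C \<Longrightarrow> y \<in> carrier C \<Longrightarrow> a \<odot>\<^bsub>?CC\<^esub> pure A C C x y = pure A C C (a \<odot>\<^bsub>C\<^esub> x) y"
    if "a \<in> carrier A" for a x y
    using CC.smult_tensor[OF additive_smult_C[OF that] C_lr[symmetric]] that by blast+
  have SCr: "additive_map ?SC ?SC (\<lambda>X. X \<triangleleft>\<^bsub>?SC\<^esub> a)"
    "x \<in> carrier S \<Longrightarrow> y \<in> carrier C \<Longrightarrow> pure A S C x y \<triangleleft>\<^bsub>?SC\<^esub> a = pure A S C x (y \<triangleleft>\<^bsub>C\<^esub> a)"
    if "a \<in> carrier A" for a x y
    using SC.ract_tensor[OF additive_ract_C[OF that] C_lr] that by blast+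
  interpret CC: abelian_group ?CC by (rule CC.abelian_group_tensor)
  interpret SC: abelian_group ?SC by (rule SC.abelian_group_tensor)
  interpret S_CC: tensor_pair A S ?CC
    by unfold_locales (auto simp: S_simps intro: additive_map_closed[OF CCl(1)])
  interpret SC_C: tensor_pair A ?SC C
    by unfold_locales (auto simp: C_simps intro: additive_map_closed[OF SCr(1)])
  let ?S_CC = "tensor A S ?CC" and ?SC_C = "tensor A ?SC C"
  note hc = additive_map_closed[OF h]
  define \<Phi> where "\<Phi> = tlift C (\<lambda>x Y. g x \<odot>\<^bsub>C\<^esub> h Y)"
  have b\<Phi>: "balanced A S ?CC C (\<lambda>x Y. g x \<odot>\<^bsub>C\<^esub> h Y)"
    by (rule balancedI)
      (simp_all add: C_simps hc S_functionalD[OF g] C_lassoc h_lact additive_map_add[OF h])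
  have \<Phi>: "additive_map ?S_CC C \<Phi>"
    unfolding \<Phi>_def by (rule S_CC.tlift_additive[OF aC b\<Phi>])
  have \<Phi>_pure: "\<Phi> (pure A S ?CC x Y) = g x \<odot>\<^bsub>C\<^esub> h Y" if "x \<in> carrier S" "Y \<in> carrier ?CC" for x Y
    unfolding \<Phi>_def by (rule S_CC.tlift_pure[OF aC b\<Phi> that])

  \<comment> \<open>\<open>\<Phi>\<close> of the right hand side of coassociativity.\<close>
  have id_add: "additive_map M M id" for M :: "('p, 'q) ring_scheme" by (auto intro: additive_mapI)
  have b1: "balanced A S C ?S_CC (\<lambda>x c. pure A S ?CC (id x) (comult C c))"
    by (rule SC.balanced_pure_map[OF S_CC.tensor_pair_axioms id_add left_linearD(1)[OF comult_left]])
      (simp_all add: left_linearD(2)[OF comult_left])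
  have R: "\<Phi> (tensor_map A S ?CC id (comult C) (\<rho> u)) = coring_act C (gcan g u) f"
  proof -
    have "\<Phi> (tensor_map A S ?CC id (comult C) (\<rho> u))
      = tlift C (\<lambda>x c. \<Phi> (pure A S ?CC (id x) (comult C c))) (\<rho> u)"
      unfolding tensor_map_def
      by (rule SC.additive_map_tlift[OF S_CC.abelian_group_tensor aC b1 \<Phi> coact_closed[OF u]])
    also have "\<dots> = tlift C (\<lambda>x c. coring_act C (g x \<odot>\<^bsub>C\<^esub> c) f) (\<rho> u)"
      by (rule SC.tlift_cong[OF aC balanced_comp[OF b1 \<Phi>]
            balanced_comp[OF balanced_gcan[OF g] coring_act_additive[OF f]]])
        (simp_all add: coact_closed[OF u] \<Phi>_pure comult_closed coring_act_lact[OF f] S_functionalD[OF g],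
         simp_all add: h_def coring_act_def)
    also have "\<dots> = coring_act C (gcan g u) f"
      unfolding gcan_def
      by (rule SC.additive_map_tlift[symmetric, OF aC aC balanced_gcan[OF g] coring_act_additive[OF f]
            coact_closed[OF u]])
    finally show ?thesis .
  qed

  \<comment> \<open>\<open>\<Phi>\<close> of the left hand side.\<close>
  have b2: "balanced A S C ?S_CC (\<lambda>x y. pure A S ?CC x (pure A C C y z))" if z: "z \<in> carrier C" for z
    by (rule balancedI)
      (simp_all add: S_CC.pure_closed CC.pure_closed z S_simps C_simps
        additive_map_add[OF balanced_left[OF S_CC.balanced_pure]]
        additive_map_add[OF balanced_right[OF S_CC.balanced_pure]]
        additive_map_add[OF balanced_left[OF CC.balanced_pure]]
        balanced_mid[OF S_CC.balanced_pure] CCl(2))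
  define as where "as X z = tlift ?S_CC (\<lambda>x y. pure A S ?CC x (pure A C C y z)) X" for X z
  have as_add: "additive_map ?SC ?S_CC (\<lambda>X. as X z)" if "z \<in> carrier C" for z
    unfolding as_def by (rule SC.tlift_additive[OF S_CC.abelian_group_tensor b2[OF that]])
  have as_pure: "as (pure A S C x y) z = pure A S ?CC x (pure A C C y z)"
    if "x \<in> carrier S" "y \<in> carrier C" "z \<in> carrier C" for x y z
    unfolding as_def by (rule SC.tlift_pure[OF S_CC.abelian_group_tensor b2[OF that(3)] that(1,2)])
  note asc = additive_map_closed[OF as_add]
  have b3: "balanced A ?SC C ?S_CC as"
  proof (rule balancedI)
    interpret S_CC': abelian_group ?S_CC by (rule S_CC.abelian_group_tensor)
    fix X assume X: "X \<in> carrier ?SC"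
    fix z assume z: "z \<in> carrier C"
    show "as X z \<in> carrier ?S_CC" by (rule asc[OF z X])
    fix z' assume z': "z' \<in> carrier C"
    show "as X (z \<oplus>\<^bsub>C\<^esub> z') = as X z \<oplus>\<^bsub>?S_CC\<^esub> as X z'"
    proof (rule SC.additive_map_eq_on_pure[OF S_CC.abelian_group_tensor as_add _ _ X])
      show "additive_map ?SC ?S_CC (\<lambda>X. as X z \<oplus>\<^bsub>?S_CC\<^esub> as X z')"
        by (rule additive_mapI)
          (auto simp: asc z z' additive_map_add[OF as_add] S_CC'.a_ac)
    qed (auto simp: as_pure z z' additive_map_add[OF balanced_right[OF S_CC.balanced_pure]]
         additive_map_add[OF balanced_right[OF CC.balanced_pure]] CC.pure_closed)
  next
    fix X a z assume X: "X \<in> carrier ?SC" and a: "a \<in> carrier A" and z: "z \<in> carrier C"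
    show "as (X \<triangleleft>\<^bsub>?SC\<^esub> a) z = as X (a \<odot>\<^bsub>C\<^esub> z)"
      by (rule SC.additive_map_eq_on_pure[OF S_CC.abelian_group_tensor
            additive_map_comp[OF SCr(1)[OF a] as_add] as_add _ X])
        (simp_all add: a z C_simps SCr(2)[OF a] as_pure balanced_mid[OF CC.balanced_pure])
  qed (simp add: additive_map_add[OF as_add])
  have assoc: "tensor_assoc A A S C C = tlift ?S_CC as"
    unfolding tensor_assoc_def as_def[abs_def] Let_def ..
  have b4: "balanced A S C ?SC_C (\<lambda>x c. pure A ?SC C (\<rho> x) (id c))"
    by (rule SC.balanced_pure_map[OF SC_C.tensor_pair_axioms coact_additive id_add])
      (simp_all add: right_linearD(2)[OF coact_right])
  note as_lift = SC_C.tlift_additive[OF S_CC.abelian_group_tensor b3]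
  have as_eval: "\<Phi> (as X c) = tlift C (\<lambda>x y. g x \<odot>\<^bsub>C\<^esub> y) X \<triangleleft>\<^bsub>C\<^esub> f c"
    if X: "X \<in> carrier ?SC" and c: "c \<in> carrier C" for X c
    by (rule SC.additive_map_eq_on_pure[OF aC additive_map_comp[OF as_add[OF c] \<Phi>]
          additive_map_comp[OF SC.tlift_additive[OF aC balanced_gcan[OF g]] additive_ract_C] _ X])
      (simp_all add: as_pure c \<Phi>_pure CC.pure_closed h_pure C_lr S_functionalD[OF g] C_functionalD[OF f]
        SC.tlift_pure[OF aC balanced_gcan[OF g]])
  have L: "\<Phi> (tensor_assoc A A S C C (tensor_map A ?SC C \<rho> id (\<rho> u))) = gcan g (S_act u f)"
  proof -
    have "\<Phi> (tensor_assoc A A S C C (tensor_map A ?SC C \<rho> id (\<rho> u)))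
      = tlift C (\<lambda>x c. \<Phi> (tensor_assoc A A S C C (pure A ?SC C (\<rho> x) (id c)))) (\<rho> u)"
      unfolding tensor_map_def assoc
      by (rule SC.additive_map_tlift[OF SC_C.abelian_group_tensor aC b4
            additive_map_comp[OF as_lift \<Phi>] coact_closed[OF u]])
    also have "\<dots> = tlift C (\<lambda>x c. gcan g (x \<triangleleft>\<^bsub>S\<^esub> f c)) (\<rho> u)"
      unfolding assoc
      by (rule SC.tlift_cong[OF aC balanced_comp[OF b4 additive_map_comp[OF as_lift \<Phi>]]
            balanced_comp[OF balanced_S_act[OF f] gcan_additive[OF g]]])
        (simp_all add: coact_closed u SC_C.tlift_pure[OF S_CC.abelian_group_tensor b3]
          as_eval gcan_ract[OF g] C_functionalD[OF f], simp add: gcan_def)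
    also have "\<dots> = gcan g (S_act u f)"
      unfolding S_act_def
      by (rule SC.additive_map_tlift[symmetric, OF S.abelian_group_axioms aC balanced_S_act[OF f]
            gcan_additive[OF g] coact_closed[OF u]])
    finally show ?thesis .
  qed
  show ?thesis
    using com.comod.coact_coassoc[OF u] L R by simp
qed

text \<open>Counitality of the coaction.\<close>

lemma counit_functional: "C_functional (counit C)"
  using cor.counit_map by (simp add: bimodule_map_def)

lemma gcan_counit:
  assumes "S_functional g" "u \<in> carrier S"
  shows "counit C (gcan g u) = g u"
  using functional_S_act[OF assms(1) counit_functional assms(2)] com.comod.coact_counit[OF assms(2)]
  by (simp add: S_act_def)

section \<open>Evaluation of \<open>\<C> \<otimes>\<^sub>A \<Sigma>\<^sup>*\<close> and the bimodule \<open>Q\<close>\<close>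

text \<open>\<open>ev u\<close> sends \<open>c \<otimes> g\<close> to \<open>c g(u)\<close>; together these maps identify \<open>\<C> \<otimes>\<^sub>A \<Sigma>\<^sup>*\<close> with
  \<open>Hom\<^sub>A(\<Sigma>, \<C>)\<close>.\<close>

definition ev :: "'s \<Rightarrow> ('c, 's \<Rightarrow> 'a) tens \<Rightarrow> 'c" where
  "ev u = tlift C (\<lambda>c g. c \<triangleleft>\<^bsub>C\<^esub> g u)"

lemma balanced_ev: "u \<in> carrier S \<Longrightarrow> balanced A C (dual A S) C (\<lambda>c g. c \<triangleleft>\<^bsub>C\<^esub> g u)"
  by (rule balancedI) (auto simp: C_simps dual_iff S_functionalD dual_simps C_rassoc)

lemma ev_additive: "u \<in> carrier S \<Longrightarrow> additive_map (tensor A C (dual A S)) C (ev u)"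
  unfolding ev_def by (rule CD.tlift_additive[OF C.abelian_group_axioms balanced_ev])

lemma ev_pure: "u \<in> carrier S \<Longrightarrow> c \<in> carrier C \<Longrightarrow> g \<in> carrier (dual A S)
    \<Longrightarrow> ev u (pure A C (dual A S) c g) = c \<triangleleft>\<^bsub>C\<^esub> g u"
  unfolding ev_def by (rule CD.tlift_pure[OF C.abelian_group_axioms balanced_ev])

lemma ev_tensor_map:
  assumes q: "left_linear A C (dual A S) q" and c: "c \<in> carrier C" and u: "u \<in> carrier S"
  shows "ev u (tensor_map A C (dual A S) id q (comult C c)) = coring_act C c (\<lambda>y. q y u)"
    and "tensor_map A C (dual A S) id q (comult C c) \<in> carrier (tensor A C (dual A S))"
    and "C_functional (\<lambda>y. q y u)"
proof -
  have qc: "q y \<in> carrier (dual A S)" if "y \<in> carrier C" for y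
    by (rule additive_map_closed[OF left_linearD(1)[OF q] that])
  have qc': "q y v \<in> carrier A" if "y \<in> carrier C" "v \<in> carrier S" for y v
    using S_functionalD(1)[OF S_functional_dual[OF qc]] that .
  show f: "C_functional (\<lambda>y. q y u)"
    by (rule C_functionalI)
      (simp_all add: qc' u additive_map_add[OF left_linearD(1)[OF q]] left_linearD(2)[OF q] dual_simps)
  have b: "balanced A C C (tensor A C (dual A S)) (\<lambda>x y. pure A C (dual A S) (id x) (q y))"
    by (rule CC.balanced_pure_map[OF CD.tensor_pair_axioms _ left_linearD(1)[OF q]])
      (auto intro: additive_mapI simp: left_linearD(2)[OF q])
  show "tensor_map A C (dual A S) id q (comult C c) \<in> carrier (tensor A C (dual A S))"
    unfolding tensor_map_def by (rule CC.tlift_closed[OF CD.abelian_group_tensor b comult_closed[OF c]])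
  have "ev u (tensor_map A C (dual A S) id q (comult C c))
      = tlift C (\<lambda>x y. ev u (pure A C (dual A S) (id x) (q y))) (comult C c)"
    unfolding tensor_map_def
    by (rule CC.additive_map_tlift[OF CD.abelian_group_tensor C.abelian_group_axioms b
          ev_additive[OF u] comult_closed[OF c]])
  also have "\<dots> = coring_act C c (\<lambda>y. q y u)"
    unfolding coring_act_def
    by (rule CC.tlift_cong[OF C.abelian_group_axioms balanced_comp[OF b ev_additive[OF u]]
          balanced_C_act[OF f]])
      (simp_all add: ev_pure u qc comult_closed c)
  finally show "ev u (tensor_map A C (dual A S) id q (comult C c)) = coring_act C c (\<lambda>y. q y u)" .
qed

context
  fixes es :: "('s \<times> ('s \<Rightarrow> 'a)) list"
  assumes es: "dual_basis A S es"
begin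

abbreviation basis_vec where "basis_vec i \<equiv> fst (es ! i)"
abbreviation basis_fun where "basis_fun i \<equiv> snd (es ! i)"
abbreviation basis_idx where "basis_idx \<equiv> {..<length es}"

lemma e_closed: "i \<in> basis_idx \<Longrightarrow> basis_vec i \<in> carrier S"
  and f_closed: "i \<in> basis_idx \<Longrightarrow> basis_fun i \<in> carrier (dual A S)"
proof -
  assume "i \<in> basis_idx"
  then have "es ! i \<in> carrier S \<times> carrier (dual A S)"
    using es by (auto simp: dual_basis_def simp del: mem_Sigma_iff)
  then show "basis_vec i \<in> carrier S" "basis_fun i \<in> carrier (dual A S)" by auto
qed

lemma f_val: "i \<in> basis_idx \<Longrightarrow> u \<in> carrier S \<Longrightarrow> basis_fun i u \<in> carrier A"
  by (rule S_functionalD(1)[OF S_functional_dual[OF f_closed]])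

lemma basis_expand: "u \<in> carrier S \<Longrightarrow> (\<Oplus>\<^bsub>S\<^esub>i \<in> basis_idx. basis_vec i \<triangleleft>\<^bsub>S\<^esub> basis_fun i u) = u"
  using es by (auto simp: dual_basis_def)

lemma basis_expand_additive:
  assumes "additive_map S H h" "abelian_group H" "u \<in> carrier S"
  shows "(\<Oplus>\<^bsub>H\<^esub>i \<in> basis_idx. h (basis_vec i \<triangleleft>\<^bsub>S\<^esub> basis_fun i u)) = h u"
  using additive_map_finsum[OF assms(1) S.abelian_group_axioms assms(2), of "\<lambda>i. basis_vec i \<triangleleft>\<^bsub>S\<^esub> basis_fun i u" basis_idx]
    basis_expand[OF assms(3)] assms(3)
  by (auto simp: S_simps e_closed f_val)

lemma dual_expand:
  assumes g: "g \<in> carrier (dual A S)"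
  shows "(\<Oplus>\<^bsub>dual A S\<^esub>i \<in> basis_idx. g (basis_vec i) \<odot>\<^bsub>dual A S\<^esub> basis_fun i) = g"
proof -
  note gf = S_functional_dual[OF g]
  let ?s = "\<Oplus>\<^bsub>dual A S\<^esub>i \<in> basis_idx. g (basis_vec i) \<odot>\<^bsub>dual A S\<^esub> basis_fun i"
  have t: "(\<lambda>i. g (basis_vec i) \<odot>\<^bsub>dual A S\<^esub> basis_fun i) \<in> basis_idx \<rightarrow> carrier (dual A S)"
    by (auto intro!: dual_lact_closed S_functionalD(1)[OF gf] e_closed f_closed)
  have s: "?s \<in> carrier (dual A S)" by (rule D.finsum_closed[OF t])
  show ?thesis
  proof (rule extensionalityI[where A = "carrier S"])
    fix u assume u: "u \<in> carrier S"
    have "additive_map (dual A S) A (\<lambda>g. g u)"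
      by (rule additive_mapI) (auto simp: dual_iff S_functionalD dual_simps u)
    then have "?s u = (\<Oplus>\<^bsub>A\<^esub>i \<in> basis_idx. (g (basis_vec i) \<odot>\<^bsub>dual A S\<^esub> basis_fun i) u)"
      by (rule additive_map_finsum[OF _ abelian_group_dual A.abelian_group_axioms t])
    also have "\<dots> = (\<Oplus>\<^bsub>A\<^esub>i \<in> basis_idx. g (basis_vec i \<triangleleft>\<^bsub>S\<^esub> basis_fun i u))"
      using u by (intro A.finsum_cong') (auto simp: dual_simps S_functionalD[OF gf] e_closed f_val S_simps)
    also have "\<dots> = g u"
      using gf by (intro basis_expand_additive[OF _ A.abelian_group_axioms u])
        (simp add: right_linear_def additive_regular)
    finally show "?s u = g u" .
  qed (use s g in \<open>auto simp: dual_iff\<close>)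
qed

text \<open>The elements of \<open>\<C> \<otimes>\<^sub>A \<Sigma>\<^sup>* \<cong> Hom\<^sub>A(\<Sigma>, \<C>)\<close> are determined by their values.\<close>

lemma ev_expand:
  assumes X: "X \<in> carrier (tensor A C (dual A S))"
  shows "(\<Oplus>\<^bsub>tensor A C (dual A S)\<^esub>i \<in> basis_idx. pure A C (dual A S) (ev (basis_vec i) X) (basis_fun i)) = X"
proof (rule CD.additive_map_eq_on_pure[OF CD.abelian_group_tensor _ _ _ X])
  let ?T = "tensor A C (dual A S)"
  interpret T: abelian_group ?T by (rule CD.abelian_group_tensor)
  have a: "additive_map ?T ?T (\<lambda>X. pure A C (dual A S) (ev (basis_vec i) X) (basis_fun i))" if "i \<in> basis_idx" for i
    by (rule additive_map_comp[OF ev_additive[OF e_closed[OF that]]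
          balanced_left[OF CD.balanced_pure f_closed[OF that]]])
  show "additive_map ?T ?T (\<lambda>X. \<Oplus>\<^bsub>?T\<^esub>i \<in> basis_idx. pure A C (dual A S) (ev (basis_vec i) X) (basis_fun i))"
  proof (rule additive_mapI)
    fix X Y assume XY: "X \<in> carrier ?T" "Y \<in> carrier ?T"
    show "(\<Oplus>\<^bsub>?T\<^esub>i \<in> basis_idx. pure A C (dual A S) (ev (basis_vec i) (X \<oplus>\<^bsub>?T\<^esub> Y)) (basis_fun i))
      = (\<Oplus>\<^bsub>?T\<^esub>i \<in> basis_idx. pure A C (dual A S) (ev (basis_vec i) X) (basis_fun i))
        \<oplus>\<^bsub>?T\<^esub> (\<Oplus>\<^bsub>?T\<^esub>i \<in> basis_idx. pure A C (dual A S) (ev (basis_vec i) Y) (basis_fun i))"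
      using XY additive_map_closed[OF a] additive_map_add[OF a]
      by (subst T.finsum_addf[symmetric]) (simp_all cong: T.finsum_cong)
  qed (auto intro!: T.finsum_closed additive_map_closed[OF a])
  show "additive_map ?T ?T (\<lambda>X. X)" by (auto intro: additive_mapI)
  fix c g assume c: "c \<in> carrier C" and g: "g \<in> carrier (dual A S)"
  note gA = S_functionalD(1)[OF S_functional_dual[OF g] e_closed]
  have "(\<Oplus>\<^bsub>?T\<^esub>i \<in> basis_idx. pure A C (dual A S) (ev (basis_vec i) (pure A C (dual A S) c g)) (basis_fun i))
    = (\<Oplus>\<^bsub>?T\<^esub>i \<in> basis_idx. pure A C (dual A S) c (g (basis_vec i) \<odot>\<^bsub>dual A S\<^esub> basis_fun i))"
    using c g gA e_closed f_closed
    by (intro T.finsum_cong')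
      (auto simp: ev_pure balanced_mid[OF CD.balanced_pure] intro!: CD.pure_closed dual_lact_closed)
  also have "\<dots> = pure A C (dual A S) c (\<Oplus>\<^bsub>dual A S\<^esub>i \<in> basis_idx. g (basis_vec i) \<odot>\<^bsub>dual A S\<^esub> basis_fun i)"
    using gA f_closed
    by (intro additive_map_finsum[OF balanced_right[OF CD.balanced_pure c]
          abelian_group_dual CD.abelian_group_tensor, symmetric]) (auto intro!: dual_lact_closed)
  finally show "(\<Oplus>\<^bsub>?T\<^esub>i \<in> basis_idx. pure A C (dual A S) (ev (basis_vec i) (pure A C (dual A S) c g)) (basis_fun i))
    = pure A C (dual A S) c g"
    by (simp add: dual_expand[OF g])
qed

lemma ev_inj:
  assumes "X \<in> carrier (tensor A C (dual A S))" "Y \<in> carrier (tensor A C (dual A S))"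
    and "\<And>u. u \<in> carrier S \<Longrightarrow> ev u X = ev u Y"
  shows "X = Y"
proof -
  interpret T: abelian_group "tensor A C (dual A S)" by (rule CD.abelian_group_tensor)
  have "(\<Oplus>\<^bsub>tensor A C (dual A S)\<^esub>i \<in> basis_idx. pure A C (dual A S) (ev (basis_vec i) X) (basis_fun i))
    = (\<Oplus>\<^bsub>tensor A C (dual A S)\<^esub>i \<in> basis_idx. pure A C (dual A S) (ev (basis_vec i) Y) (basis_fun i))"
    using assms e_closed f_closed
    by (intro T.finsum_cong') (auto intro!: CD.pure_closed additive_map_closed[OF ev_additive])
  then show ?thesis using ev_expand assms(1,2) by simp
qed

text \<open>The left coaction of \<open>\<Sigma>\<^sup>*\<close> corresponds to \<open>u \<mapsto> g(u\<^sub>[\<^sub>0\<^sub>]) u\<^sub>[\<^sub>1\<^sub>]\<close>.\<close>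

lemma coact_sum_ev:
  assumes g: "g \<in> carrier (dual A S)"
  defines "X \<equiv> \<Oplus>\<^bsub>tensor A C (dual A S)\<^esub>i \<in> basis_idx. pure A C (dual A S) (gcan g (basis_vec i)) (basis_fun i)"
  shows "X \<in> carrier (tensor A C (dual A S))" and "u \<in> carrier S \<Longrightarrow> ev u X = gcan g u"
proof -
  interpret T: abelian_group "tensor A C (dual A S)" by (rule CD.abelian_group_tensor)
  note gf = S_functional_dual[OF g]
  have t: "(\<lambda>i. pure A C (dual A S) (gcan g (basis_vec i)) (basis_fun i)) \<in> basis_idx \<rightarrow> carrier (tensor A C (dual A S))"
    by (auto intro!: CD.pure_closed gcan_closed[OF gf] e_closed f_closed)
  show "X \<in> carrier (tensor A C (dual A S))"
    unfolding X_def by (rule T.finsum_closed[OF t])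
  assume u: "u \<in> carrier S"
  have "ev u X = (\<Oplus>\<^bsub>C\<^esub>i \<in> basis_idx. ev u (pure A C (dual A S) (gcan g (basis_vec i)) (basis_fun i)))"
    unfolding X_def
    by (rule additive_map_finsum[OF ev_additive[OF u] CD.abelian_group_tensor C.abelian_group_axioms t])
  also have "\<dots> = (\<Oplus>\<^bsub>C\<^esub>i \<in> basis_idx. gcan g (basis_vec i \<triangleleft>\<^bsub>S\<^esub> basis_fun i u))"
    using u by (intro C.finsum_cong')
      (auto simp: ev_pure gcan_closed[OF gf] e_closed f_closed gcan_ract[OF gf] f_val S_simps C_simps)
  also have "\<dots> = gcan g u"
    by (rule basis_expand_additive[OF gcan_additive[OF gf] C.abelian_group_axioms u])
  finally show "ev u X = gcan g u" .
qed

end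

lemma dual_coact_ev:
  assumes "\<exists>es. dual_basis A S es" and g: "g \<in> carrier (dual A S)"
  shows "dual_coact A C S \<rho> g \<in> carrier (tensor A C (dual A S))"
    and "u \<in> carrier S \<Longrightarrow> ev u (dual_coact A C S \<rho> g) = gcan g u"
proof -
  define es where "es = (SOME es. dual_basis A S es)"
  have es: "dual_basis A S es" unfolding es_def by (rule someI_ex) fact
  have eq: "dual_coact A C S \<rho> g = (\<Oplus>\<^bsub>tensor A C (dual A S)\<^esub>i \<in> {..<length es}.
       pure A C (dual A S) (gcan g (fst (es ! i))) (snd (es ! i)))"
    by (simp add: dual_coact_def Let_def es_def gcan_def)
  show "dual_coact A C S \<rho> g \<in> carrier (tensor A C (dual A S))"
    and "u \<in> carrier S \<Longrightarrow> ev u (dual_coact A C S \<rho> g) = gcan g u"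
    unfolding eq using coact_sum_ev[OF es g] .
qed

text \<open>Colinearity of \<open>q\<close>, made explicit: \<open>q(c)(u\<^sub>[\<^sub>0\<^sub>]) u\<^sub>[\<^sub>1\<^sub>] = c\<^sub>(\<^sub>1\<^sub>) q(c\<^sub>(\<^sub>2\<^sub>))(u)\<close>.\<close>

lemma Q_iff:
  assumes ex: "\<exists>es. dual_basis A S es"
  shows "q \<in> carrier (Q_group A C S \<rho>) \<longleftrightarrow>
    q \<in> extensional (carrier C) \<and> left_linear A C (dual A S) q \<and>
    (\<forall>c \<in> carrier C. \<forall>u \<in> carrier S. gcan (q c) u = coring_act C c (\<lambda>y. q y u))"
proof -
  have "dual_coact A C S \<rho> (q c) = tensor_map A C (dual A S) id q (comult C c) \<longleftrightarrow>
      (\<forall>u \<in> carrier S. gcan (q c) u = coring_act C c (\<lambda>y. q y u))"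
    if q: "left_linear A C (dual A S) q" and c: "c \<in> carrier C" for c
  proof -
    have qc: "q c \<in> carrier (dual A S)" by (rule additive_map_closed[OF left_linearD(1)[OF q] c])
    obtain es where es: "dual_basis A S es" using ex ..
    show ?thesis
      using ev_inj[OF es dual_coact_ev(1)[OF ex qc] ev_tensor_map(2)[OF q c S.zero_closed]]
        dual_coact_ev(2)[OF ex qc] ev_tensor_map(1)[OF q c] by metis
  qed
  then show ?thesis by (auto simp: Q_group_def left_comod_hom_def left_hom_def)
qed

end


section \<open>\<open>\<Sigma>\<^sup>*\<close> and \<open>Q\<close> as right \<open>B\<close>-modules\<close>

context bicomodule_setting
begin

lemma dual_eval: "u \<in> carrier S \<Longrightarrow> additive_map (dual A S) A (\<lambda>g. g u)"
  by (rule additive_mapI) (auto simp: dual_iff S_functionalD dual_simps)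

lemma star_eval: "c \<in> carrier C \<Longrightarrow> additive_map (star A C) A (\<lambda>f. f c)"
  by (rule additive_mapI) (auto simp: star_iff C_functionalD star_simps)

lemma dual_minus: "g \<in> carrier (dual A S) \<Longrightarrow> u \<in> carrier S \<Longrightarrow> (\<ominus>\<^bsub>dual A S\<^esub> g) u = \<ominus>\<^bsub>A\<^esub> g u"
  by (rule additive_map_minus[OF dual_eval abelian_group_dual A.abelian_group_axioms])

lemma star_minus: "f \<in> carrier (star A C) \<Longrightarrow> c \<in> carrier C \<Longrightarrow> (\<ominus>\<^bsub>star A C\<^esub> f) c = \<ominus>\<^bsub>A\<^esub> f c"
  by (rule additive_map_minus[OF star_eval abelian_group_star A.abelian_group_axioms])

lemma gcan_additive_left:
  assumes u: "u \<in> carrier S"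
  shows "additive_map (dual A S) C (\<lambda>g. gcan g u)"
proof (rule additive_mapI)
  fix g h assume "g \<in> carrier (dual A S)" "h \<in> carrier (dual A S)"
  then have gh: "S_functional g" "S_functional h" "S_functional (g \<oplus>\<^bsub>dual A S\<^esub> h)"
    using S_functional_dual D.a_closed by auto
  show "gcan (g \<oplus>\<^bsub>dual A S\<^esub> h) u = gcan g u \<oplus>\<^bsub>C\<^esub> gcan h u"
    unfolding gcan_add_left[OF gh(1,2) u, symmetric]
    by (rule gcan_cong[OF gh(3) _ u]) (simp add: dual_simps)
qed (simp add: gcan_closed S_functional_dual u)

lemma coring_act_additive_right:
  assumes c: "c \<in> carrier C"
  shows "additive_map (star A C) C (coring_act C c)"
proof (rule additive_mapI)
  fix g h assume "g \<in> carrier (star A C)" "h \<in> carrier (star A C)"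
  then have gh: "C_functional g" "C_functional h" "C_functional (g \<oplus>\<^bsub>star A C\<^esub> h)"
    using C_functional_star star.a_closed by auto
  show "coring_act C c (g \<oplus>\<^bsub>star A C\<^esub> h) = coring_act C c g \<oplus>\<^bsub>C\<^esub> coring_act C c h"
    unfolding coring_act_add_right[OF gh(1,2) c, symmetric]
    by (rule coring_act_cong[OF gh(3) _ c]) (simp add: star_simps)
qed (simp add: coring_act_closed C_functional_star c)

lemma dual_smult_additive: "a \<in> carrier A \<Longrightarrow> additive_map (dual A S) (dual A S) (smult (dual A S) a)"
  by (rule additive_mapI)
    (auto simp: dual_lact_closed, auto simp: dual_simps dual_iff S_functionalD A.r_distr intro!: restrict_ext)

lemma dual_ract_additive:
  "b \<in> carrier B \<Longrightarrow> additive_map (dual A S) (dual A S) (\<lambda>g. g \<triangleleft>\<^bsub>dual A S\<^esub> b)"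
  by (rule additive_mapI)
    (auto simp: dual_ract_closed, auto simp: dual_simps dual_iff S_functionalD S_simps intro!: restrict_ext)

lemma dual_right_module: "right_module B (dual A S)"
proof unfold_locales
  fix g assume g: "g \<in> carrier (dual A S)"
  show "g \<triangleleft>\<^bsub>dual A S\<^esub> \<one>\<^bsub>B\<^esub> = g"
    using g by (intro extensionalityI[where A = "carrier S"]) (auto simp: dual_simps dual_iff com.left.lact_one)
qed (auto simp: dual_ract_closed additive_map_add[OF dual_ract_additive],
   auto simp: dual_simps dual_iff S_functionalD S_simps intro!: restrict_ext)

lemma Q_A_B_simps:
  "carrier (Q_A_B A C S \<rho>) = carrier (Q_group A C S \<rho>)"
  "add (Q_A_B A C S \<rho>) = (\<lambda>p q. \<lambda>c \<in> carrier C. p c \<oplus>\<^bsub>dual A S\<^esub> q c)"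
  "\<zero>\<^bsub>Q_A_B A C S \<rho>\<^esub> = (\<lambda>c \<in> carrier C. \<zero>\<^bsub>dual A S\<^esub>)"
  "smult (Q_A_B A C S \<rho>) = (\<lambda>a q. \<lambda>c \<in> carrier C. q (c \<triangleleft>\<^bsub>C\<^esub> a))"
  "ract (Q_A_B A C S \<rho>) = (\<lambda>q b. \<lambda>c \<in> carrier C. \<lambda>u \<in> carrier S. q c (b \<odot>\<^bsub>S\<^esub> u))"
  by (simp_all add: Q_A_B_def Q_group_def)

lemma left_linear_dualI:
  assumes "\<And>c. c \<in> carrier C \<Longrightarrow> q c \<in> carrier (dual A S)"
    and "\<And>c d. c \<in> carrier C \<Longrightarrow> d \<in> carrier C \<Longrightarrow> q (c \<oplus>\<^bsub>C\<^esub> d) = q c \<oplus>\<^bsub>dual A S\<^esub> q d"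
    and "\<And>c a. c \<in> carrier C \<Longrightarrow> a \<in> carrier A \<Longrightarrow> q (a \<odot>\<^bsub>C\<^esub> c) = a \<odot>\<^bsub>dual A S\<^esub> q c"
  shows "left_linear A C (dual A S) (restrict q (carrier C))"
  using assms by (auto simp: left_linear_def C_simps intro!: additive_mapI)

context
  assumes ex: "\<exists>es. dual_basis A S es"
begin

lemma QD:
  assumes "q \<in> carrier (Q_A_B A C S \<rho>)"
  shows "q \<in> extensional (carrier C)" "left_linear A C (dual A S) q"
    "c \<in> carrier C \<Longrightarrow> q c \<in> carrier (dual A S)" "c \<in> carrier C \<Longrightarrow> S_functional (q c)"
    "u \<in> carrier S \<Longrightarrow> C_functional (\<lambda>y. q y u)"
    "c \<in> carrier C \<Longrightarrow> d \<in> carrier C \<Longrightarrow> q (c \<oplus>\<^bsub>C\<^esub> d) = q c \<oplus>\<^bsub>dual A S\<^esub> q d"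
    "c \<in> carrier C \<Longrightarrow> a \<in> carrier A \<Longrightarrow> q (a \<odot>\<^bsub>C\<^esub> c) = a \<odot>\<^bsub>dual A S\<^esub> q c"
    "c \<in> carrier C \<Longrightarrow> u \<in> carrier S \<Longrightarrow> gcan (q c) u = coring_act C c (\<lambda>y. q y u)"
proof -
  show *: "q \<in> extensional (carrier C)" "left_linear A C (dual A S) q"
    "c \<in> carrier C \<Longrightarrow> u \<in> carrier S \<Longrightarrow> gcan (q c) u = coring_act C c (\<lambda>y. q y u)"
    using assms by (auto simp: Q_A_B_simps Q_iff[OF ex])
  show "q c \<in> carrier (dual A S)" if "c \<in> carrier C"
    by (rule additive_map_closed[OF left_linearD(1)[OF *(2)] that])
  then show "S_functional (q c)" if "c \<in> carrier C" using that by (simp add: dual_iff)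
  show "C_functional (\<lambda>y. q y u)" if "u \<in> carrier S"
    by (rule ev_tensor_map(3)[OF *(2) C.zero_closed that])
qed (use assms in \<open>auto simp: Q_A_B_simps Q_iff[OF ex] left_linear_def additive_map_add\<close>)

text \<open>In \<open>QI\<close> the functional \<open>y \<mapsto> q(y)(u)\<close> is cut off outside \<open>\<C>\<close>, to make it an element of
  \<open>\<^sup>*\<C>\<close>.\<close>

lemma QI:
  assumes q: "\<And>c. c \<in> carrier C \<Longrightarrow> q c \<in> carrier (dual A S)"
    and "\<And>c d. c \<in> carrier C \<Longrightarrow> d \<in> carrier C \<Longrightarrow> q (c \<oplus>\<^bsub>C\<^esub> d) = q c \<oplus>\<^bsub>dual A S\<^esub> q d"
    and "\<And>c a. c \<in> carrier C \<Longrightarrow> a \<in> carrier A \<Longrightarrow> q (a \<odot>\<^bsub>C\<^esub> c) = a \<odot>\<^bsub>dual A S\<^esub> q c"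
    and gc: "\<And>c u. c \<in> carrier C \<Longrightarrow> u \<in> carrier S \<Longrightarrow> gcan (q c) u = coring_act C c (\<lambda>y\<in>carrier C. q y u)"
  shows "restrict q (carrier C) \<in> carrier (Q_A_B A C S \<rho>)"
proof -
  have l: "left_linear A C (dual A S) (restrict q (carrier C))"
    by (rule left_linear_dualI) fact+
  have "coring_act C c (\<lambda>y. restrict q (carrier C) y u) = coring_act C c (\<lambda>y\<in>carrier C. q y u)"
    if "c \<in> carrier C" "u \<in> carrier S" for c u
    by (rule coring_act_cong[OF ev_tensor_map(3)[OF l that]]) (auto simp: that)
  then show ?thesis using l gc by (simp add: Q_A_B_simps Q_iff[OF ex])
qed

lemma Q_star: "q \<in> carrier (Q_A_B A C S \<rho>) \<Longrightarrow> u \<in> carrier S \<Longrightarrow> (\<lambda>y\<in>carrier C. q y u) \<in> carrier (star A C)"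
  by (rule C_functional_restrict[OF QD(5)])

lemma Q_gcan:
  assumes "q \<in> carrier (Q_A_B A C S \<rho>)" "c \<in> carrier C" "u \<in> carrier S"
  shows "gcan (q c) u = coring_act C c (\<lambda>y\<in>carrier C. q y u)"
  unfolding QD(8)[OF assms] by (rule coring_act_cong[OF QD(5)[OF assms(1,3)] _ assms(2)]) simp

lemma abelian_group_Q: "abelian_group (Q_A_B A C S \<rho>)"
proof (rule abelian_group_pointwise[OF abelian_group_dual Q_A_B_simps(2,3)])
  note add = additive_map_add[OF gcan_additive_left] additive_map_add[OF coring_act_additive_right]
  note zero = additive_map_zero[OF gcan_additive_left abelian_group_dual C.abelian_group_axioms]
    additive_map_zero[OF coring_act_additive_right abelian_group_star C.abelian_group_axioms]
  note minus = additive_map_minus[OF gcan_additive_left abelian_group_dual C.abelian_group_axioms]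
    additive_map_minus[OF coring_act_additive_right abelian_group_star C.abelian_group_axioms]
  note smult = additive_map_add[OF dual_smult_additive]
    additive_map_zero[OF dual_smult_additive abelian_group_dual abelian_group_dual]
    additive_map_minus[OF dual_smult_additive abelian_group_dual abelian_group_dual]
  show "carrier (Q_A_B A C S \<rho>) \<subseteq> carrier C \<rightarrow>\<^sub>E carrier (dual A S)"
    using QD(1,3) by (auto simp: PiE_def)
  show "(\<lambda>x\<in>carrier C. \<zero>\<^bsub>dual A S\<^esub>) \<in> carrier (Q_A_B A C S \<rho>)"
  proof (rule QI)
    fix c u assume c: "c \<in> carrier C" and u: "u \<in> carrier S"
    have eq: "(\<lambda>y\<in>carrier C. \<zero>\<^bsub>dual A S\<^esub> u) = \<zero>\<^bsub>star A C\<^esub>" using u by (simp add: dual_simps star_simps)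
    show "gcan \<zero>\<^bsub>dual A S\<^esub> u = coring_act C c (\<lambda>y\<in>carrier C. \<zero>\<^bsub>dual A S\<^esub> u)"
      unfolding eq using zero c u by simp
  qed (simp_all add: smult)
  fix p assume p: "p \<in> carrier (Q_A_B A C S \<rho>)"
  show "(\<lambda>x\<in>carrier C. \<ominus>\<^bsub>dual A S\<^esub> p x) \<in> carrier (Q_A_B A C S \<rho>)"
  proof (rule QI)
    fix c u assume c: "c \<in> carrier C" and u: "u \<in> carrier S"
    note ps = Q_star[OF p u]
    have eq: "(\<lambda>y\<in>carrier C. (\<ominus>\<^bsub>dual A S\<^esub> p y) u) = \<ominus>\<^bsub>star A C\<^esub> (\<lambda>y\<in>carrier C. p y u)"
      using star.a_inv_closed[OF ps] ps QD(3)[OF p] u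
      by (intro extensionalityI[where A = "carrier C"]) (auto simp: star_minus dual_minus star_iff)
    show "gcan (\<ominus>\<^bsub>dual A S\<^esub> p c) u = coring_act C c (\<lambda>y\<in>carrier C. (\<ominus>\<^bsub>dual A S\<^esub> p y) u)"
      unfolding eq using minus c u ps QD(3)[OF p c] by (simp add: Q_gcan[OF p c u])
  qed (simp_all add: QD[OF p] D.minus_add D.a_comm smult)
  fix q assume q: "q \<in> carrier (Q_A_B A C S \<rho>)"
  show "(\<lambda>x\<in>carrier C. p x \<oplus>\<^bsub>dual A S\<^esub> q x) \<in> carrier (Q_A_B A C S \<rho>)"
  proof (rule QI)
    fix c u assume c: "c \<in> carrier C" and u: "u \<in> carrier S"
    have eq: "(\<lambda>y\<in>carrier C. (p y \<oplus>\<^bsub>dual A S\<^esub> q y) u)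
      = (\<lambda>y\<in>carrier C. p y u) \<oplus>\<^bsub>star A C\<^esub> (\<lambda>y\<in>carrier C. q y u)"
      using u by (auto simp: dual_simps star_simps intro!: restrict_ext)
    show "gcan (p c \<oplus>\<^bsub>dual A S\<^esub> q c) u = coring_act C c (\<lambda>y\<in>carrier C. (p y \<oplus>\<^bsub>dual A S\<^esub> q y) u)"
      unfolding eq using add c u Q_star[OF p u] Q_star[OF q u] QD(3)[OF p c] QD(3)[OF q c]
      by (simp add: Q_gcan[OF p c u] Q_gcan[OF q c u])
  qed (simp_all add: QD[OF p] QD[OF q] D.a_ac smult)
qed

lemma Q_ract: "ract (Q_A_B A C S \<rho>) = (\<lambda>q b. \<lambda>c\<in>carrier C. q c \<triangleleft>\<^bsub>dual A S\<^esub> b)"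
  by (simp add: Q_A_B_simps dual_simps)

lemma Q_ract_closed:
  assumes q: "q \<in> carrier (Q_A_B A C S \<rho>)" and b: "b \<in> carrier B"
  shows "q \<triangleleft>\<^bsub>Q_A_B A C S \<rho>\<^esub> b \<in> carrier (Q_A_B A C S \<rho>)"
  unfolding Q_ract
proof (rule QI)
  fix c u assume c: "c \<in> carrier C" and u: "u \<in> carrier S"
  have bu: "b \<odot>\<^bsub>S\<^esub> u \<in> carrier S" using b u by (simp add: S_simps)
  have "gcan (q c \<triangleleft>\<^bsub>dual A S\<^esub> b) u = gcan (\<lambda>x. q c (b \<odot>\<^bsub>S\<^esub> x)) u"
    by (rule gcan_cong[OF S_functional_dual[OF dual_ract_closed[OF b QD(3)[OF q c]]] _ u])
      (simp add: dual_simps)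
  also have "\<dots> = coring_act C c (\<lambda>y\<in>carrier C. q y (b \<odot>\<^bsub>S\<^esub> u))"
    unfolding gcan_lact[OF QD(4)[OF q c] b u, symmetric] by (rule Q_gcan[OF q c bu])
  also have "(\<lambda>y\<in>carrier C. q y (b \<odot>\<^bsub>S\<^esub> u)) = (\<lambda>y\<in>carrier C. (q y \<triangleleft>\<^bsub>dual A S\<^esub> b) u)"
    using u by (simp add: dual_simps)
  finally show "gcan (q c \<triangleleft>\<^bsub>dual A S\<^esub> b) u = coring_act C c (\<lambda>y\<in>carrier C. (q y \<triangleleft>\<^bsub>dual A S\<^esub> b) u)" .
next
  fix c a assume ca: "c \<in> carrier C" "a \<in> carrier A"
  show "q (a \<odot>\<^bsub>C\<^esub> c) \<triangleleft>\<^bsub>dual A S\<^esub> b = a \<odot>\<^bsub>dual A S\<^esub> (q c \<triangleleft>\<^bsub>dual A S\<^esub> b)"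
    using ca b by (auto simp: QD(7)[OF q] dual_simps S_simps intro!: restrict_ext)
qed (simp_all add: QD[OF q] b dual_ract_closed additive_map_add[OF dual_ract_additive])

lemma Q_right_module: "right_module B (Q_A_B A C S \<rho>)"
proof -
  interpret Q: abelian_group "Q_A_B A C S \<rho>" by (rule abelian_group_Q)
  interpret D: right_module B "dual A S" by (rule dual_right_module)
  show ?thesis
  proof unfold_locales
    fix q assume q: "q \<in> carrier (Q_A_B A C S \<rho>)"
    show "q \<triangleleft>\<^bsub>Q_A_B A C S \<rho>\<^esub> \<one>\<^bsub>B\<^esub> = q"
      unfolding Q_ract
      by (rule extensionalityI[where A = "carrier C"]) (auto simp: QD[OF q] D.ract_one)
  qed (auto simp: Q_ract_closed, auto simp: Q_ract Q_A_B_simps(2) QD D.ract_add D.ract_distrib D.ract_assoc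
      intro!: restrict_ext)
qed

end

end

section \<open>Transport of structure into a universe\<close>

text \<open>The copy of a right module on the image of an injection; the left action is dropped.\<close>

definition transport :: "('m \<Rightarrow> 'u) \<Rightarrow> ('l, 'r, 'm, 'z) bimod_scheme \<Rightarrow> (unit, 'r, 'u) bimod" where
  "transport i M = (let j = inv_into (carrier M) i in with_actions
     (additive_group (i ` carrier M) (i \<zero>\<^bsub>M\<^esub>) (\<lambda>x y. i (j x \<oplus>\<^bsub>M\<^esub> j y)))
     undefined (\<lambda>x r. i (j x \<triangleleft>\<^bsub>M\<^esub> r)))"

lemma right_module_transport:
  assumes M: "right_module R M" and i: "inj_on i (carrier M)"
  shows "right_module R (transport i M)"
    and "right_linear R M (transport i M) i"
    and "right_linear R (transport i M) M (inv_into (carrier M) i)"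
    and "carrier (transport i M) = i ` carrier M"
proof -
  interpret M: right_module R M by fact
  have s: "carrier (transport i M) = i ` carrier M" "\<zero>\<^bsub>transport i M\<^esub> = i \<zero>\<^bsub>M\<^esub>"
    "x \<in> carrier M \<Longrightarrow> y \<in> carrier M \<Longrightarrow> i x \<oplus>\<^bsub>transport i M\<^esub> i y = i (x \<oplus>\<^bsub>M\<^esub> y)"
    "x \<in> carrier M \<Longrightarrow> i x \<triangleleft>\<^bsub>transport i M\<^esub> r = i (x \<triangleleft>\<^bsub>M\<^esub> r)" for x y r
    by (simp_all add: transport_def Let_def inv_into_f_f[OF i])
  show "carrier (transport i M) = i ` carrier M" by (rule s)
  have ag: "abelian_group (transport i M)"
  proof (rule abelian_groupI)
    fix z assume "z \<in> carrier (transport i M)"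
    then obtain x where "z = i x" "x \<in> carrier M" by (auto simp: s)
    then show "\<exists>y\<in>carrier (transport i M). y \<oplus>\<^bsub>transport i M\<^esub> z = \<zero>\<^bsub>transport i M\<^esub>"
      by (intro bexI[where x = "i (\<ominus>\<^bsub>M\<^esub> x)"]) (auto simp: s M.l_neg)
  qed (auto simp: s M.a_ac)
  interpret T: abelian_group "transport i M" by (rule ag)
  show "right_module R (transport i M)"
    by unfold_locales (auto simp: s M.ract_closed M.ract_add M.ract_distrib M.ract_assoc M.ract_one)
  show "right_linear R M (transport i M) i"
    by (auto simp: right_linear_def s intro!: additive_mapI)
  show "right_linear R (transport i M) M (inv_into (carrier M) i)"
    by (auto simp: right_linear_def s inv_into_f_f[OF i] M.ract_closed intro!: additive_mapI)
qed

lemma (in tensor_pair) tensor_map_right_linear: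
  assumes "tensor_pair R M' N" "right_linear R M M' f"
  shows "additive_map (tensor R M N) (tensor R M' N) (tensor_map R M' N f id)"
    and "x \<in> carrier M \<Longrightarrow> y \<in> carrier N \<Longrightarrow> tensor_map R M' N f id (pure R M N x y) = pure R M' N (f x) y"
proof -
  interpret T: tensor_pair R M' N by fact
  have b: "balanced R M N (tensor R M' N) (\<lambda>x y. pure R M' N (f x) (id y))"
    by (rule balanced_pure_map[OF assms(1) right_linearD(1)[OF assms(2)]])
      (auto intro: additive_mapI simp: right_linearD(2)[OF assms(2)])
  show "additive_map (tensor R M N) (tensor R M' N) (tensor_map R M' N f id)"
    unfolding tensor_map_def by (rule tlift_additive[OF T.abelian_group_tensor b])
  show "x \<in> carrier M \<Longrightarrow> y \<in> carrier N \<Longrightarrow> tensor_map R M' N f id (pure R M N x y) = pure R M' N (f x) y"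
    unfolding tensor_map_def using tlift_pure[OF T.abelian_group_tensor b] by simp
qed

text \<open>Flatness tested in a universe applies to all modules that embed into the universe.\<close>

lemma flat_inj_tensor_map:
  fixes i :: "'m \<Rightarrow> 'u" and i' :: "'n \<Rightarrow> 'u" and U :: "'u itself"
    and M :: "('l, 'r, 'm, 'y) bimod_scheme" and M' :: "('k, 'r, 'n, 'x) bimod_scheme"
  assumes flat: "flat U R N" and M: "right_module R M" and M': "right_module R M'"
    and N: "abelian_group N" "\<And>r y. r \<in> carrier R \<Longrightarrow> y \<in> carrier N \<Longrightarrow> r \<odot>\<^bsub>N\<^esub> y \<in> carrier N"
    and i: "inj_on i (carrier M)" and i': "inj_on i' (carrier M')"
    and J: "right_linear R M M' J" "inj_on J (carrier M)"
  shows "inj_on (tensor_map R M' N J id) (carrier (tensor R M N))"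
proof -
  have pair: "tensor_pair R P N" if "right_module R P" for P :: "('q, 'r, 'p, 't) bimod_scheme"
  proof -
    interpret P: right_module R P by fact
    interpret N: abelian_group N by fact
    show ?thesis by unfold_locales (simp_all add: N P.ract_closed)
  qed
  let ?T = "transport i M" and ?T' = "transport i' M'"
  note t = right_module_transport[OF M i] and t' = right_module_transport[OF M' i']
  interpret M: tensor_pair R M N by (rule pair[OF M])
  interpret M': tensor_pair R M' N by (rule pair[OF M'])
  interpret T: tensor_pair R ?T N by (rule pair[OF t(1)])
  interpret T': tensor_pair R ?T' N by (rule pair[OF t'(1)])
  let ?j = "inv_into (carrier M) i"
  define f where "f = (\<lambda>z\<in>carrier ?T. i' (J (?j z)))"
  have j: "?j z \<in> carrier M" "i (?j z) = z" if "z \<in> carrier ?T" for z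
    using that t(4) by (auto simp: inv_into_f_f[OF i])
  have Jc: "J x \<in> carrier M'" if "x \<in> carrier M" for x
    by (rule additive_map_closed[OF right_linearD(1)[OF J(1)] that])
  have "right_linear R ?T ?T' f"
    unfolding right_linear_def
  proof (intro conjI ballI)
    show "additive_map ?T ?T' f"
      by (rule additive_mapI)
        (auto simp: f_def j Jc t'(4) T.M.a_closed additive_map_add[OF right_linearD(1)[OF t(3)]]
          additive_map_add[OF right_linearD(1)[OF J(1)]] additive_map_add[OF right_linearD(1)[OF t'(2)]])
    fix x r assume "x \<in> carrier ?T" "r \<in> carrier R"
    then show "f (x \<triangleleft>\<^bsub>?T\<^esub> r) = f x \<triangleleft>\<^bsub>?T'\<^esub> r"
      by (simp add: f_def j Jc T.racl right_linearD(2)[OF t(3)] right_linearD(2)[OF J(1)]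
          right_linearD(2)[OF t'(2)])
  qed
  then have fh: "f \<in> right_hom R ?T ?T'" and fl: "right_linear R ?T ?T' f"
    by (auto simp: right_hom_def f_def)
  have "inj_on f (carrier ?T)"
  proof (rule inj_onI)
    fix x y assume xy: "x \<in> carrier ?T" "y \<in> carrier ?T" "f x = f y"
    then have "J (?j x) = J (?j y)" using inj_onD[OF i'] j Jc by (simp add: f_def)
    then have "?j x = ?j y" using inj_onD[OF J(2)] j xy by simp
    then show "x = y" using j(2) xy by metis
  qed
  then have inj: "inj_on (tensor_map R ?T' N f id) (carrier (tensor R ?T N))"
    using flat t(1) t'(1) fh unfolding flat_def by blast
  note ti = M.tensor_map_right_linear[OF T.tensor_pair_axioms t(2)]
  note tj = T.tensor_map_right_linear[OF M.tensor_pair_axioms t(3)]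
  note ti' = M'.tensor_map_right_linear[OF T'.tensor_pair_axioms t'(2)]
  note tf = T.tensor_map_right_linear[OF T'.tensor_pair_axioms fl]
  note tJ = M.tensor_map_right_linear[OF M'.tensor_pair_axioms J(1)]
  have ic: "i x \<in> carrier ?T" if "x \<in> carrier M" for x using that t(4) by simp
  have fi: "f (i x) = i' (J x)" if "x \<in> carrier M" for x
    using ic that by (simp add: f_def inv_into_f_f[OF i])
  have ji: "tensor_map R M N ?j id (tensor_map R ?T N i id X) = X" if X: "X \<in> carrier (tensor R M N)" for X
    by (rule M.additive_map_eq_on_pure[OF M.abelian_group_tensor additive_map_comp[OF ti(1) tj(1)] _ _ X])
      (simp_all add: ti tj ic inv_into_f_f[OF i] additive_mapI)
  have sq: "tensor_map R ?T' N f id (tensor_map R ?T N i id X)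
      = tensor_map R ?T' N i' id (tensor_map R M' N J id X)" if X: "X \<in> carrier (tensor R M N)" for X
    by (rule M.additive_map_eq_on_pure[OF T'.abelian_group_tensor additive_map_comp[OF ti(1) tf(1)]
          additive_map_comp[OF tJ(1) ti'(1)] _ X])
      (simp_all add: ti ti' tf tJ ic Jc fi)
  show ?thesis
  proof (rule inj_onI)
    fix X Y assume XY: "X \<in> carrier (tensor R M N)" "Y \<in> carrier (tensor R M N)"
      "tensor_map R M' N J id X = tensor_map R M' N J id Y"
    then have "tensor_map R ?T N i id X = tensor_map R ?T N i id Y"
      using inj_onD[OF inj] sq additive_map_closed[OF ti(1)] by metis
    then show "X = Y" using ji XY by metis
  qed
qed


section \<open>Dual bases from projectivity in a universe\<close>

text \<open>A function is determined by its graph, and \<open>\<kappa> \<cdot> \<kappa> = \<kappa>\<close> turns graphs into subsets of \<open>\<kappa>\<close>.\<close>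

lemma ex_inj_pair:
  assumes "infinite (UNIV :: 'k set)"
  shows "\<exists>p :: 'k \<times> 'k \<Rightarrow> 'k. inj p"
proof -
  have "|(UNIV :: 'k set) \<times> (UNIV :: 'k set)| =o |UNIV :: 'k set|"
    by (rule card_of_Times_same_infinite[OF assms])
  then have "|(UNIV :: 'k set) \<times> (UNIV :: 'k set)| \<le>o |UNIV :: 'k set|"
    by (rule ordIso_imp_ordLeq)
  then show ?thesis by (auto simp: card_of_ordLeq[symmetric])
qed

lemma ex_inj_fun:
  fixes i :: "'x \<Rightarrow> 'k" and j :: "'y \<Rightarrow> 'k"
  assumes "infinite (UNIV :: 'k set)" and i: "inj i" and j: "inj j"
  shows "\<exists>G :: ('x \<Rightarrow> 'y) \<Rightarrow> 'k set. inj G"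
proof -
  obtain p :: "'k \<times> 'k \<Rightarrow> 'k" where p: "inj p" using ex_inj_pair[OF assms(1)] by blast
  have "inj (\<lambda>h :: 'x \<Rightarrow> 'y. range (\<lambda>x. p (i x, j (h x))))"
  proof (rule injI)
    fix h h' :: "'x \<Rightarrow> 'y" assume eq: "range (\<lambda>x. p (i x, j (h x))) = range (\<lambda>x. p (i x, j (h' x)))"
    show "h = h'"
    proof
      fix x
      have "p (i x, j (h x)) \<in> range (\<lambda>x. p (i x, j (h' x)))" using eq by auto
      then obtain y where "p (i x, j (h x)) = p (i y, j (h' y))" by auto
      then show "h x = h' x" using p i j by (auto simp: inj_eq)
    qed
  qed
  then show ?thesis by blast
qed

context bicomodule_setting
begin

text \<open>The dual basis comes from splitting the map from a free module of finite rank onto \<open>\<Sigma>\<close>; \<open>iF\<close> and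
  \<open>iS\<close> place the free module and \<open>\<Sigma>\<close> in the universe.\<close>

lemma ex_dual_basis:
  fixes iF :: "('s \<Rightarrow> 'a) \<Rightarrow> 'u" and iS :: "'s \<Rightarrow> 'u"
  assumes iF: "inj iF" and iS: "inj iS"
  shows "\<exists>es. dual_basis A S es"
proof -
  from com.fgp have fg: "finitely_generated A S"
    and proj: "projective_in (right_module A :: (unit, 'a, 'u) bimod \<Rightarrow> bool) carrier (right_hom A)
       (carrier S) (right_hom A S)"
    by (auto simp: fg_projective_def)
  from fg obtain X where X: "finite X" "X \<subseteq> carrier S"
    and gen: "\<And>N. right_submodule A S N \<Longrightarrow> X \<subseteq> N \<Longrightarrow> N = carrier S"
    by (auto simp: finitely_generated_def)

  \<comment> \<open>The free module on the generators, as functions on \<open>X\<close>, maps onto \<open>\<Sigma>\<close>.\<close>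
  define F :: "(unit, 'a, 's \<Rightarrow> 'a) bimod" where "F = with_actions
     (additive_group (X \<rightarrow>\<^sub>E carrier A) (\<lambda>x\<in>X. \<zero>\<^bsub>A\<^esub>) (\<lambda>f g. \<lambda>x\<in>X. f x \<oplus>\<^bsub>A\<^esub> g x))
     undefined (\<lambda>h a. \<lambda>x\<in>X. h x \<otimes>\<^bsub>A\<^esub> a)"
  have F: "carrier F = X \<rightarrow>\<^sub>E carrier A" "\<zero>\<^bsub>F\<^esub> = (\<lambda>x\<in>X. \<zero>\<^bsub>A\<^esub>)"
    "add F = (\<lambda>f g. \<lambda>x\<in>X. f x \<oplus>\<^bsub>A\<^esub> g x)" "ract F = (\<lambda>h a. \<lambda>x\<in>X. h x \<otimes>\<^bsub>A\<^esub> a)"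
    by (simp_all add: F_def)
  have hA: "h x \<in> carrier A" if "h \<in> carrier F" "x \<in> X" for h x
    using that by (auto simp: F)
  have "abelian_group F"
    by (rule abelian_group_pointwise[where G = A and X = X]) (auto simp: F A.abelian_group_axioms)
  then interpret F: abelian_group F .
  have Fm: "right_module A F"
  proof unfold_locales
    fix h assume h: "h \<in> carrier F"
    show "h \<triangleleft>\<^bsub>F\<^esub> \<one>\<^bsub>A\<^esub> = h"
    proof (rule extensionalityI[where A = X])
      show "h \<in> extensional X" using h by (simp add: F PiE_iff)
      show "(h \<triangleleft>\<^bsub>F\<^esub> \<one>\<^bsub>A\<^esub>) x = h x" if "x \<in> X" for x
        using hA[OF h that] that by (simp add: F)
    qed (simp add: F)
  next
    fix h a b assume h: "h \<in> carrier F" and ab: "a \<in> carrier A" "b \<in> carrier A"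
    show "h \<triangleleft>\<^bsub>F\<^esub> a \<in> carrier F" using hA[OF h] ab by (auto simp: F)
    show "h \<triangleleft>\<^bsub>F\<^esub> (a \<oplus>\<^bsub>A\<^esub> b) = h \<triangleleft>\<^bsub>F\<^esub> a \<oplus>\<^bsub>F\<^esub> h \<triangleleft>\<^bsub>F\<^esub> b"
      using hA[OF h] ab by (simp add: F A.r_distr cong: restrict_cong)
    show "h \<triangleleft>\<^bsub>F\<^esub> (a \<otimes>\<^bsub>A\<^esub> b) = (h \<triangleleft>\<^bsub>F\<^esub> a) \<triangleleft>\<^bsub>F\<^esub> b"
      using hA[OF h] ab by (simp add: F A.m_assoc cong: restrict_cong)
    fix h' assume h': "h' \<in> carrier F"
    show "(h \<oplus>\<^bsub>F\<^esub> h') \<triangleleft>\<^bsub>F\<^esub> a = h \<triangleleft>\<^bsub>F\<^esub> a \<oplus>\<^bsub>F\<^esub> h' \<triangleleft>\<^bsub>F\<^esub> a"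
      using hA[OF h] hA[OF h'] ab by (simp add: F A.l_distr cong: restrict_cong)
  qed
  define p where "p h = (\<Oplus>\<^bsub>S\<^esub>x\<in>X. x \<triangleleft>\<^bsub>S\<^esub> h x)" for h
  have t: "(\<lambda>x. x \<triangleleft>\<^bsub>S\<^esub> h x) \<in> X \<rightarrow> carrier S" if "h \<in> carrier F" for h
    using that hA X(2) by (auto simp: S_simps)
  have p_add: "additive_map F S p"
  proof (rule additive_mapI)
    fix h h' assume h: "h \<in> carrier F" "h' \<in> carrier F"
    show "p (h \<oplus>\<^bsub>F\<^esub> h') = p h \<oplus>\<^bsub>S\<^esub> p h'"
      unfolding p_def S.finsum_addf[OF t[OF h(1)] t[OF h(2)], symmetric]
      using h X(2) hA by (intro S.finsum_cong') (auto simp: F S_simps subset_iff)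
  qed (auto simp: p_def intro!: S.finsum_closed t)
  note p_closed = additive_map_closed[OF p_add]
  have p_ract: "p (h \<triangleleft>\<^bsub>F\<^esub> a) = p h \<triangleleft>\<^bsub>S\<^esub> a" if h: "h \<in> carrier F" and a: "a \<in> carrier A" for h a
  proof -
    have aa: "additive_map S S (\<lambda>x. x \<triangleleft>\<^bsub>S\<^esub> a)" using a by (auto intro: additive_mapI simp: S_simps)
    show ?thesis
      unfolding p_def additive_map_finsum[OF aa S.abelian_group_axioms S.abelian_group_axioms t[OF h]]
      using h a X(2) hA by (intro S.finsum_cong') (auto simp: F S_simps S_rassoc subset_iff)
  qed
  have p_lin: "right_linear A F S p" using p_add p_ract by (simp add: right_linear_def)
  have surj: "p ` carrier F = carrier S"
  proof (rule gen)
    have "subgroup (p ` carrier F) (add_monoid S)"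
    proof -
      interpret h: group_hom "add_monoid F" "add_monoid S" p
        by (rule additive_map_group_hom[OF p_add F.abelian_group_axioms S.abelian_group_axioms])
      show ?thesis using h.img_is_subgroup by simp
    qed
    moreover have "p h \<triangleleft>\<^bsub>S\<^esub> a \<in> p ` carrier F" if "h \<in> carrier F" "a \<in> carrier A" for h a
      unfolding p_ract[OF that, symmetric]
      using rng_right_module.ract_closed[OF right_module.axioms(2)[OF Fm] that] by (rule imageI)
    ultimately show "right_submodule A S (p ` carrier F)"
      by (auto simp: right_submodule_def)
    show "X \<subseteq> p ` carrier F"
    proof
      fix x assume x: "x \<in> X"
      define \<delta> where "\<delta> = (\<lambda>y\<in>X. if y = x then \<one>\<^bsub>A\<^esub> else \<zero>\<^bsub>A\<^esub>)"
      have \<delta>: "\<delta> \<in> carrier F" by (auto simp: \<delta>_def F)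
      have z: "y \<triangleleft>\<^bsub>S\<^esub> \<zero>\<^bsub>A\<^esub> = \<zero>\<^bsub>S\<^esub>" if "y \<in> carrier S" for y
        by (rule additive_map_zero[OF _ A.abelian_group_axioms S.abelian_group_axioms])
          (auto intro: additive_mapI simp: S_simps that)
      have "p \<delta> = (\<Oplus>\<^bsub>S\<^esub>y\<in>X. if x = y then y else \<zero>\<^bsub>S\<^esub>)"
        unfolding p_def \<delta>_def using X(2) com.right.ract_one
        by (intro S.finsum_cong') (auto simp: z subset_iff)
      also have "\<dots> = x"
        using S.finsum_singleton[OF x X(1), of "\<lambda>y. y"] X(2) by auto
      finally show "x \<in> p ` carrier F" using \<delta> by (metis imageI)
    qed
  qed

  \<comment> \<open>A splitting of \<open>p\<close>, found between copies of the two modules in the universe.\<close>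
  have Sm: "right_module A S" by (rule com.right.right_module_axioms)
  have iF': "inj_on iF (carrier F)" and iS': "inj_on iS (carrier S)"
    using iF iS by (auto intro: inj_on_subset)
  let ?F = "transport iF F" and ?S = "transport iS S"
  note tF = right_module_transport[OF Fm iF'] and tS = right_module_transport[OF Sm iS']
  interpret TF: right_module A ?F by (rule tF(1))
  let ?j = "inv_into (carrier F) iF"
  have j: "?j z \<in> carrier F" if "z \<in> carrier ?F" for z
    using additive_map_closed[OF right_linearD(1)[OF tF(3)]] that .
  define p' where "p' = (\<lambda>z\<in>carrier ?F. iS (p (?j z)))"
  have p'_lin: "p' \<in> right_hom A ?F ?S"
    unfolding right_hom_def right_linear_def
  proof (intro CollectI conjI ballI)
    show "additive_map ?F ?S p'"
      by (rule additive_mapI)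
        (auto simp: p'_def j p_closed tS(4) TF.a_closed additive_map_add[OF right_linearD(1)[OF tF(3)]]
          additive_map_add[OF p_add] additive_map_add[OF right_linearD(1)[OF tS(2)]])
    fix x r assume "x \<in> carrier ?F" "r \<in> carrier A"
    then show "p' (x \<triangleleft>\<^bsub>?F\<^esub> r) = p' x \<triangleleft>\<^bsub>?S\<^esub> r"
      by (simp add: p'_def j p_closed TF.ract_closed right_linearD(2)[OF tF(3)] p_ract
          right_linearD(2)[OF tS(2)])
  qed (simp add: p'_def)
  have p'_surj: "p' ` carrier ?F = carrier ?S"
    unfolding tS(4) surj[symmetric] tF(4) by (auto simp: p'_def tF(4) inv_into_f_f[OF iF'] image_image)
  define g where "g = (\<lambda>u\<in>carrier S. iS u)"
  have "g \<in> right_hom A S ?S"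
    using tS(2) by (auto simp: right_hom_def right_linear_def g_def S_simps additive_map_def hom_def)
  then have "\<exists>h \<in> right_hom A S ?F. compose (carrier S) p' h = g"
    by (rule proj[unfolded projective_in_def, rule_format, OF p'_lin]) (simp add: tF(1) tS(1) p'_surj)
  then obtain h where h: "h \<in> right_hom A S ?F" "compose (carrier S) p' h = g" by blast
  then have hl: "right_linear A S ?F h" by (simp add: right_hom_def)
  note hc = additive_map_closed[OF right_linearD(1)[OF hl]]
  define k where "k u = ?j (h u)" for u
  have kc: "k u \<in> carrier F" if "u \<in> carrier S" for u
    unfolding k_def by (rule j[OF hc[OF that]])
  have pk: "p (k u) = u" if u: "u \<in> carrier S" for u
  proof -
    have "iS (p (k u)) = iS u"
      using fun_cong[OF h(2), of u] u hc[OF u] by (simp add: compose_def p'_def g_def k_def)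
    then show ?thesis using injD[OF iS] by blast
  qed
  have k_lin: "k (u \<oplus>\<^bsub>S\<^esub> v) = k u \<oplus>\<^bsub>F\<^esub> k v" "k (u \<triangleleft>\<^bsub>S\<^esub> a) = k u \<triangleleft>\<^bsub>F\<^esub> a"
    if "u \<in> carrier S" "v \<in> carrier S" "a \<in> carrier A" for u v a
    using that hc unfolding k_def
    by (simp_all add: additive_map_add[OF right_linearD(1)[OF hl]] right_linearD(2)[OF hl]
        additive_map_add[OF right_linearD(1)[OF tF(3)]] right_linearD(2)[OF tF(3)])

  \<comment> \<open>The coordinates of the splitting are the dual functionals.\<close>
  define f where "f x = (\<lambda>u\<in>carrier S. k u x)" for x
  have f: "f x \<in> carrier (dual A S)" if x: "x \<in> X" for x
    unfolding f_def
  proof (rule S_functional_restrict, rule S_functionalI)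
    show "k u x \<in> carrier A" if "u \<in> carrier S" for u using hA kc that x by blast
    show "k (u \<oplus>\<^bsub>S\<^esub> v) x = k u x \<oplus>\<^bsub>A\<^esub> k v x" if "u \<in> carrier S" "v \<in> carrier S" for u v
      using k_lin(1)[OF that A.zero_closed] x by (simp add: F)
    show "k (u \<triangleleft>\<^bsub>S\<^esub> a) x = k u x \<otimes>\<^bsub>A\<^esub> a" if "u \<in> carrier S" "a \<in> carrier A" for u a
      using k_lin(2)[OF that(1) S.zero_closed that(2)] x by (simp add: F)
  qed
  obtain xs where xs: "set xs = X" "distinct xs" using finite_distinct_list[OF X(1)] by blast
  define es where "es = map (\<lambda>x. (x, f x)) xs"
  have es: "length es = length xs" "i < length xs \<Longrightarrow> es ! i = (xs ! i, f (xs ! i))" for i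
    by (simp_all add: es_def)
  have im: "(!) xs ` {..<length xs} = X"
    unfolding xs(1)[symmetric] by (auto simp: in_set_conv_nth)
  have inj: "inj_on ((!) xs) {..<length xs}"
    using xs(2) by (auto simp: inj_on_def nth_eq_iff_index_eq)
  have expand: "(\<Oplus>\<^bsub>S\<^esub>i\<in>{..<length es}. fst (es ! i) \<triangleleft>\<^bsub>S\<^esub> snd (es ! i) u) = u"
    if u: "u \<in> carrier S" for u
  proof -
    define \<phi> where "\<phi> x = x \<triangleleft>\<^bsub>S\<^esub> f x u" for x
    have \<phi>: "\<phi> \<in> X \<rightarrow> carrier S"
      using t[OF kc[OF u]] u by (auto simp: \<phi>_def f_def)
    have "(\<Oplus>\<^bsub>S\<^esub>i\<in>{..<length es}. fst (es ! i) \<triangleleft>\<^bsub>S\<^esub> snd (es ! i) u)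
        = (\<Oplus>\<^bsub>S\<^esub>i\<in>{..<length xs}. \<phi> (xs ! i))"
    proof (rule S.finsum_cong')
      show "(\<lambda>i. \<phi> (xs ! i)) \<in> {..<length xs} \<rightarrow> carrier S"
        using \<phi> xs(1) nth_mem[of _ xs] by auto
    qed (auto simp: es \<phi>_def)
    moreover have "\<dots> = (\<Oplus>\<^bsub>S\<^esub>x\<in>X. \<phi> x)"
      using S.finsum_reindex[OF _ inj, of \<phi>] \<phi> by (simp only: im)
    moreover have "\<dots> = u"
      using pk[OF u] u by (simp add: p_def \<phi>_def f_def)
    ultimately show ?thesis by simp
  qed
  have "set es \<subseteq> carrier S \<times> carrier (dual A S)"
    using xs X(2) f by (auto simp: es_def)
  then have "dual_basis A S es"
    unfolding dual_basis_def using expand by simp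
  then show ?thesis ..
qed

end


section \<open>From a Frobenius map to a bimodule map \<open>\<Sigma>\<^sup>* \<rightarrow> Q\<close>\<close>

context bicomodule_setting
begin

text \<open>Local projectivity makes the functionals separate the points of \<open>\<C>\<close>.\<close>

lemma locally_projective_separates:
  assumes lp: "locally_projective A C" and xy: "x \<in> carrier C" "y \<in> carrier C"
    and eq: "\<And>f. f \<in> carrier (star A C) \<Longrightarrow> f x = f y"
  shows "x = y"
proof -
  have D: "finite {x, y} \<and> {x, y} \<subseteq> carrier C" using xy by simp
  obtain n :: nat and f e where fe: "\<forall>i<n. f i \<in> carrier (star A C) \<and> e i \<in> carrier C"
    and d: "\<forall>d\<in>{x, y}. d = (\<Oplus>\<^bsub>C\<^esub>i\<in>{..<n}. f i d \<odot>\<^bsub>C\<^esub> e i)"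
    using lp[unfolded locally_projective_def, rule_format, OF D] by (elim exE conjE) (rule that)
  have sums: "(\<Oplus>\<^bsub>C\<^esub>i\<in>{..<n}. f i x \<odot>\<^bsub>C\<^esub> e i) = (\<Oplus>\<^bsub>C\<^esub>i\<in>{..<n}. f i y \<odot>\<^bsub>C\<^esub> e i)"
  proof (rule C.finsum_cong')
    show "(\<lambda>i. f i y \<odot>\<^bsub>C\<^esub> e i) \<in> {..<n} \<rightarrow> carrier C"
    proof
      fix i assume "i \<in> {..<n}"
      then have fi: "f i \<in> carrier (star A C)" and ei: "e i \<in> carrier C" using fe by simp_all
      show "f i y \<odot>\<^bsub>C\<^esub> e i \<in> carrier C"
        by (rule cor.left.lact_closed[OF C_functionalD(1)[OF C_functional_star[OF fi] xy(2)] ei])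
    qed
    show "f i x \<odot>\<^bsub>C\<^esub> e i = f i y \<odot>\<^bsub>C\<^esub> e i" if "i \<in> {..<n}" for i
      using eq[of "f i"] fe that by simp
  qed simp
  have x: "x = (\<Oplus>\<^bsub>C\<^esub>i\<in>{..<n}. f i x \<odot>\<^bsub>C\<^esub> e i)" 
    and y: "y = (\<Oplus>\<^bsub>C\<^esub>i\<in>{..<n}. f i y \<odot>\<^bsub>C\<^esub> e i)"
    by (rule bspec[OF d], simp)+
  show ?thesis by (rule trans[OF trans[OF x sums] y[symmetric]])
qed

text \<open>The action of \<open>A\<close> on \<open>\<C>\<close> from the right is the action of the functionals \<open>\<epsilon>(-) a\<close>.\<close>

lemma counit_ract: "c \<in> carrier C \<Longrightarrow> a \<in> carrier A \<Longrightarrow> counit C (c \<triangleleft>\<^bsub>C\<^esub> a) = counit C c \<otimes>\<^bsub>A\<^esub> a"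
  using cor.counit_map by (auto simp: bimodule_map_def right_linear_def)

lemma counit_times:
  assumes a: "a \<in> carrier A"
  shows "(\<lambda>c\<in>carrier C. counit C c \<otimes>\<^bsub>A\<^esub> a) \<in> carrier (star A C)"
  by (rule C_functional_restrict)
    (auto intro!: C_functionalI simp: C_functionalD[OF counit_functional] a A.l_distr A.m_assoc)

lemma coring_act_counit_times:
  assumes a: "a \<in> carrier A" and c: "c \<in> carrier C"
  shows "coring_act C c (\<lambda>c\<in>carrier C. counit C c \<otimes>\<^bsub>A\<^esub> a) = c \<triangleleft>\<^bsub>C\<^esub> a"
proof -
  note e = C_functionalD[OF counit_functional]
  note b = balanced_C_act[OF counit_functional]
  have "c \<triangleleft>\<^bsub>C\<^esub> a = tlift C (\<lambda>x y. x \<triangleleft>\<^bsub>C\<^esub> counit C y) (comult C c) \<triangleleft>\<^bsub>C\<^esub> a"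
    by (simp add: cor.counit_right[OF c])
  also have "\<dots> = tlift C (\<lambda>x y. (x \<triangleleft>\<^bsub>C\<^esub> counit C y) \<triangleleft>\<^bsub>C\<^esub> a) (comult C c)"
    by (rule CC.additive_map_tlift[OF C.abelian_group_axioms C.abelian_group_axioms b
          additive_ract_C[OF a] comult_closed[OF c]])
  also have "\<dots> = coring_act C c (\<lambda>c\<in>carrier C. counit C c \<otimes>\<^bsub>A\<^esub> a)"
    unfolding coring_act_def
    by (rule CC.tlift_cong[OF C.abelian_group_axioms balanced_comp[OF b additive_ract_C[OF a]]
          balanced_C_act[OF C_functional_star[OF counit_times[OF a]]]])
      (simp_all add: C_rassoc e a comult_closed c)
  finally show ?thesis ..
qed

lemma counit_coring_act:
  assumes f: "C_functional f" and c: "c \<in> carrier C"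
  shows "counit C (coring_act C c f) = f c"
proof -
  note e = C_functionalD[OF counit_functional]
  have fa: "additive_map C A f" "additive_map C A (counit C)"
    using f counit_functional by (simp_all add: left_linear_def additive_regular)
  have b: "balanced A C C C (\<lambda>x y. counit C x \<odot>\<^bsub>C\<^esub> y)"
    by (rule balancedI) (simp_all add: C_simps e C_lassoc counit_ract)
  have 1: "counit C (coring_act C c f) = tlift A (\<lambda>x y. counit C (x \<triangleleft>\<^bsub>C\<^esub> f y)) (comult C c)"
    unfolding coring_act_def
    by (rule CC.additive_map_tlift[OF C.abelian_group_axioms A.abelian_group_axioms
          balanced_C_act[OF f] fa(2) comult_closed[OF c]])
  have 2: "f (tlift C (\<lambda>x y. counit C x \<odot>\<^bsub>C\<^esub> y) (comult C c))
      = tlift A (\<lambda>x y. f (counit C x \<odot>\<^bsub>C\<^esub> y)) (comult C c)"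
    by (rule CC.additive_map_tlift[OF C.abelian_group_axioms A.abelian_group_axioms
          b fa(1) comult_closed[OF c]])
  have "counit C (coring_act C c f) = f (tlift C (\<lambda>x y. counit C x \<odot>\<^bsub>C\<^esub> y) (comult C c))"
    unfolding 1 2
    by (rule CC.tlift_cong[OF A.abelian_group_axioms balanced_comp[OF balanced_C_act[OF f] fa(2)]
          balanced_comp[OF b fa(1)]])
      (simp_all add: comult_closed c counit_ract C_functionalD[OF f] e)
  then show ?thesis by (simp add: cor.counit_left[OF c])
qed

lemma bimodule_mono_starD:
  assumes "bimodule_mono A (star A C) (coring_A_star C) (star_A_star A C) j"
  shows "additive_map C (star A C) j" "inj_on j (carrier C)"
    "a \<in> carrier A \<Longrightarrow> c \<in> carrier C \<Longrightarrow> j (a \<odot>\<^bsub>C\<^esub> c) = a \<odot>\<^bsub>star A C\<^esub> j c"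
    "f \<in> carrier (star A C) \<Longrightarrow> c \<in> carrier C \<Longrightarrow> j (coring_act C c f) = j c \<otimes>\<^bsub>star A C\<^esub> f"
  using assms unfolding bimodule_mono_def bimodule_map_def left_linear_def right_linear_def
  by (simp_all add: coring_A_star_def star_A_star_def additive_map_def hom_def)

text \<open>The map is \<open>J(\<phi>)(c)(u) = j(\<phi>(u\<^sub>[\<^sub>0\<^sub>]) u\<^sub>[\<^sub>1\<^sub>])(c)\<close>.\<close>

theorem coFrobenius_imp_mono:
  assumes ex: "\<exists>es. dual_basis A S es" and cf: "right_coFrobenius A C"
  shows "\<exists>J. bimodule_mono A B (dual A S) (Q_A_B A C S \<rho>) J"
proof -
  from cf have lp: "locally_projective A C" by (simp add: right_coFrobenius_def)
  from cf obtain j where j: "bimodule_mono A (star A C) (coring_A_star C) (star_A_star A C) j"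
    by (auto simp: right_coFrobenius_def)
  note jD = bimodule_mono_starD[OF j]
  have jc: "j c \<in> carrier (star A C)" if "c \<in> carrier C" for c
    by (rule additive_map_closed[OF jD(1) that])
  have jf: "C_functional (j c)" if "c \<in> carrier C" for c
    using jc[OF that] by (simp add: star_iff)
  have j_add: "j (c \<oplus>\<^bsub>C\<^esub> d) x = j c x \<oplus>\<^bsub>A\<^esub> j d x"
    if "c \<in> carrier C" "d \<in> carrier C" "x \<in> carrier C" for c d x
    using that by (simp add: additive_map_add[OF jD(1)] star_simps)
  have j_ract: "j (c \<triangleleft>\<^bsub>C\<^esub> a) x = j c x \<otimes>\<^bsub>A\<^esub> a"
    if "c \<in> carrier C" "a \<in> carrier A" "x \<in> carrier C" for c a x
  proof -
    let ?i = "\<lambda>c\<in>carrier C. counit C c \<otimes>\<^bsub>A\<^esub> a"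
    have "j (c \<triangleleft>\<^bsub>C\<^esub> a) = j c \<otimes>\<^bsub>star A C\<^esub> ?i"
      using jD(4)[OF counit_times[OF that(2)] that(1)]
      by (simp only: coring_act_counit_times[OF that(2,1)])
    then have "j (c \<triangleleft>\<^bsub>C\<^esub> a) x = ?i (coring_act C x (j c))"
      using that(3) by (simp only: star_simps restrict_apply') 
    then show ?thesis
      by (simp only: restrict_apply'[OF coring_act_closed[OF jf[OF that(1)] that(3)]]
          counit_coring_act[OF jf[OF that(1)] that(3)])
  qed
  define J where "J \<phi> = (\<lambda>c\<in>carrier C. \<lambda>u\<in>carrier S. j (gcan \<phi> u) c)" for \<phi>
  have JQ: "J \<phi> \<in> carrier (Q_A_B A C S \<rho>)" if \<phi>: "\<phi> \<in> carrier (dual A S)" for \<phi>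
    unfolding J_def
  proof (rule QI[OF ex])
    note \<phi>f = S_functional_dual[OF \<phi>]
    note g = gcan_closed[OF \<phi>f]
    have qf: "S_functional (\<lambda>u. j (gcan \<phi> u) c)" if c: "c \<in> carrier C" for c
      by (rule S_functionalI)
        (simp_all add: g c C_functionalD[OF jf] additive_map_add[OF gcan_additive[OF \<phi>f]] j_add
          gcan_ract[OF \<phi>f] j_ract)
    fix c assume c: "c \<in> carrier C"
    show q: "(\<lambda>u\<in>carrier S. j (gcan \<phi> u) c) \<in> carrier (dual A S)"
      by (rule S_functional_restrict[OF qf[OF c]])
    show "(\<lambda>u\<in>carrier S. j (gcan \<phi> u) (c \<oplus>\<^bsub>C\<^esub> d))
        = (\<lambda>u\<in>carrier S. j (gcan \<phi> u) c) \<oplus>\<^bsub>dual A S\<^esub> (\<lambda>u\<in>carrier S. j (gcan \<phi> u) d)"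
      if "d \<in> carrier C" for d
      using that c by (auto simp: dual_simps C_functionalD[OF jf] g intro!: restrict_ext)
    show "(\<lambda>u\<in>carrier S. j (gcan \<phi> u) (a \<odot>\<^bsub>C\<^esub> c))
        = a \<odot>\<^bsub>dual A S\<^esub> (\<lambda>u\<in>carrier S. j (gcan \<phi> u) c)" if "a \<in> carrier A" for a
      using that c by (auto simp: dual_simps C_functionalD[OF jf] g intro!: restrict_ext)
    fix u assume u: "u \<in> carrier S"
    have eq: "(\<lambda>y\<in>carrier C. (\<lambda>u\<in>carrier S. j (gcan \<phi> u) y) u) = j (gcan \<phi> u)"
      using jc[OF g[OF u]] u
      by (intro extensionalityI[where A = "carrier C"]) (auto simp: star_iff)
    note qd = S_functional_dual[OF q]
    \<comment> \<open>Colinearity, tested against the elements of \<open>\<^sup>*\<C>\<close>.\<close>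
    show "gcan (\<lambda>u\<in>carrier S. j (gcan \<phi> u) c) u
        = coring_act C c (\<lambda>y\<in>carrier C. (\<lambda>u\<in>carrier S. j (gcan \<phi> u) y) u)"
      unfolding eq
    proof (rule locally_projective_separates[OF lp gcan_closed[OF qd u] coring_act_closed[OF jf[OF g[OF u]] c]])
      fix f assume f: "f \<in> carrier (star A C)"
      note ff = C_functional_star[OF f]
      have "f (gcan (\<lambda>u\<in>carrier S. j (gcan \<phi> u) c) u) = j (gcan \<phi> (S_act u f)) c"
        using functional_S_act[OF qd ff u] S_act_closed[OF ff u] by simp
      also have "\<dots> = f (coring_act C c (j (gcan \<phi> u)))"
        unfolding gcan_S_act[OF \<phi>f ff u] jD(4)[OF f g[OF u]] by (simp add: star_simps c)
      finally show "f (gcan (\<lambda>u\<in>carrier S. j (gcan \<phi> u) c) u) = f (coring_act C c (j (gcan \<phi> u)))" .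
    qed
  qed
  have "additive_map (dual A S) (Q_A_B A C S \<rho>) J"
  proof (rule additive_mapI[OF JQ])
    fix \<phi> \<psi> assume *: "\<phi> \<in> carrier (dual A S)" "\<psi> \<in> carrier (dual A S)"
    note g = gcan_closed[OF S_functional_dual[OF *(1)]] gcan_closed[OF S_functional_dual[OF *(2)]]
    show "J (\<phi> \<oplus>\<^bsub>dual A S\<^esub> \<psi>) = J \<phi> \<oplus>\<^bsub>Q_A_B A C S \<rho>\<^esub> J \<psi>"
      unfolding J_def
      by (simp add: additive_map_add[OF gcan_additive_left *] j_add g cong: restrict_cong)
        (simp add: Q_A_B_simps dual_simps cong: restrict_cong)
  qed
  moreover have "J (a \<odot>\<^bsub>dual A S\<^esub> \<phi>) = a \<odot>\<^bsub>Q_A_B A C S \<rho>\<^esub> J \<phi>"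
    if a: "a \<in> carrier A" and \<phi>: "\<phi> \<in> carrier (dual A S)" for a \<phi>
  proof -
    note \<phi>f = S_functional_dual[OF \<phi>]
    have "gcan (a \<odot>\<^bsub>dual A S\<^esub> \<phi>) u = a \<odot>\<^bsub>C\<^esub> gcan \<phi> u" if "u \<in> carrier S" for u
      unfolding gcan_lact_left[OF \<phi>f a that, symmetric]
      by (rule gcan_cong[OF S_functional_dual[OF dual_lact_closed[OF a \<phi>]] _ that])
        (simp add: dual_simps)
    then show ?thesis
      unfolding J_def using a
      by (auto simp: Q_A_B_simps jD(3) star_simps gcan_closed[OF \<phi>f] C_simps intro!: restrict_ext)
  qed
  moreover have "J (\<phi> \<triangleleft>\<^bsub>dual A S\<^esub> b) = J \<phi> \<triangleleft>\<^bsub>Q_A_B A C S \<rho>\<^esub> b"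
    if b: "b \<in> carrier B" and \<phi>: "\<phi> \<in> carrier (dual A S)" for b \<phi>
  proof -
    note \<phi>f = S_functional_dual[OF \<phi>]
    have "gcan (\<phi> \<triangleleft>\<^bsub>dual A S\<^esub> b) u = gcan \<phi> (b \<odot>\<^bsub>S\<^esub> u)" if "u \<in> carrier S" for u
      unfolding gcan_lact[OF \<phi>f b that]
      by (rule gcan_cong[OF S_functional_dual[OF dual_ract_closed[OF b \<phi>]] _ that])
        (simp add: dual_simps)
    then show ?thesis
      unfolding J_def using b by (auto simp: Q_A_B_simps S_simps intro!: restrict_ext)
  qed
  moreover have "inj_on J (carrier (dual A S))"
  proof (rule inj_onI)
    fix \<phi> \<psi> assume *: "\<phi> \<in> carrier (dual A S)" "\<psi> \<in> carrier (dual A S)" "J \<phi> = J \<psi>"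
    note f = S_functional_dual[OF *(1)] S_functional_dual[OF *(2)]
    show "\<phi> = \<psi>"
    proof (rule extensionalityI[where A = "carrier S"])
      fix u assume u: "u \<in> carrier S"
      note g = gcan_closed[OF f(1) u] gcan_closed[OF f(2) u]
      have "j (gcan \<phi> u) = j (gcan \<psi> u)"
      proof (rule extensionalityI[where A = "carrier C"])
        show "j (gcan \<phi> u) c = j (gcan \<psi> u) c" if "c \<in> carrier C" for c
          using fun_cong[OF fun_cong[OF *(3), of c], of u] that u by (simp add: J_def)
      qed (use jc[OF g(1)] jc[OF g(2)] in \<open>auto simp: star_iff\<close>)
      then have "gcan \<phi> u = gcan \<psi> u" using inj_onD[OF jD(2)] g by blast
      then show "\<phi> u = \<psi> u" using gcan_counit[OF f(1) u] gcan_counit[OF f(2) u] by simp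
    qed (use *(1,2) in \<open>auto simp: dual_iff\<close>)
  qed
  ultimately have "bimodule_mono A B (dual A S) (Q_A_B A C S \<rho>) J"
    by (simp add: bimodule_mono_def bimodule_map_def left_linear_def right_linear_def)
  then show ?thesis by (rule exI[of _ J])
qed

section \<open>From a bimodule map \<open>\<Sigma>\<^sup>* \<rightarrow> Q\<close> to a Frobenius map\<close>

text \<open>If \<open>l : B \<rightarrow> T\<close> is onto, then \<open>Q \<otimes>\<^sub>B \<Sigma>\<close> and \<open>Q \<otimes>\<^sub>T \<Sigma>\<close> have the same defining relations.\<close>

lemma tensor_T_eq_tensor_B:
  assumes l: "l_map S ` carrier B = carrier (T_ring A C S \<rho>)"
  shows "carrier (tensor (T_ring A C S \<rho>) (Q_star_T A C S \<rho>) (S_T_star S \<rho>))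
    = carrier (tensor B (Q_A_B A C S \<rho>) S)"
proof -
  let ?T = "T_ring A C S \<rho>" and ?Q = "Q_star_T A C S \<rho>" and ?Q' = "Q_A_B A C S \<rho>"
    and ?S = "S_T_star S \<rho>"
  have s: "carrier ?Q = carrier ?Q'" "add ?Q = add ?Q'" "carrier ?S = carrier S" "add ?S = add S"
    by (simp_all add: Q_star_T_def Q_A_B_def S_T_star_def)
  have r: "q \<triangleleft>\<^bsub>?Q\<^esub> l_map S b = q \<triangleleft>\<^bsub>?Q'\<^esub> b" for q b
    by (auto simp: Q_star_T_def Q_A_B_simps compose_def l_map_def intro!: restrict_ext)
  have t: "l_map S b \<odot>\<^bsub>?S\<^esub> u = b \<odot>\<^bsub>S\<^esub> u" if "u \<in> carrier S" for b u
    using that by (simp add: S_T_star_def l_map_def)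
  have "{frag_of (x \<triangleleft>\<^bsub>?Q\<^esub> r, y) - frag_of (x, r \<odot>\<^bsub>?S\<^esub> y) | x r y.
        x \<in> carrier ?Q' \<and> r \<in> carrier ?T \<and> y \<in> carrier S}
    = {frag_of (x \<triangleleft>\<^bsub>?Q'\<^esub> r, y) - frag_of (x, r \<odot>\<^bsub>S\<^esub> y) | x r y.
        x \<in> carrier ?Q' \<and> r \<in> carrier B \<and> y \<in> carrier S}" (is "?L = ?R")
  proof (intro equalityI subsetI)
    fix w assume "w \<in> ?L"
    then obtain x b y where "w = frag_of (x \<triangleleft>\<^bsub>?Q\<^esub> l_map S b, y) - frag_of (x, l_map S b \<odot>\<^bsub>?S\<^esub> y)"
      "x \<in> carrier ?Q'" "b \<in> carrier B" "y \<in> carrier S"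
      unfolding l[symmetric] by blast
    then show "w \<in> ?R" unfolding r by (auto simp: t)
  next
    fix w assume "w \<in> ?R"
    then obtain x b y where w: "w = frag_of (x \<triangleleft>\<^bsub>?Q'\<^esub> b, y) - frag_of (x, b \<odot>\<^bsub>S\<^esub> y)"
      and *: "x \<in> carrier ?Q'" "b \<in> carrier B" "y \<in> carrier S" by blast
    have "w = frag_of (x \<triangleleft>\<^bsub>?Q\<^esub> l_map S b, y) - frag_of (x, l_map S b \<odot>\<^bsub>?S\<^esub> y)"
      unfolding w r t[OF *(3)] ..
    moreover have "l_map S b \<in> carrier ?T" using l *(2) by blast
    ultimately show "w \<in> ?L" using * by blast
  qed
  then have "tensor_relations ?T ?Q ?S = tensor_relations B ?Q' S"
    unfolding tensor_relations_def s by (rule arg_cong)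
  then show ?thesis by (simp add: carrier_tensor tensor_group_def tensor_null_def s)
qed

text \<open>Flatness of \<open>\<Sigma>\<close> over \<open>B\<close> enters only through injectivity of \<open>J \<otimes> \<Sigma>\<close>, and strictness of the
  restricted context only through injectivity of \<open>\<mu>\<close>.\<close>

theorem mono_imp_coFrobenius:
  assumes ex: "\<exists>es. dual_basis A S es" and lp: "locally_projective A C"
    and l: "l_map S ` carrier B = carrier (T_ring A C S \<rho>)" and can: "can_iso B A C S \<rho>"
    and mu: "inj_on (mu A C) (carrier (tensor (T_ring A C S \<rho>) (Q_star_T A C S \<rho>) (S_T_star S \<rho>)))"
    and J: "bimodule_mono A B (dual A S) (Q_A_B A C S \<rho>) J"
    and J\<Sigma>: "inj_on (tensor_map B (Q_A_B A C S \<rho>) S J id) (carrier (tensor B (dual A S) S))"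
  shows "right_coFrobenius A C"
proof -
  let ?Q = "Q_A_B A C S \<rho>" and ?DS = "tensor B (dual A S) S"
  interpret Q: abelian_group ?Q by (rule abelian_group_Q[OF ex])
  interpret QS: tensor_pair B ?Q S by unfold_locales (simp_all add: Q_ract_closed[OF ex] S_simps)
  interpret DSg: abelian_group ?DS by (rule DS.abelian_group_tensor)
  note aC = C.abelian_group_axioms
  from J have Jl: "right_linear B (dual A S) ?Q J" "left_linear A (dual A S) ?Q J"
    by (auto simp: bimodule_mono_def bimodule_map_def)
  have JQ: "J \<phi> \<in> carrier ?Q" if "\<phi> \<in> carrier (dual A S)" for \<phi>
    by (rule additive_map_closed[OF right_linearD(1)[OF Jl(1)] that])

  have b_mu: "balanced B ?Q S (star A C) (\<lambda>q u. \<lambda>c\<in>carrier C. q c u)"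
  proof (rule balancedI)
    fix q u assume q: "q \<in> carrier ?Q" and u: "u \<in> carrier S"
    show "(\<lambda>c\<in>carrier C. q c u) \<in> carrier (star A C)" by (rule Q_star[OF ex q u])
    show "(\<lambda>c\<in>carrier C. q c (u \<oplus>\<^bsub>S\<^esub> v))
        = (\<lambda>c\<in>carrier C. q c u) \<oplus>\<^bsub>star A C\<^esub> (\<lambda>c\<in>carrier C. q c v)" if "v \<in> carrier S" for v
      by (simp add: S_functionalD(2)[OF QD(4)[OF ex q] u that] star_simps cong: restrict_cong)
    show "(\<lambda>c\<in>carrier C. (q \<oplus>\<^bsub>?Q\<^esub> p) c u)
        = (\<lambda>c\<in>carrier C. q c u) \<oplus>\<^bsub>star A C\<^esub> (\<lambda>c\<in>carrier C. p c u)" if "p \<in> carrier ?Q" for p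
      using u by (simp add: Q_A_B_simps dual_simps star_simps cong: restrict_cong)
    show "(\<lambda>c\<in>carrier C. (q \<triangleleft>\<^bsub>?Q\<^esub> b) c u) = (\<lambda>c\<in>carrier C. q c (b \<odot>\<^bsub>S\<^esub> u))" for b
      using u by (simp add: Q_A_B_simps cong: restrict_cong)
  qed
  define k where "k X = mu A C (tensor_map B ?Q S J id X)" for X
  note tJ = DS.tensor_map_right_linear[OF QS.tensor_pair_axioms Jl(1)]
  have k_add: "additive_map ?DS (star A C) k"
    unfolding k_def mu_def
    by (rule additive_map_comp[OF tJ(1) QS.tlift_additive[OF abelian_group_star b_mu]])
  have k_pure: "k (pure B (dual A S) S \<phi> u) = (\<lambda>c\<in>carrier C. J \<phi> c u)"
    if "\<phi> \<in> carrier (dual A S)" "u \<in> carrier S" for \<phi> u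
    unfolding k_def mu_def using that
    by (simp add: tJ(2) QS.tlift_pure[OF abelian_group_star b_mu] JQ)
  have k_inj: "inj_on k (carrier ?DS)"
  proof (rule inj_onI)
    fix X Y assume XY: "X \<in> carrier ?DS" "Y \<in> carrier ?DS" "k X = k Y"
    have "tensor_map B ?Q S J id X = tensor_map B ?Q S J id Y"
      using inj_onD[OF mu[unfolded tensor_T_eq_tensor_B[OF l]]] XY additive_map_closed[OF tJ(1)]
      unfolding k_def by blast
    then show "X = Y" using inj_onD[OF J\<Sigma>] XY by blast
  qed

  have b_can: "balanced B (dual A S) S C gcan"
  proof (rule balancedI)
    fix \<phi> b u assume \<phi>: "\<phi> \<in> carrier (dual A S)" and b: "b \<in> carrier B" and u: "u \<in> carrier S"
    show "gcan (\<phi> \<triangleleft>\<^bsub>dual A S\<^esub> b) u = gcan \<phi> (b \<odot>\<^bsub>S\<^esub> u)"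
      unfolding gcan_lact[OF S_functional_dual[OF \<phi>] b u]
      by (rule gcan_cong[OF S_functional_dual[OF dual_ract_closed[OF b \<phi>]] _ u])
        (simp add: dual_simps)
  qed (simp_all add: gcan_closed S_functional_dual additive_map_add[OF gcan_additive]
      additive_map_add[OF gcan_additive_left])
  have can_eq: "can C \<rho> = tlift C gcan"
    unfolding can_def gcan_def[abs_def] ..
  have can_add: "additive_map ?DS C (can C \<rho>)"
    unfolding can_eq by (rule DS.tlift_additive[OF aC b_can])
  have can_pure: "can C \<rho> (pure B (dual A S) S \<phi> u) = gcan \<phi> u"
    if "\<phi> \<in> carrier (dual A S)" "u \<in> carrier S" for \<phi> u
    unfolding can_eq by (rule DS.tlift_pure[OF aC b_can that])
  from can have bij: "bij_betw (can C \<rho>) (carrier ?DS) (carrier C)" by (simp add: can_iso_def)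

  define j where "j c = k (inv_into (carrier ?DS) (can C \<rho>) c)" for c
  have j_can: "j (can C \<rho> X) = k X" if "X \<in> carrier ?DS" for X
    using inv_into_f_f[OF bij_betw_imp_inj_on[OF bij] that] by (simp add: j_def)
  have c_cases: "\<exists>X\<in>carrier ?DS. c = can C \<rho> X" if "c \<in> carrier C" for c
    using bij that by (auto simp: bij_betw_def)
  have j_add: "additive_map C (star A C) j"
  proof (rule additive_mapI)
    fix c assume "c \<in> carrier C"
    then obtain X where X: "X \<in> carrier ?DS" "c = can C \<rho> X" using c_cases by blast
    then show "j c \<in> carrier (star A C)" by (simp add: j_can additive_map_closed[OF k_add])
    fix d assume "d \<in> carrier C"
    then obtain Y where Y: "Y \<in> carrier ?DS" "d = can C \<rho> Y" using c_cases by blast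
    show "j (c \<oplus>\<^bsub>C\<^esub> d) = j c \<oplus>\<^bsub>star A C\<^esub> j d"
      using X Y by (simp add: additive_map_add[OF can_add, symmetric] j_can additive_map_add[OF k_add])
  qed
  have j_inj: "inj_on j (carrier C)"
  proof (rule inj_onI)
    fix c d assume "c \<in> carrier C" "d \<in> carrier C" and eq: "j c = j d"
    then obtain X Y where XY: "X \<in> carrier ?DS" "c = can C \<rho> X" "Y \<in> carrier ?DS" "d = can C \<rho> Y"
      using c_cases by meson
    with eq have "k X = k Y" by (simp add: j_can)
    then have "X = Y" using XY by (intro inj_onD[OF k_inj])
    then show "c = d" using XY by simp
  qed

  \<comment> \<open>Since \<open>can\<close> is onto, linearity of \<open>j\<close> has to be checked only on the elements \<open>gcan \<phi> u\<close>.\<close>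
  have transfer: "j (\<alpha> c) = \<beta> (j c)"
    if \<alpha>: "additive_map C C \<alpha>" and \<beta>: "additive_map (star A C) (star A C) \<beta>" and c: "c \<in> carrier C"
      and eq: "\<And>\<phi> u. \<phi> \<in> carrier (dual A S) \<Longrightarrow> u \<in> carrier S
        \<Longrightarrow> j (\<alpha> (gcan \<phi> u)) = \<beta> (\<lambda>c\<in>carrier C. J \<phi> c u)" for \<alpha> \<beta> c
  proof -
    obtain X where X: "X \<in> carrier ?DS" "c = can C \<rho> X" using c_cases[OF c] by blast
    have "j (\<alpha> (can C \<rho> X)) = \<beta> (k X)"
      by (rule DS.additive_map_eq_on_pure[OF abelian_group_star
            additive_map_comp[OF additive_map_comp[OF can_add \<alpha>] j_add]
            additive_map_comp[OF k_add \<beta>] _ X(1)])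
        (simp add: can_pure k_pure eq)
    then show ?thesis using X by (simp add: j_can)
  qed
  have j_gcan: "j (gcan \<phi> u) = (\<lambda>c\<in>carrier C. J \<phi> c u)"
    if "\<phi> \<in> carrier (dual A S)" "u \<in> carrier S" for \<phi> u
    using j_can[OF DS.pure_closed[OF that]] can_pure[OF that] k_pure[OF that] by simp
  have j_lact: "j (a \<odot>\<^bsub>C\<^esub> c) = a \<odot>\<^bsub>star A C\<^esub> j c" if a: "a \<in> carrier A" and c: "c \<in> carrier C" for a c
  proof (rule transfer[OF additive_smult_C[OF a] _ c])
    show "additive_map (star A C) (star A C) (smult (star A C) a)"
    proof (rule additive_mapI)
      fix f assume f: "f \<in> carrier (star A C)"
      show "a \<odot>\<^bsub>star A C\<^esub> f \<in> carrier (star A C)"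
        using a C_functionalD[OF C_functional_star[OF f]]
        by (auto simp: star_simps C_simps C_lr intro!: C_functional_restrict C_functionalI)
    qed (use a in \<open>auto simp: star_simps C_simps intro!: restrict_ext\<close>)
    fix \<phi> u assume \<phi>: "\<phi> \<in> carrier (dual A S)" and u: "u \<in> carrier S"
    note \<phi>f = S_functional_dual[OF \<phi>]
    have "a \<odot>\<^bsub>C\<^esub> gcan \<phi> u = gcan (a \<odot>\<^bsub>dual A S\<^esub> \<phi>) u"
      unfolding gcan_lact_left[OF \<phi>f a u, symmetric]
      by (rule gcan_cong[OF S_functional_dual[OF dual_lact_closed[OF a \<phi>]] _ u, symmetric])
        (simp add: dual_simps)
    then have "j (a \<odot>\<^bsub>C\<^esub> gcan \<phi> u) = (\<lambda>c\<in>carrier C. J (a \<odot>\<^bsub>dual A S\<^esub> \<phi>) c u)"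
      using j_gcan[OF dual_lact_closed[OF a \<phi>] u] by simp
    also have "\<dots> = a \<odot>\<^bsub>star A C\<^esub> (\<lambda>c\<in>carrier C. J \<phi> c u)"
      unfolding left_linearD(2)[OF Jl(2) a \<phi>] using a
      by (auto simp: star_simps Q_A_B_simps C_simps intro!: restrict_ext)
    finally show "j (a \<odot>\<^bsub>C\<^esub> gcan \<phi> u) = a \<odot>\<^bsub>star A C\<^esub> (\<lambda>c\<in>carrier C. J \<phi> c u)" .
  qed
  have j_ract: "j (coring_act C c f) = j c \<otimes>\<^bsub>star A C\<^esub> f"
    if f: "f \<in> carrier (star A C)" and c: "c \<in> carrier C" for f c
  proof (rule transfer[OF coring_act_additive[OF C_functional_star[OF f]] _ c])
    note ff = C_functional_star[OF f]
    show "additive_map (star A C) (star A C) (\<lambda>g. g \<otimes>\<^bsub>star A C\<^esub> f)"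
    proof (rule additive_mapI)
      fix g assume g: "g \<in> carrier (star A C)"
      note gf = C_functional_star[OF g]
      show "g \<otimes>\<^bsub>star A C\<^esub> f \<in> carrier (star A C)"
        unfolding star_simps
        by (rule C_functional_restrict, rule C_functionalI)
          (simp_all add: C_functionalD[OF ff] coring_act_closed[OF gf] coring_act_add[OF gf]
            coring_act_lact[OF gf])
      fix h assume h: "h \<in> carrier (star A C)"
      have e: "f (coring_act C c (g \<oplus>\<^bsub>star A C\<^esub> h)) = f (coring_act C c g) \<oplus>\<^bsub>A\<^esub> f (coring_act C c h)"
        if "c \<in> carrier C" for c
        using coring_act_closed[OF gf that] coring_act_closed[OF C_functional_star[OF h] that]
        by (simp add: additive_map_add[OF coring_act_additive_right[OF that] g h] C_functionalD(2)[OF ff])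
      show "(g \<oplus>\<^bsub>star A C\<^esub> h) \<otimes>\<^bsub>star A C\<^esub> f = g \<otimes>\<^bsub>star A C\<^esub> f \<oplus>\<^bsub>star A C\<^esub> h \<otimes>\<^bsub>star A C\<^esub> f"
        unfolding star_simps(3) by (simp add: e cong: restrict_cong) (simp add: star_simps(1) cong: restrict_cong)
    qed
    fix \<phi> u assume \<phi>: "\<phi> \<in> carrier (dual A S)" and u: "u \<in> carrier S"
    note \<phi>f = S_functional_dual[OF \<phi>]
    have "j (coring_act C (gcan \<phi> u) f) = (\<lambda>c\<in>carrier C. J \<phi> c (S_act u f))"
      unfolding gcan_S_act[OF \<phi>f ff u, symmetric] by (rule j_gcan[OF \<phi> S_act_closed[OF ff u]])
    also have "\<dots> = (\<lambda>c\<in>carrier C. f (coring_act C c (\<lambda>y\<in>carrier C. J \<phi> y u)))"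
    proof (rule restrict_ext)
      fix c assume c: "c \<in> carrier C"
      show "J \<phi> c (S_act u f) = f (coring_act C c (\<lambda>y\<in>carrier C. J \<phi> y u))"
        unfolding functional_S_act[OF QD(4)[OF ex JQ[OF \<phi>] c] ff u] Q_gcan[OF ex JQ[OF \<phi>] c u] ..
    qed
    also have "\<dots> = (\<lambda>c\<in>carrier C. J \<phi> c u) \<otimes>\<^bsub>star A C\<^esub> f" by (simp add: star_simps)
    finally show "j (coring_act C (gcan \<phi> u) f) = (\<lambda>c\<in>carrier C. J \<phi> c u) \<otimes>\<^bsub>star A C\<^esub> f" .
  qed
  have "additive_map (coring_A_star C) (star_A_star A C) j"
    using j_add by (simp add: additive_map_def hom_def coring_A_star_def star_A_star_def)
  then have "bimodule_mono A (star A C) (coring_A_star C) (star_A_star A C) j"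
    using j_inj j_lact j_ract
    by (simp add: bimodule_mono_def bimodule_map_def left_linear_def right_linear_def
        coring_A_star_def star_A_star_def)
  then show ?thesis using lp by (auto simp: right_coFrobenius_def)
qed

end

theorem proposition6p2:
  fixes A :: "'a ring" and B :: "'b ring" and C :: "('a, 'c) coring"
    and S :: "('b, 'a, 's) bimod" and \<rho> :: "'s \<Rightarrow> ('s, 'c) tens"
    and U :: "('a, 'b, 'c, 's) universe itself"
  assumes "coring A C" and "fgp_bicomodule U B A C S \<rho>"
  shows "(right_coFrobenius A C \<longrightarrow>
            (\<exists>J. bimodule_mono A B (dual A S) (Q_A_B A C S \<rho>) J)) \<and>
         (locally_projective A C \<and> rat_dense A C \<and>
          l_map S \<in> ring_iso B (T_ring A C S \<rho>) \<and> tau_surjective A C S \<rho> \<and>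
          (can_iso B A C S \<rho> \<and> faithfully_flat U B S) \<and>
          (can_iso B A C S \<rho> \<and> flat U B S) \<and>
          comodule_generator U A C S \<rho> \<and>
          (comodule_projective U A C S \<rho> \<and> comodule_generator U A C S \<rho>) \<and>
          firm_progenerator U (star_rat A C) (S_T_star S \<rho>) \<and>
          mu_surjective_rat A C S \<rho> \<and>
          restricted_context_strict A C S \<rho> \<and>
          comodule_equivalence U B A C S \<rho> \<and>
          comodule_evaluation_isos U B A C S \<rho> \<and>
          (\<exists>J. bimodule_mono A B (dual A S) (Q_A_B A C S \<rho>) J)
          \<longrightarrow> right_coFrobenius A C)"
proof -
  interpret cor: coring A C by fact
  interpret com: fgp_bicomodule U B A C S \<rho> by fact
  interpret bicomodule_setting U A B C S \<rho>
    by (intro bicomodule_setting.intro cor.left.R.ring_axioms com.left.R.ring_axioms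
        cor.left.M.abelian_group_axioms com.left.M.abelian_group_axioms assms)
  let ?Q = "Q_A_B A C S \<rho>"
  \<comment> \<open>\<open>\<Sigma>\<close>, the functions \<open>'s \<Rightarrow> 'a\<close> and, uncurried, the elements of \<open>Q\<close> embed into the universe.\<close>
  have inf: "infinite (UNIV :: ('a + 'b + 'c + 's + nat) set)"
    by (simp add: finite_Plus_UNIV_iff)
  let ?a = "Inl :: 'a \<Rightarrow> 'a + 'b + 'c + 's + nat"
  let ?c = "(\<lambda>x. Inr (Inr (Inl x))) :: 'c \<Rightarrow> 'a + 'b + 'c + 's + nat"
  let ?s = "(\<lambda>x. Inr (Inr (Inr (Inl x)))) :: 's \<Rightarrow> 'a + 'b + 'c + 's + nat"
  have ia: "inj ?a" and ic: "inj ?c" and i_s: "inj ?s" by (auto intro: injI)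
  obtain p :: "('a + 'b + 'c + 's + nat) \<times> ('a + 'b + 'c + 's + nat) \<Rightarrow> 'a + 'b + 'c + 's + nat"
    where p: "inj p" using ex_inj_pair[OF inf] by blast
  have iS: "inj (\<lambda>x. {?s x})" by (auto intro: injI)
  obtain iD :: "('s \<Rightarrow> 'a) \<Rightarrow> ('a, 'b, 'c, 's) universe" where iD: "inj iD"
    using ex_inj_fun[OF inf i_s ia] by blast
  have ics: "inj (\<lambda>x. p (?c (fst x), ?s (snd x)))"
    by (rule injI) (use p in \<open>auto simp: inj_eq prod_eq_iff\<close>)
  obtain iQ' :: "('c \<times> 's \<Rightarrow> 'a) \<Rightarrow> ('a, 'b, 'c, 's) universe" where iQ': "inj iQ'"
    using ex_inj_fun[OF inf ics ia] by blast
  have iQ: "inj (\<lambda>q. iQ' (case_prod q))"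
    by (rule injI) (metis injD[OF iQ'] curry_case_prod)
  have ex: "\<exists>es. dual_basis A S es" by (rule ex_dual_basis[OF iD iS])
  have "right_coFrobenius A C"
    if lp: "locally_projective A C" and l: "l_map S \<in> ring_iso B (T_ring A C S \<rho>)"
      and can: "can_iso B A C S \<rho>" and flat: "flat U B S"
      and strict: "restricted_context_strict A C S \<rho>"
      and J: "bimodule_mono A B (dual A S) ?Q J" for J
  proof (rule mono_imp_coFrobenius[OF ex lp _ can _ J])
    show "l_map S ` carrier B = carrier (T_ring A C S \<rho>)"
      using l by (simp add: ring_iso_def bij_betw_def)
    show "inj_on (mu A C) (carrier (tensor (T_ring A C S \<rho>) (Q_star_T A C S \<rho>) (S_T_star S \<rho>)))"
      using strict by (simp add: restricted_context_strict_def bij_betw_def)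
    show "inj_on (tensor_map B ?Q S J id) (carrier (tensor B (dual A S) S))"
      using J
      by (intro flat_inj_tensor_map[OF flat dual_right_module Q_right_module[OF ex] com.left.M.abelian_group_axioms
            _ inj_on_subset[OF iD] inj_on_subset[OF iQ]])
        (auto simp: S_simps bimodule_mono_def bimodule_map_def)
  qed
  then show ?thesis using coFrobenius_imp_mono[OF ex] by blast
qed

end
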